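(* Any language $\mathcal{L}_{\alpha_1,\beta_1,\gamma_1,\delta_1}$ can be (validly) encoded into any language $\mathcal{L}_{\alpha_2,\beta_2,\gamma_2,I}$. That is, intensionality alone is sufficient to encode synchronicity, polyadicity, channel-based communication, and pattern-matching.
   Context: Setting. Names $a,b,c,\dots$; terms $s,t ::= a \mid s\bullet t$. Patterns: binding names $x$; $m ::= x \mid \ulcorner a\urcorner$; $p,q ::= m \mid p\bullet q$. Processes $P,Q ::= \mathbf{0} \mid OutProc \mid IN.P \mid (\nu n)P \mid P|Q \mid \mathsf{if}\ s=t\ \mathsf{then}\ P\ \mathsf{else}\ Q \mid *P \mid \mathit{Succ}$, with $\mathit{Succ}$ the success process. The 24 languages $\mathcal{L}_{\alpha,\beta,\gamma,\delta}$: $\alpha\in\{A,S\}$ (asynchronous: outputs without continuation; synchronous: with continuation); $\beta\in\{M,P\}$ (monadic/polyadic tuples); $\gamma\in\{D,C\}$ (dataspace: no channel; channel-based: $s(\tilde p).P$, $\overline{s}\langle\tilde t\rangle$); $\delta\in\{NO,NM,I\}$ (binding names only; name-matching patterns $m$; intensional patterns $p$ with terms as data/channels). Matching: $\{t/\!\!/x\}=\{t/x\}$, $\{a/\!\!/\ulcorner a\urcorner\}=\{\}$, $\{s\bullet t/\!\!/p\bullet q\}=\{s/\!\!/p\}\cup\{t/\!\!/q\}$, else undefined; tuples pointwise. Reduction: matching output and input (same channel if channel-based) reduce, applying the match substitution to the input continuation; closed under $|$, $\nu$, structural congruence. $P\Downarrow$ means $P\Rightarrow P'\equiv P''|\mathit{Succ}$.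 A valid encoding satisfies compositionality, name invariance, operational correspondence (up to a reduction-sensitive behavioural equivalence of the target), divergence reflection, and success sensitiveness. Trivial encodings exist whenever each feature of the source is $\le$ that of the target under $A\le S$, $M\le P$, $D\le C$, $NO\le NM\le I$. *)

theory Defs
  imports Main
begin

section \<open>Terms, patterns and processes\<close>

type_synonym name = nat

datatype tm = Nm name | Cmp tm tm

datatype pat = Bind name | Match name | PCmp pat pat

text \<open>
  One raw syntax is shared by all languages; the individual languages are carved out of it below.
  The optional term is the channel (absent in dataspace-based languages), the list is the tuple.
  \<open>Out\<close> is the asynchronous output, \<open>OutC\<close> the synchronous output with its continuation.
\<close>

datatype proc =
    Null
  | Out "tm option" "tm list"
  | OutC "tm option" "tm list" proc
  | In "tm option" "pat list" proc
  | Res name proc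
  | Par proc proc
  | Cond tm tm proc proc
  | Rep proc
  | Succ

primrec names_tm :: "tm \<Rightarrow> name set" where
  "names_tm (Nm a) = {a}"
| "names_tm (Cmp s t) = names_tm s \<union> names_tm t"

primrec match_names :: "pat \<Rightarrow> name set" where
  "match_names (Bind x) = {}"
| "match_names (Match a) = {a}"
| "match_names (PCmp p q) = match_names p \<union> match_names q"

primrec binders_pat :: "pat \<Rightarrow> name list" where
  "binders_pat (Bind x) = [x]"
| "binders_pat (Match a) = []"
| "binders_pat (PCmp p q) = binders_pat p @ binders_pat q"

definition binders :: "pat list \<Rightarrow> name list" where
  "binders ps = concat (map binders_pat ps)"

definition fn_out :: "tm option \<Rightarrow> tm list \<Rightarrow> name set" where
  "fn_out ch ts = \<Union> (names_tm ` (set_option ch \<union> set ts))"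

definition fn_in :: "tm option \<Rightarrow> pat list \<Rightarrow> name set" where
  "fn_in ch ps = \<Union> (names_tm ` set_option ch) \<union> \<Union> (match_names ` set ps)"

primrec fn :: "proc \<Rightarrow> name set" where
  "fn Null = {}"
| "fn (Out ch ts) = fn_out ch ts"
| "fn (OutC ch ts P) = fn_out ch ts \<union> fn P"
| "fn (In ch ps P) = fn_in ch ps \<union> (fn P - set (binders ps))"
| "fn (Res n P) = fn P - {n}"
| "fn (Par P Q) = fn P \<union> fn Q"
| "fn (Cond s t P Q) = names_tm s \<union> names_tm t \<union> fn P \<union> fn Q"
| "fn (Rep P) = fn P"
| "fn Succ = {}"


section \<open>Substitution and alpha-equivalence\<close>

primrec subst_tm :: "(name \<Rightarrow> tm) \<Rightarrow> tm \<Rightarrow> tm" where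
  "subst_tm \<sigma> (Nm a) = \<sigma> a"
| "subst_tm \<sigma> (Cmp s t) = Cmp (subst_tm \<sigma> s) (subst_tm \<sigma> t)"

text \<open>Name-match of an arbitrary term, needed when a matched name is replaced by a compound.\<close>

primrec match_tm :: "tm \<Rightarrow> pat" where
  "match_tm (Nm a) = Match a"
| "match_tm (Cmp s t) = PCmp (match_tm s) (match_tm t)"

text \<open>\<open>\<rho>\<close> renames the binding names, \<open>\<sigma>\<close> substitutes for the matched names.\<close>

primrec subst_pat :: "(name \<Rightarrow> name) \<Rightarrow> (name \<Rightarrow> tm) \<Rightarrow> pat \<Rightarrow> pat" where
  "subst_pat \<rho> \<sigma> (Bind x) = Bind (\<rho> x)"
| "subst_pat \<rho> \<sigma> (Match a) = match_tm (\<sigma> a)"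
| "subst_pat \<rho> \<sigma> (PCmp p q) = PCmp (subst_pat \<rho> \<sigma> p) (subst_pat \<rho> \<sigma> q)"

text \<open>All names from \<open>fresh A\<close> onwards lie outside the finite set \<open>A\<close>.\<close>

definition fresh :: "name set \<Rightarrow> name" where
  "fresh A = (LEAST m. \<forall>a\<in>A. a < m)"

definition rename_list :: "name list \<Rightarrow> name \<Rightarrow> name \<Rightarrow> name" where
  "rename_list xs m x = (case map_of (zip xs [m..<m + length xs]) x of Some y \<Rightarrow> y | None \<Rightarrow> x)"

definition under_binders :: "name set \<Rightarrow> (name \<Rightarrow> name) \<Rightarrow> (name \<Rightarrow> tm) \<Rightarrow> name \<Rightarrow> tm" where
  "under_binders X \<rho> \<sigma> b = (if b \<in> X then Nm (\<rho> b) else \<sigma> b)"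

text \<open>
  Capture-avoiding parallel substitution. Every binder is renamed, whether or not capture threatens,
  to fresh names that depend only on the free names of the result; so the outcome is the intended
  one up to alpha-equivalence.
\<close>

primrec subst :: "(name \<Rightarrow> tm) \<Rightarrow> proc \<Rightarrow> proc" where
  "subst \<sigma> Null = Null"
| "subst \<sigma> (Out ch ts) = Out (map_option (subst_tm \<sigma>) ch) (map (subst_tm \<sigma>) ts)"
| "subst \<sigma> (OutC ch ts P) =
     OutC (map_option (subst_tm \<sigma>) ch) (map (subst_tm \<sigma>) ts) (subst \<sigma> P)"
| "subst \<sigma> (In ch ps P) =
     (let xs = binders ps;
          \<rho> = rename_list xs (fresh (\<Union>b\<in>fn P - set xs. names_tm (\<sigma> b)))
      in In (map_option (subst_tm \<sigma>) ch) (map (subst_pat \<rho> \<sigma>) ps)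
           (subst (under_binders (set xs) \<rho> \<sigma>) P))"
| "subst \<sigma> (Res n P) =
     (let m = fresh (\<Union>b\<in>fn P - {n}. names_tm (\<sigma> b))
      in Res m (subst (\<sigma>(n := Nm m)) P))"
| "subst \<sigma> (Par P Q) = Par (subst \<sigma> P) (subst \<sigma> Q)"
| "subst \<sigma> (Cond s t P Q) = Cond (subst_tm \<sigma> s) (subst_tm \<sigma> t) (subst \<sigma> P) (subst \<sigma> Q)"
| "subst \<sigma> (Rep P) = Rep (subst \<sigma> P)"
| "subst \<sigma> Succ = Succ"

definition rename :: "(name \<Rightarrow> name) \<Rightarrow> proc \<Rightarrow> proc" where
  "rename f = subst (\<lambda>a. Nm (f a))"

definition name_subst :: "(name \<Rightarrow> name) \<Rightarrow> bool" where
  "name_subst f \<longleftrightarrow> finite {a. f a \<noteq> a}"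

inductive alpha :: "proc \<Rightarrow> proc \<Rightarrow> bool" (infix \<open>=\<^sub>\<alpha>\<close> 50) where
  alpha_refl: "P =\<^sub>\<alpha> P"
| alpha_sym: "P =\<^sub>\<alpha> Q \<Longrightarrow> Q =\<^sub>\<alpha> P"
| alpha_trans: "P =\<^sub>\<alpha> Q \<Longrightarrow> Q =\<^sub>\<alpha> R \<Longrightarrow> P =\<^sub>\<alpha> R"
| alpha_Res: "m \<notin> fn P - {n} \<Longrightarrow> Res n P =\<^sub>\<alpha> Res m (rename (id(n := m)) P)"
| alpha_In: "inj_on \<rho> (set (binders ps)) \<Longrightarrow> \<rho> ` set (binders ps) \<inter> (fn P - set (binders ps)) = {} \<Longrightarrow>
    In ch ps P =\<^sub>\<alpha>
      In ch (map (subst_pat \<rho> Nm) ps) (subst (under_binders (set (binders ps)) \<rho> Nm) P)"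
| alpha_cong_OutC: "P =\<^sub>\<alpha> P' \<Longrightarrow> OutC ch ts P =\<^sub>\<alpha> OutC ch ts P'"
| alpha_cong_In: "P =\<^sub>\<alpha> P' \<Longrightarrow> In ch ps P =\<^sub>\<alpha> In ch ps P'"
| alpha_cong_Res: "P =\<^sub>\<alpha> P' \<Longrightarrow> Res n P =\<^sub>\<alpha> Res n P'"
| alpha_cong_Par: "P =\<^sub>\<alpha> P' \<Longrightarrow> Q =\<^sub>\<alpha> Q' \<Longrightarrow> Par P Q =\<^sub>\<alpha> Par P' Q'"
| alpha_cong_Cond: "P =\<^sub>\<alpha> P' \<Longrightarrow> Q =\<^sub>\<alpha> Q' \<Longrightarrow> Cond s t P Q =\<^sub>\<alpha> Cond s t P' Q'"
| alpha_cong_Rep: "P =\<^sub>\<alpha> P' \<Longrightarrow> Rep P =\<^sub>\<alpha> Rep P'"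


section \<open>The twenty-four languages\<close>

datatype synchronism = Asynchronous | Synchronous
datatype arity = Monadic | Polyadic
datatype medium = Dataspace | Channel
datatype matching = NoMatch | NameMatch | Intensional

datatype lang =
  Lang (synchronism: synchronism) (arity: arity) (medium: medium) (matching: matching)

text \<open>Terms usable as data and channels: only names, unless the language is intensional.\<close>

definition ok_tm :: "lang \<Rightarrow> tm \<Rightarrow> bool" where
  "ok_tm L t \<longleftrightarrow> matching L = Intensional \<or> (\<exists>a. t = Nm a)"

definition ok_pat :: "lang \<Rightarrow> pat \<Rightarrow> bool" where
  "ok_pat L p \<longleftrightarrow>
     (case matching L of
        NoMatch \<Rightarrow> (\<exists>x. p = Bind x)
      | NameMatch \<Rightarrow> (\<exists>x. p = Bind x) \<or> (\<exists>a. p = Match a)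
      | Intensional \<Rightarrow> True)"

definition ok_channel :: "lang \<Rightarrow> tm option \<Rightarrow> bool" where
  "ok_channel L ch \<longleftrightarrow>
     (case medium L of
        Dataspace \<Rightarrow> ch = None
      | Channel \<Rightarrow> (\<exists>s. ch = Some s \<and> ok_tm L s))"

definition ok_arity :: "lang \<Rightarrow> 'a list \<Rightarrow> bool" where
  "ok_arity L xs \<longleftrightarrow> arity L = Monadic \<longrightarrow> length xs = 1"

definition ok_out :: "lang \<Rightarrow> tm option \<Rightarrow> tm list \<Rightarrow> bool" where
  "ok_out L ch ts \<longleftrightarrow> ok_channel L ch \<and> ok_arity L ts \<and> (\<forall>t\<in>set ts. ok_tm L t)"

text \<open>Inputs are well-formed: no binding name occurs twice.\<close>

definition ok_in :: "lang \<Rightarrow> tm option \<Rightarrow> pat list \<Rightarrow> bool" where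
  "ok_in L ch ps \<longleftrightarrow>
     ok_channel L ch \<and> ok_arity L ps \<and> (\<forall>p\<in>set ps. ok_pat L p) \<and> distinct (binders ps)"

primrec in_lang :: "lang \<Rightarrow> proc \<Rightarrow> bool" where
  "in_lang L Null \<longleftrightarrow> True"
| "in_lang L (Out ch ts) \<longleftrightarrow> synchronism L = Asynchronous \<and> ok_out L ch ts"
| "in_lang L (OutC ch ts P) \<longleftrightarrow> synchronism L = Synchronous \<and> ok_out L ch ts \<and> in_lang L P"
| "in_lang L (In ch ps P) \<longleftrightarrow> ok_in L ch ps \<and> in_lang L P"
| "in_lang L (Res n P) \<longleftrightarrow> in_lang L P"
| "in_lang L (Par P Q) \<longleftrightarrow> in_lang L P \<and> in_lang L Q"
| "in_lang L (Cond s t P Q) \<longleftrightarrow> in_lang L P \<and> in_lang L Q"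
| "in_lang L (Rep P) \<longleftrightarrow> in_lang L P"
| "in_lang L Succ \<longleftrightarrow> True"

definition procs :: "lang \<Rightarrow> proc set" where
  "procs L = {P. in_lang L P}"


section \<open>Operational semantics\<close>

text \<open>
  Matching yields a substitution with finite domain, or \<open>None\<close> where it is undefined.
  On well-formed inputs the maps joined by \<open>++\<close> have disjoint domains.
\<close>

fun match1 :: "tm \<Rightarrow> pat \<Rightarrow> (name \<rightharpoonup> tm) option" where
  "match1 t (Bind x) = Some [x \<mapsto> t]"
| "match1 (Nm a) (Match b) = (if a = b then Some Map.empty else None)"
| "match1 (Cmp s t) (PCmp p q) =
     (case (match1 s p, match1 t q) of
        (Some \<sigma>, Some \<rho>) \<Rightarrow> Some (\<sigma> ++ \<rho>)
      | _ \<Rightarrow> None)"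
| "match1 _ _ = None"

fun matches :: "tm list \<Rightarrow> pat list \<Rightarrow> (name \<rightharpoonup> tm) option" where
  "matches [] [] = Some Map.empty"
| "matches (t # ts) (p # ps) =
     (case (match1 t p, matches ts ps) of
        (Some \<sigma>, Some \<rho>) \<Rightarrow> Some (\<sigma> ++ \<rho>)
      | _ \<Rightarrow> None)"
| "matches _ _ = None"

definition map_subst :: "(name \<rightharpoonup> tm) \<Rightarrow> proc \<Rightarrow> proc" where
  "map_subst \<sigma> = subst (\<lambda>a. case \<sigma> a of Some t \<Rightarrow> t | None \<Rightarrow> Nm a)"

text \<open>
  Structural equivalence is closed under evaluation contexts only. Closing it under input prefixes
  would be unsound for the two conditional laws, since an input can later identify distinct names.
\<close>

inductive scong :: "lang \<Rightarrow> proc \<Rightarrow> proc \<Rightarrow> bool" for L where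
  sc_sym: "scong L P Q \<Longrightarrow> scong L Q P"
| sc_trans: "scong L P Q \<Longrightarrow> scong L Q R \<Longrightarrow> scong L P R"
| sc_Par: "scong L P P' \<Longrightarrow> Q \<in> procs L \<Longrightarrow> scong L (Par P Q) (Par P' Q)"
| sc_Res: "scong L P P' \<Longrightarrow> scong L (Res n P) (Res n P')"
| sc_alpha: "P \<in> procs L \<Longrightarrow> P' \<in> procs L \<Longrightarrow> P =\<^sub>\<alpha> P' \<Longrightarrow> scong L P P'"
| sc_par_nil: "P \<in> procs L \<Longrightarrow> scong L (Par P Null) P"
| sc_par_comm: "P \<in> procs L \<Longrightarrow> Q \<in> procs L \<Longrightarrow> scong L (Par P Q) (Par Q P)"
| sc_par_assoc: "P \<in> procs L \<Longrightarrow> Q \<in> procs L \<Longrightarrow> R \<in> procs L \<Longrightarrow>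
    scong L (Par P (Par Q R)) (Par (Par P Q) R)"
| sc_if_eq: "P \<in> procs L \<Longrightarrow> Q \<in> procs L \<Longrightarrow> s = t \<Longrightarrow> scong L (Cond s t P Q) P"
| sc_if_neq: "P \<in> procs L \<Longrightarrow> Q \<in> procs L \<Longrightarrow> s \<noteq> t \<Longrightarrow> scong L (Cond s t P Q) Q"
| sc_res_nil: "scong L (Res a Null) Null"
| sc_res_comm: "P \<in> procs L \<Longrightarrow> scong L (Res a (Res b P)) (Res b (Res a P))"
| sc_scope: "P \<in> procs L \<Longrightarrow> Q \<in> procs L \<Longrightarrow> a \<notin> fn P \<Longrightarrow>
    scong L (Par P (Res a Q)) (Res a (Par P Q))"
| sc_rep: "P \<in> procs L \<Longrightarrow> scong L (Rep P) (Par P (Rep P))"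

inductive red :: "lang \<Rightarrow> proc \<Rightarrow> proc \<Rightarrow> bool" for L where
  red_async: "Par (Out ch ts) (In ch ps Q) \<in> procs L \<Longrightarrow> matches ts ps = Some \<sigma> \<Longrightarrow>
    red L (Par (Out ch ts) (In ch ps Q)) (map_subst \<sigma> Q)"
| red_sync: "Par (OutC ch ts P) (In ch ps Q) \<in> procs L \<Longrightarrow> matches ts ps = Some \<sigma> \<Longrightarrow>
    red L (Par (OutC ch ts P) (In ch ps Q)) (Par P (map_subst \<sigma> Q))"
| red_Par: "red L P P' \<Longrightarrow> Q \<in> procs L \<Longrightarrow> red L (Par P Q) (Par P' Q)"
| red_Res: "red L P P' \<Longrightarrow> red L (Res n P) (Res n P')"
| red_scong: "scong L P Q \<Longrightarrow> red L Q Q' \<Longrightarrow> scong L Q' P' \<Longrightarrow> red L P P'"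

abbreviation reds :: "lang \<Rightarrow> proc \<Rightarrow> proc \<Rightarrow> bool" where
  "reds L \<equiv> (red L)\<^sup>*\<^sup>*"

definition diverges :: "lang \<Rightarrow> proc \<Rightarrow> bool" where
  "diverges L P \<longleftrightarrow> (\<exists>f. f 0 = P \<and> (\<forall>i::nat. red L (f i) (f (Suc i))))"

definition succeeds :: "lang \<Rightarrow> proc \<Rightarrow> bool" where
  "succeeds L P \<longleftrightarrow> (\<exists>P' P''. reds L P P' \<and> scong L P' (Par P'' Succ))"

text \<open>
  The reference behavioural equivalence of a language is a parameter: any equivalence that contains
  structural equivalence and is reduction-sensitive, such as a barbed equivalence.
\<close>

definition reference_equivalence :: "lang \<Rightarrow> proc rel \<Rightarrow> bool" where
  "reference_equivalence L E \<longleftrightarrow>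
     equiv (procs L) E \<and>
     (\<forall>P Q. scong L P Q \<longrightarrow> (P, Q) \<in> E) \<and>
     (\<forall>P Q. (P, Q) \<in> E \<and> (\<exists>Q'. red L Q Q') \<longrightarrow> (\<exists>P'. red L P P'))"


section \<open>Contexts and operators\<close>

datatype ctx =
    Hole nat
  | CNull
  | COut "tm option" "tm list"
  | COutC "tm option" "tm list" ctx
  | CIn "tm option" "pat list" ctx
  | CRes name ctx
  | CPar ctx ctx
  | CCond tm tm ctx ctx
  | CRep ctx
  | CSucc

text \<open>Filling a hole may capture free names of the process put into it.\<close>

primrec fill :: "ctx \<Rightarrow> (nat \<Rightarrow> proc) \<Rightarrow> proc" where
  "fill (Hole i) F = F i"
| "fill CNull F = Null"
| "fill (COut ch ts) F = Out ch ts"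
| "fill (COutC ch ts C) F = OutC ch ts (fill C F)"
| "fill (CIn ch ps C) F = In ch ps (fill C F)"
| "fill (CRes n C) F = Res n (fill C F)"
| "fill (CPar C D) F = Par (fill C F) (fill D F)"
| "fill (CCond s t C D) F = Cond s t (fill C F) (fill D F)"
| "fill (CRep C) F = Rep (fill C F)"
| "fill CSucc F = Succ"

primrec holes :: "ctx \<Rightarrow> nat list" where
  "holes (Hole i) = [i]"
| "holes CNull = []"
| "holes (COut ch ts) = []"
| "holes (COutC ch ts C) = holes C"
| "holes (CIn ch ps C) = holes C"
| "holes (CRes n C) = holes C"
| "holes (CPar C D) = holes C @ holes D"
| "holes (CCond s t C D) = holes C @ holes D"
| "holes (CRep C) = holes C"
| "holes CSucc = []"

text \<open>
  A \<open>k\<close>-ary context is a process in which \<open>k\<close> occurrences of \<open>Null\<close> are replaced by the holes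
  \<open>0, \<dots>, k - 1\<close>, each of them used exactly once.
\<close>

definition context_of :: "lang \<Rightarrow> nat \<Rightarrow> ctx \<Rightarrow> bool" where
  "context_of L k C \<longleftrightarrow>
     fill C (\<lambda>_. Null) \<in> procs L \<and> distinct (holes C) \<and> set (holes C) = {..<k}"

text \<open>
  A \<open>k\<close>-ary operator is a process constructor together with its parameters (terms, patterns, the
  restricted name); it is represented by the context that applies it to the holes.
\<close>

inductive operator :: "nat \<Rightarrow> ctx \<Rightarrow> bool" where
  "operator 0 CNull"
| "operator 0 (COut ch ts)"
| "operator 1 (COutC ch ts (Hole 0))"
| "operator 1 (CIn ch ps (Hole 0))"
| "operator 1 (CRes n (Hole 0))"
| "operator 2 (CPar (Hole 0) (Hole 1))"
| "operator 2 (CCond s t (Hole 0) (Hole 1))"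
| "operator 1 (CRep (Hole 0))"
| "operator 0 CSucc"


section \<open>Valid encodings\<close>

text \<open>
  Processes are identified up to alpha-equivalence, so a translation must respect it, and the
  equations required of a translation are understood up to it.
\<close>

definition encoding ::
  "lang \<Rightarrow> lang \<Rightarrow> (proc \<Rightarrow> proc) \<Rightarrow> (name \<Rightarrow> name list) \<Rightarrow> bool" where
  "encoding L1 L2 enc \<phi> \<longleftrightarrow>
     (\<forall>P\<in>procs L1. enc P \<in> procs L2) \<and>
     (\<forall>P\<in>procs L1. \<forall>Q\<in>procs L1. P =\<^sub>\<alpha> Q \<longrightarrow> enc P =\<^sub>\<alpha> enc Q) \<and>
     (\<exists>k>0. \<forall>a. length (\<phi> a) = k) \<and>
     (\<forall>a b. a \<noteq> b \<longrightarrow> set (\<phi> a) \<inter> set (\<phi> b) = {})"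

definition compositional :: "lang \<Rightarrow> lang \<Rightarrow> (proc \<Rightarrow> proc) \<Rightarrow> bool" where
  "compositional L1 L2 enc \<longleftrightarrow>
     (\<forall>k Op N. operator k Op \<and> context_of L1 k Op \<longrightarrow>
        (\<exists>C. context_of L2 k C \<and>
           (\<forall>S. (\<forall>i<k. S i \<in> procs L1) \<and> (\<Union>i<k. fn (S i)) = N \<longrightarrow>
              enc (fill Op S) =\<^sub>\<alpha> fill C (\<lambda>i. enc (S i)))))"

text \<open>
  The equation for \<open>\<sigma>'\<close> only constrains it on names that occur in some \<open>\<phi> a\<close>; the remaining,
  reserved, names stay fixed.
\<close>

definition name_invariant ::
  "lang \<Rightarrow> proc rel \<Rightarrow> (proc \<Rightarrow> proc) \<Rightarrow> (name \<Rightarrow> name list) \<Rightarrow> bool" where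
  "name_invariant L1 E enc \<phi> \<longleftrightarrow>
     (\<forall>S\<in>procs L1. \<forall>\<sigma>. name_subst \<sigma> \<longrightarrow>
        (\<exists>\<sigma>'. name_subst \<sigma>' \<and>
           (\<forall>a. \<phi> (\<sigma> a) = map \<sigma>' (\<phi> a)) \<and>
           (\<forall>b. b \<notin> (\<Union>a. set (\<phi> a)) \<longrightarrow> \<sigma>' b = b) \<and>
           (if inj \<sigma> then enc (rename \<sigma> S) =\<^sub>\<alpha> rename \<sigma>' (enc S)
            else (enc (rename \<sigma> S), rename \<sigma>' (enc S)) \<in> E)))"

definition operational_correspondence ::
  "lang \<Rightarrow> lang \<Rightarrow> proc rel \<Rightarrow> (proc \<Rightarrow> proc) \<Rightarrow> bool" where
  "operational_correspondence L1 L2 E enc \<longleftrightarrow>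
     (\<forall>S\<in>procs L1. \<forall>S'. reds L1 S S' \<longrightarrow> (\<exists>T. reds L2 (enc S) T \<and> (T, enc S') \<in> E)) \<and>
     (\<forall>S\<in>procs L1. \<forall>T. reds L2 (enc S) T \<longrightarrow>
        (\<exists>S' T'. reds L1 S S' \<and> reds L2 T T' \<and> (T', enc S') \<in> E))"

definition divergence_reflecting :: "lang \<Rightarrow> lang \<Rightarrow> (proc \<Rightarrow> proc) \<Rightarrow> bool" where
  "divergence_reflecting L1 L2 enc \<longleftrightarrow>
     (\<forall>S\<in>procs L1. diverges L2 (enc S) \<longrightarrow> diverges L1 S)"

definition success_sensitive :: "lang \<Rightarrow> lang \<Rightarrow> (proc \<Rightarrow> proc) \<Rightarrow> bool" where
  "success_sensitive L1 L2 enc \<longleftrightarrow>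
     (\<forall>S\<in>procs L1. succeeds L1 S \<longleftrightarrow> succeeds L2 (enc S))"

definition valid_encoding ::
  "lang \<Rightarrow> lang \<Rightarrow> proc rel \<Rightarrow> (proc \<Rightarrow> proc) \<Rightarrow> (name \<Rightarrow> name list) \<Rightarrow> bool" where
  "valid_encoding L1 L2 E enc \<phi> \<longleftrightarrow>
     encoding L1 L2 enc \<phi> \<and>
     compositional L1 L2 enc \<and>
     name_invariant L1 E enc \<phi> \<and>
     operational_correspondence L1 L2 E enc \<and>
     divergence_reflecting L1 L2 enc \<and>
     success_sensitive L1 L2 enc"

end

theory Submission
  imports Defs
begin

text \<open>
  A message \<open>t\<^sub>1,\<dots>,t\<^sub>k\<close> on a channel \<open>s\<close> is packed into one compound term, and input patterns are packed in
  the same way, so that intensional matching checks channel and arity. The compound also carries a fresh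
  name \<open>n\<close>; the receiver binds it and sends it back, which releases the continuation of the output. No other
  process can use the acknowledgement, because \<open>n\<close> is restricted and encoded inputs only accept compounds.

  Operational correspondence needs to know which reductions a process has up to structural equivalence. For
  this, processes are interpreted by de Bruijn terms, where alpha-equivalence is equality, and reduction
  is characterised there by a transition relation that follows the structure of the process and is invariant
  under structural equivalence. A target process reachable from an encoding is then the encoding of a source
  process with some acknowledgements pending, and every step either delivers one of these or is the first
  half of a source reduction.
\<close>

section \<open>De Bruijn interpretation\<close>

text \<open>The packing is unambiguous by shape alone: an absent channel becomes the reserved atom,
  a present one a compound, and a tuple becomes a spine of compounds closed by the reserved atom.
  Hence a packed pattern matches only packed tuples of its own length on its own channel, and a
  binder never swallows more than one component. Data are compounds and acknowledgements are atoms,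
  so both share one reserved channel, or the bare dataspace, without interference. The data exchange
  already commits the source step. Its acknowledgement has only one possible receiver, so a delay is
  harmless. The number of pending acknowledgements is a measure: each delivery lowers it, which
  gives divergence reflection, and all of them can be delivered, which gives the backward half of
  operational correspondence. The obstacle is that \<open>red\<close> is closed under
  \<open>scong\<close>, whose derivations run through arbitrary processes and renamings, so
  inversion on \<open>red\<close> says nothing about the shape of a process. The price of passing to
  transitions is a converse: each transition must be realised by a reduction between named processes
  of the right language.\<close>

datatype dpat = DBind | DMatch nat | DCmp dpat dpat

datatype dproc =
    DNull
  | DOut "tm option" "tm list"
  | DOutC "tm option" "tm list" dproc
  | DIn "tm option" "dpat list" dproc
  | DRes dproc
  | DPar dproc dproc
  | DCond tm tm dproc dproc
  | DRep dproc
  | DSucc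

primrec dmt :: "tm \<Rightarrow> dpat" where
  "dmt (Nm a) = DMatch a"
| "dmt (Cmp s t) = DCmp (dmt s) (dmt t)"

primrec nb :: "dpat \<Rightarrow> nat" where
  "nb DBind = 1"
| "nb (DMatch a) = 0"
| "nb (DCmp p q) = nb p + nb q"

definition nbs :: "dpat list \<Rightarrow> nat" where
  "nbs ps = sum_list (map nb ps)"

primrec dps :: "(nat \<Rightarrow> tm) \<Rightarrow> dpat \<Rightarrow> dpat" where
  "dps \<sigma> DBind = DBind"
| "dps \<sigma> (DMatch a) = dmt (\<sigma> a)"
| "dps \<sigma> (DCmp p q) = DCmp (dps \<sigma> p) (dps \<sigma> q)"

primrec dp :: "(name \<Rightarrow> tm) \<Rightarrow> pat \<Rightarrow> dpat" where
  "dp \<rho> (Bind x) = DBind"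
| "dp \<rho> (Match a) = dmt (\<rho> a)"
| "dp \<rho> (PCmp p q) = DCmp (dp \<rho> p) (dp \<rho> q)"

primrec pos :: "'a list \<Rightarrow> 'a \<Rightarrow> nat" where
  "pos [] x = 0"
| "pos (y # ys) x = (if x = y then 0 else Suc (pos ys x))"

definition sh :: "nat \<Rightarrow> tm \<Rightarrow> tm" where
  "sh k = subst_tm (\<lambda>i. Nm (i + k))"

text \<open>The first binder gets index 0, so the values that \<open>dmatch\<close> collects from
  left to right can be looked up by index in \<open>inst\<close>.\<close>

definition ext :: "name list \<Rightarrow> (name \<Rightarrow> tm) \<Rightarrow> name \<Rightarrow> tm" where
  "ext xs \<rho> a = (if a \<in> set xs then Nm (pos xs a) else sh (length xs) (\<rho> a))"

definition up :: "nat \<Rightarrow> (nat \<Rightarrow> tm) \<Rightarrow> nat \<Rightarrow> tm" where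
  "up k \<sigma> i = (if i < k then Nm i else sh k (\<sigma> (i - k)))"

text \<open>
  An environment assigns a term over de Bruijn indices to every name. Alpha-equivalent processes get the
  same interpretation, and substituting in a process amounts to changing the environment.
\<close>

primrec interp :: "(name \<Rightarrow> tm) \<Rightarrow> proc \<Rightarrow> dproc" where
  "interp \<rho> Null = DNull"
| "interp \<rho> (Out ch ts) = DOut (map_option (subst_tm \<rho>) ch) (map (subst_tm \<rho>) ts)"
| "interp \<rho> (OutC ch ts P) =
     DOutC (map_option (subst_tm \<rho>) ch) (map (subst_tm \<rho>) ts) (interp \<rho> P)"
| "interp \<rho> (In ch ps P) =
     DIn (map_option (subst_tm \<rho>) ch) (map (dp \<rho>) ps) (interp (ext (binders ps) \<rho>) P)"
| "interp \<rho> (Res n P) = DRes (interp (ext [n] \<rho>) P)"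
| "interp \<rho> (Par P Q) = DPar (interp \<rho> P) (interp \<rho> Q)"
| "interp \<rho> (Cond s t P Q) =
     DCond (subst_tm \<rho> s) (subst_tm \<rho> t) (interp \<rho> P) (interp \<rho> Q)"
| "interp \<rho> (Rep P) = DRep (interp \<rho> P)"
| "interp \<rho> Succ = DSucc"

primrec ds :: "(nat \<Rightarrow> tm) \<Rightarrow> dproc \<Rightarrow> dproc" where
  "ds \<sigma> DNull = DNull"
| "ds \<sigma> (DOut ch ts) = DOut (map_option (subst_tm \<sigma>) ch) (map (subst_tm \<sigma>) ts)"
| "ds \<sigma> (DOutC ch ts p) =
     DOutC (map_option (subst_tm \<sigma>) ch) (map (subst_tm \<sigma>) ts) (ds \<sigma> p)"
| "ds \<sigma> (DIn ch ps p) =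
     DIn (map_option (subst_tm \<sigma>) ch) (map (dps \<sigma>) ps) (ds (up (nbs ps) \<sigma>) p)"
| "ds \<sigma> (DRes p) = DRes (ds (up 1 \<sigma>) p)"
| "ds \<sigma> (DPar p q) = DPar (ds \<sigma> p) (ds \<sigma> q)"
| "ds \<sigma> (DCond s t p q) = DCond (subst_tm \<sigma> s) (subst_tm \<sigma> t) (ds \<sigma> p) (ds \<sigma> q)"
| "ds \<sigma> (DRep p) = DRep (ds \<sigma> p)"
| "ds \<sigma> DSucc = DSucc"

abbreviation rent :: "(nat \<Rightarrow> nat) \<Rightarrow> tm \<Rightarrow> tm" where
  "rent f \<equiv> subst_tm (\<lambda>i. Nm (f i))"

abbreviation rents :: "(nat \<Rightarrow> nat) \<Rightarrow> tm list \<Rightarrow> tm list" where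
  "rents f \<equiv> map (rent f)"

abbreviation rento :: "(nat \<Rightarrow> nat) \<Rightarrow> tm option \<Rightarrow> tm option" where
  "rento f \<equiv> map_option (rent f)"

abbreviation rdps :: "(nat \<Rightarrow> nat) \<Rightarrow> dpat \<Rightarrow> dpat" where
  "rdps f \<equiv> dps (\<lambda>i. Nm (f i))"

abbreviation ren :: "(nat \<Rightarrow> nat) \<Rightarrow> dproc \<Rightarrow> dproc" where
  "ren f \<equiv> ds (\<lambda>i. Nm (f i))"

abbreviation rdp :: "(name \<Rightarrow> nat) \<Rightarrow> pat \<Rightarrow> dpat" where
  "rdp f \<equiv> dp (\<lambda>a. Nm (f a))"

abbreviation nint :: "(name \<Rightarrow> nat) \<Rightarrow> proc \<Rightarrow> dproc" where
  "nint f \<equiv> interp (\<lambda>a. Nm (f a))"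

section \<open>Substitution lemmas for de Bruijn terms, patterns and processes\<close>

lemma pos_less: "x \<in> set xs \<Longrightarrow> pos xs x < length xs"
  by (induction xs) auto

lemma nth_pos: "x \<in> set xs \<Longrightarrow> xs ! pos xs x = x"
  by (induction xs) auto

lemma pos_inj: "x \<in> set xs \<Longrightarrow> y \<in> set xs \<Longrightarrow> pos xs x = pos xs y \<longleftrightarrow> x = y"
  by (metis nth_pos)

lemma pos_nth: "distinct xs \<Longrightarrow> i < length xs \<Longrightarrow> pos xs (xs ! i) = i"
  by (metis nth_eq_iff_index_eq nth_mem nth_pos pos_less)

lemma pos_map: "inj_on f (set xs) \<Longrightarrow> x \<in> set xs \<Longrightarrow> pos (map f xs) (f x) = pos xs x"
  by (induction xs) (auto simp: inj_on_def)

lemma subst_tm_comp: "subst_tm \<tau> (subst_tm \<sigma> t) = subst_tm (\<lambda>a. subst_tm \<tau> (\<sigma> a)) t"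
  by (induction t) auto

lemma subst_tm_Nm [simp]: "subst_tm Nm t = t"
  by (induction t) auto

lemma subst_tm_Nm_id [simp]: "subst_tm Nm = id"
  by (auto simp: fun_eq_iff)

lemma subst_tm_cong: "(\<And>a. a \<in> names_tm t \<Longrightarrow> \<sigma> a = \<tau> a) \<Longrightarrow> subst_tm \<sigma> t = subst_tm \<tau> t"
  by (induction t) auto

lemma sh_0 [simp]: "sh 0 = id"
  by (auto simp: sh_def)

lemma sh_Nm [simp]: "sh k (Nm i) = Nm (i + k)"
  by (simp add: sh_def)

lemma sh_subst: "sh k (subst_tm \<sigma> t) = subst_tm (\<lambda>a. sh k (\<sigma> a)) t"
  by (simp add: sh_def subst_tm_comp)

lemma subst_up_sh: "subst_tm (up k \<sigma>) (sh k t) = sh k (subst_tm \<sigma> t)"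
  by (simp add: sh_def subst_tm_comp up_def)

lemma up_Nm [simp]: "up k Nm = Nm"
  by (auto simp: up_def)

lemma up_up: "subst_tm (up k \<tau>) (up k \<sigma> i) = up k (\<lambda>a. subst_tm \<tau> (\<sigma> a)) i"
  by (auto simp: up_def[of k \<sigma>] up_def[of k "\<lambda>a. subst_tm \<tau> (\<sigma> a)"] subst_up_sh)
     (auto simp: up_def)

lemma up_ext: "subst_tm (up (length xs) \<tau>) (ext xs \<rho> a) = ext xs (\<lambda>a. subst_tm \<tau> (\<rho> a)) a"
  by (auto simp: ext_def subst_up_sh) (auto simp: up_def pos_less)

lemma dps_dmt [simp]: "dps \<sigma> (dmt t) = dmt (subst_tm \<sigma> t)"
  by (induction t) auto

lemma nb_dmt [simp]: "nb (dmt t) = 0"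
  by (induction t) auto

lemma nb_dps [simp]: "nb (dps \<sigma> p) = nb p"
  by (induction p) auto

lemma nbs_dps [simp]: "nbs (map (dps \<sigma>) ps) = nbs ps"
  by (simp add: nbs_def o_def)

lemma nbs_simps [simp]: "nbs [] = 0" "nbs (p # ps) = nb p + nbs ps"
  by (auto simp: nbs_def)

lemma binders_simps [simp]: "binders [] = []" "binders (p # ps) = binders_pat p @ binders ps"
  by (auto simp: binders_def)

lemma nb_dp [simp]: "nb (dp \<rho> p) = length (binders_pat p)"
  by (induction p) auto

lemma nbs_dp [simp]: "nbs (map (dp \<rho>) ps) = length (binders ps)"
  by (induction ps) auto

lemma dps_dps: "dps \<tau> (dps \<sigma> p) = dps (\<lambda>a. subst_tm \<tau> (\<sigma> a)) p"
  by (induction p) auto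

lemma dps_dp: "dps \<tau> (dp \<rho> p) = dp (\<lambda>a. subst_tm \<tau> (\<rho> a)) p"
  by (induction p) auto

lemma dp_match_tm [simp]: "dp \<rho> (match_tm t) = dmt (subst_tm \<rho> t)"
  by (induction t) auto

lemma dps_Nm [simp]: "dps Nm p = p"
  by (induction p) auto

lemma ds_Nm [simp]: "ds Nm d = d"
  by (induction d) (auto simp: map_idI option.map_id)

lemma ds_ds: "ds \<tau> (ds \<sigma> d) = ds (\<lambda>a. subst_tm \<tau> (\<sigma> a)) d"
  by (induction d arbitrary: \<sigma> \<tau>)
     (auto simp: option.map_comp o_def subst_tm_comp dps_dps up_up)

text \<open>A substitution after interpretation is absorbed by the environment. Weakening, exchange
  and the shift by 2 are later obtained as instances.\<close>

lemma ds_interp: "ds \<tau> (interp \<rho> P) = interp (\<lambda>a. subst_tm \<tau> (\<rho> a)) P"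
  by (induction P arbitrary: \<rho> \<tau>)
     (auto simp: option.map_comp o_def subst_tm_comp dps_dp up_ext up_ext[of "[_]", simplified])

lemma dp_cong: "(\<And>a. a \<in> match_names p \<Longrightarrow> \<rho> a = \<rho>' a) \<Longrightarrow> dp \<rho> p = dp \<rho>' p"
  by (induction p) auto

lemma subst_out_cong:
  assumes "\<And>a. a \<in> fn_out ch ts \<Longrightarrow> \<rho> a = \<rho>' a"
  shows "map_option (subst_tm \<rho>) ch = map_option (subst_tm \<rho>') ch"
    and "map (subst_tm \<rho>) ts = map (subst_tm \<rho>') ts"
proof -
  show "map_option (subst_tm \<rho>) ch = map_option (subst_tm \<rho>') ch"
    by (rule option.map_cong0, rule subst_tm_cong) (use assms in \<open>auto simp: fn_out_def\<close>)
  show "map (subst_tm \<rho>) ts = map (subst_tm \<rho>') ts"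
    by (rule list.map_cong0, rule subst_tm_cong) (use assms in \<open>auto simp: fn_out_def\<close>)
qed

lemma dp_in_cong:
  assumes "\<And>a. a \<in> fn_in ch ps \<Longrightarrow> \<rho> a = \<rho>' a"
  shows "map_option (subst_tm \<rho>) ch = map_option (subst_tm \<rho>') ch"
    and "map (dp \<rho>) ps = map (dp \<rho>') ps"
proof -
  show "map_option (subst_tm \<rho>) ch = map_option (subst_tm \<rho>') ch"
    by (rule option.map_cong0, rule subst_tm_cong) (use assms in \<open>auto simp: fn_in_def\<close>)
  show "map (dp \<rho>) ps = map (dp \<rho>') ps"
    by (rule list.map_cong0, rule dp_cong) (use assms in \<open>auto simp: fn_in_def\<close>)
qed

lemma interp_cong: "(\<And>a. a \<in> fn P \<Longrightarrow> \<rho> a = \<rho>' a) \<Longrightarrow> interp \<rho> P = interp \<rho>' P"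
proof (induction P arbitrary: \<rho> \<rho>')
  case (Out ch ts)
  then show ?case using subst_out_cong[of ch ts \<rho> \<rho>'] by simp
next
  case (OutC ch ts P)
  have "interp \<rho> P = interp \<rho>' P"
    by (rule OutC.IH) (simp add: OutC.prems)
  then show ?case using subst_out_cong[of ch ts \<rho> \<rho>'] OutC.prems by simp
next
  case (In ch ps P)
  have "interp (ext (binders ps) \<rho>) P = interp (ext (binders ps) \<rho>') P"
    by (rule In.IH) (simp add: ext_def In.prems)
  then show ?case using dp_in_cong[of ch ps \<rho> \<rho>'] In.prems by simp
next
  case (Res n P)
  have "interp (ext [n] \<rho>) P = interp (ext [n] \<rho>') P"
    by (rule Res.IH) (simp add: ext_def Res.prems)
  then show ?case by simp
next
  case (Par P Q)
  have "interp \<rho> P = interp \<rho>' P" by (rule Par.IH) (simp add: Par.prems)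
  moreover have "interp \<rho> Q = interp \<rho>' Q" by (rule Par.IH) (simp add: Par.prems)
  ultimately show ?case by simp
next
  case (Cond s t P Q)
  have "interp \<rho> P = interp \<rho>' P" by (rule Cond.IH) (simp add: Cond.prems)
  moreover have "interp \<rho> Q = interp \<rho>' Q" by (rule Cond.IH) (simp add: Cond.prems)
  moreover have "subst_tm \<rho> s = subst_tm \<rho>' s" by (rule subst_tm_cong) (simp add: Cond.prems)
  moreover have "subst_tm \<rho> t = subst_tm \<rho>' t" by (rule subst_tm_cong) (simp add: Cond.prems)
  ultimately show ?case by simp
next
  case (Rep P)
  have "interp \<rho> P = interp \<rho>' P" by (rule Rep.IH) (simp add: Rep.prems)
  then show ?case by simp
qed simp_all

section \<open>Fresh names and the soundness of interpretation for alpha-equivalence\<close>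

lemma finite_names_tm [simp]: "finite (names_tm t)"
  by (induction t) auto

lemma finite_match_names [simp]: "finite (match_names p)"
  by (induction p) auto

lemma finite_fn [simp]: "finite (fn P)"
  by (induction P) (auto simp: fn_out_def fn_in_def)

lemma less_fresh:
  assumes "finite A" "a \<in> A" shows "a < fresh A"
proof -
  obtain m where "\<forall>a\<in>A. a < m"
    using assms finite_nat_set_iff_bounded by auto
  then have "\<forall>a\<in>A. a < fresh A"
    unfolding fresh_def by (rule LeastI)
  then show ?thesis using assms by blast
qed

lemma map_of_zip_upt:
  "map_of (zip xs [m..<m + length xs]) x = (if x \<in> set xs then Some (m + pos xs x) else None)"
proof (induction xs arbitrary: m)
  case (Cons y ys)
  have "[m..<m + length (y # ys)] = m # [Suc m..<Suc m + length ys]"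
    by (subst upt_conv_Cons) auto
  then show ?case using Cons[of "Suc m"] by auto
qed auto

lemma rename_list_eq: "rename_list xs m x = (if x \<in> set xs then m + pos xs x else x)"
  by (simp add: rename_list_def map_of_zip_upt)

lemma rename_list_inj: "inj_on (rename_list xs m) (set xs)"
  by (auto simp: inj_on_def rename_list_eq pos_inj)

lemma rename_list_map: "distinct xs \<Longrightarrow> map (rename_list xs m) xs = [m..<m + length xs]"
  by (rule nth_equalityI) (auto simp: rename_list_eq pos_nth)

lemma binders_pat_match_tm [simp]: "binders_pat (match_tm t) = []"
  by (induction t) auto

lemma binders_pat_subst [simp]: "binders_pat (subst_pat \<rho> \<sigma> p) = map \<rho> (binders_pat p)"
  by (induction p) auto

lemma binders_subst [simp]: "binders (map (subst_pat \<rho> \<sigma>) ps) = map \<rho> (binders ps)"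
  by (induction ps) auto

lemma dp_subst_pat: "dp \<rho> (subst_pat \<rho>' \<sigma> p) = dp (\<lambda>a. subst_tm \<rho> (\<sigma> a)) p"
  by (induction p) auto

lemma ext_map_outside:
  "set (map r xs) \<inter> names_tm t = {} \<Longrightarrow>
    subst_tm (ext (map r xs) \<rho>) t = sh (length xs) (subst_tm \<rho> t)"
  unfolding sh_subst by (rule subst_tm_cong) (auto simp: ext_def)

text \<open>Injectivity of \<open>r\<close> keeps the position of every binder, and since the new
  names miss those in \<open>\<sigma> b\<close>, terms substituted for free names are merely
  weakened. The lemma serves both \<open>subst\<close> and the rule \<open>alpha_In\<close>.\<close>

lemma interp_under_binders:
  assumes "inj_on r (set xs)"
    and "\<And>b. b \<in> fn P - set xs \<Longrightarrow> r ` set xs \<inter> names_tm (\<sigma> b) = {}"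
  shows "interp (\<lambda>a. subst_tm (ext (map r xs) \<rho>) (under_binders (set xs) r \<sigma> a)) P =
         interp (ext xs (\<lambda>a. subst_tm \<rho> (\<sigma> a))) P"
proof (rule interp_cong)
  fix a assume a: "a \<in> fn P"
  show "subst_tm (ext (map r xs) \<rho>) (under_binders (set xs) r \<sigma> a) =
         ext xs (\<lambda>a. subst_tm \<rho> (\<sigma> a)) a"
  proof (cases "a \<in> set xs")
    case True
    then show ?thesis using assms(1) by (auto simp: under_binders_def ext_def pos_map)
  next
    case False
    then have "subst_tm (ext (map r xs) \<rho>) (\<sigma> a) = sh (length xs) (subst_tm \<rho> (\<sigma> a))"
      using assms(2)[of a] a by (intro ext_map_outside) auto
    then show ?thesis
      using False by (simp add: under_binders_def ext_def[of xs])
  qed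
qed

lemma interp_upd_binder:
  assumes "\<And>b. b \<in> fn P - {n} \<Longrightarrow> m \<notin> names_tm (\<sigma> b)"
  shows "interp (\<lambda>a. subst_tm (ext [m] \<rho>) ((\<sigma>(n := Nm m)) a)) P =
         interp (ext [n] (\<lambda>a. subst_tm \<rho> (\<sigma> a))) P"
proof -
  have "under_binders (set [n]) (\<lambda>_. m) \<sigma> = \<sigma>(n := Nm m)"
    by (auto simp: under_binders_def)
  moreover have "interp (\<lambda>a. subst_tm (ext (map (\<lambda>_. m) [n]) \<rho>) (under_binders (set [n]) (\<lambda>_. m) \<sigma> a)) P =
      interp (ext [n] (\<lambda>a. subst_tm \<rho> (\<sigma> a))) P"
    by (rule interp_under_binders) (use assms in simp_all)
  ultimately show ?thesis by (simp only: list.map)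
qed

text \<open>The binders chosen by \<open>subst\<close> lie at or above a strict bound on the names
  in the substituted terms, so they capture nothing. The bound exists because \<open>fn P\<close> is
  finite.\<close>

lemma interp_subst: "interp \<rho> (subst \<sigma> P) = interp (\<lambda>a. subst_tm \<rho> (\<sigma> a)) P"
proof (induction P arbitrary: \<rho> \<sigma>)
  case (In ch ps P)
  let ?A = "\<Union>b\<in>fn P - set (binders ps). names_tm (\<sigma> b)"
  define r where "r = rename_list (binders ps) (fresh ?A)"
  have inj: "inj_on r (set (binders ps))"
    by (simp add: r_def rename_list_inj)
  have "r ` set (binders ps) \<inter> names_tm (\<sigma> b) = {}" if b: "b \<in> fn P - set (binders ps)" for b
  proof -
    have "c < fresh ?A" if "c \<in> names_tm (\<sigma> b)" for c
      using b that by (intro less_fresh) auto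
    then show ?thesis by (fastforce simp: r_def rename_list_eq)
  qed
  then show ?case
    using interp_under_binders[OF inj, of P \<sigma> \<rho>]
    by (simp add: Let_def In.IH r_def[symmetric] option.map_comp o_def subst_tm_comp dp_subst_pat)
next
  case (Res n P)
  let ?A = "\<Union>b\<in>fn P - {n}. names_tm (\<sigma> b)"
  have "fresh ?A \<notin> names_tm (\<sigma> b)" if b: "b \<in> fn P - {n}" for b
  proof -
    have "c < fresh ?A" if "c \<in> names_tm (\<sigma> b)" for c
      using b that by (intro less_fresh) auto
    then show ?thesis by blast
  qed
  then show ?case
    using interp_upd_binder[of P n "fresh ?A" \<sigma> \<rho>] by (simp add: Let_def Res.IH)
qed (auto simp: option.map_comp o_def subst_tm_comp)

lemma interp_rename: "interp \<rho> (rename f P) = interp (\<lambda>a. \<rho> (f a)) P"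
  by (simp add: rename_def interp_subst)

lemma alpha_sound: "P =\<^sub>\<alpha> Q \<Longrightarrow> interp \<rho> P = interp \<rho> Q"
proof (induction arbitrary: \<rho> rule: alpha.induct)
  case (alpha_Res m P n)
  have "(\<lambda>a. subst_tm (ext [m] \<rho>) ((Nm(n := Nm m)) a)) = (\<lambda>a. ext [m] \<rho> ((id(n := m)) a))"
    by (simp add: fun_eq_iff)
  moreover have "interp (\<lambda>a. subst_tm (ext [m] \<rho>) ((Nm(n := Nm m)) a)) P =
      interp (ext [n] (\<lambda>a. subst_tm \<rho> (Nm a))) P"
    by (rule interp_upd_binder) (use alpha_Res in auto)
  ultimately show ?case by (simp add: interp_rename)
next
  case (alpha_In r ps P ch)
  have "interp (\<lambda>a. subst_tm (ext (map r (binders ps)) \<rho>) (under_binders (set (binders ps)) r Nm a)) P =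
      interp (ext (binders ps) (\<lambda>a. subst_tm \<rho> (Nm a))) P"
    by (rule interp_under_binders) (use alpha_In in auto)
  then show ?case
    by (simp add: interp_subst o_def dp_subst_pat)
qed auto

text \<open>Repeated binders would break the converse of \<open>alpha_sound\<close>: binder lists
  \<open>[x, x]\<close> and \<open>[x, y]\<close> give the same interpretation if \<open>y\<close>
  is not free in the body, but no injective renaming turns one into the other.\<close>

primrec pwf :: "proc \<Rightarrow> bool" where
  "pwf Null \<longleftrightarrow> True"
| "pwf (Out ch ts) \<longleftrightarrow> True"
| "pwf (OutC ch ts P) \<longleftrightarrow> pwf P"
| "pwf (In ch ps P) \<longleftrightarrow> distinct (binders ps) \<and> pwf P"
| "pwf (Res n P) \<longleftrightarrow> pwf P"
| "pwf (Par P Q) \<longleftrightarrow> pwf P \<and> pwf Q"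
| "pwf (Cond s t P Q) \<longleftrightarrow> pwf P \<and> pwf Q"
| "pwf (Rep P) \<longleftrightarrow> pwf P"
| "pwf Succ \<longleftrightarrow> True"

lemma pwf_subst [simp]: "pwf (subst \<sigma> P) \<longleftrightarrow> pwf P"
proof (induction P arbitrary: \<sigma>)
  case (In ch ps P)
  then show ?case
    by (simp add: Let_def distinct_map rename_list_inj)
qed (auto simp: Let_def)

definition enf :: "name list \<Rightarrow> (name \<Rightarrow> nat) \<Rightarrow> name \<Rightarrow> nat" where
  "enf xs f a = (if a \<in> set xs then pos xs a else f a + length xs)"

lemma ext_Nm: "ext xs (\<lambda>a. Nm (f a)) = (\<lambda>a. Nm (enf xs f a))"
  by (auto simp: ext_def enf_def)

lemma inj_enf: "inj f \<Longrightarrow> inj (enf xs f)"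
  unfolding inj_def enf_def by (metis add_right_cancel not_add_less2 pos_inj pos_less)

lemma subst_tm_inj: "inj f \<Longrightarrow> rent f s = rent f t \<longleftrightarrow> s = t"
proof (induction s arbitrary: t)
  case (Nm a) then show ?case by (cases t) (auto dest: injD)
next
  case (Cmp s1 s2) then show ?case by (cases t) auto
qed

lemma subst_tm_inj_list:
  "inj f \<Longrightarrow> rents f ss = rents f ts \<longleftrightarrow> ss = ts"
  by (rule inj_map_eq_map) (auto simp: inj_def subst_tm_inj)

lemma subst_tm_inj_option:
  "inj f \<Longrightarrow> rento f c = rento f c' \<longleftrightarrow> c = c'"
  by (cases c; cases c') (auto simp: subst_tm_inj)

text \<open>Interpretation forgets only the names of binders, so fixing the binder list restores
  injectivity. Counting binders shows where the list splits between the halves of a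
  compound.\<close>

lemma dp_inj:
  "inj f \<Longrightarrow> rdp f p = rdp f q \<Longrightarrow> binders_pat p = binders_pat q \<Longrightarrow> p = q"
proof (induction p arbitrary: q)
  case (Bind x) then show ?case by (cases q) auto
next
  case (Match x) then show ?case by (cases q) (auto dest: injD)
next
  case (PCmp p1 p2)
  then obtain q1 q2 where q: "q = PCmp q1 q2" "rdp f p1 = rdp f q1"
    "rdp f p2 = rdp f q2"
    by (cases q) auto
  then have "length (binders_pat p1) = length (binders_pat q1)"
    by (metis nb_dp)
  then have "binders_pat p1 = binders_pat q1" "binders_pat p2 = binders_pat q2"
    using PCmp.prems q(1) by auto
  then show ?case using PCmp q by auto
qed

lemma dp_inj_list:
  "inj f \<Longrightarrow> map (rdp f) ps = map (rdp f) qs \<Longrightarrow>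
    binders ps = binders qs \<Longrightarrow> ps = qs"
proof (induction ps arbitrary: qs)
  case (Cons p ps)
  then obtain q qs' where q: "qs = q # qs'" "rdp f p = rdp f q"
    "map (rdp f) ps = map (rdp f) qs'"
    by (cases qs) auto
  then have "length (binders_pat p) = length (binders_pat q)"
    by (metis nb_dp)
  then have "binders_pat p = binders_pat q" "binders ps = binders qs'"
    using Cons.prems q(1) by auto
  then show ?case using Cons q dp_inj by auto
qed auto

text \<open>Induction on the common interpretation, for all injective environments. The two sides
  may bind different names, so both are renamed to the same fresh ones by alpha-equivalence; then
  the bodies have equal interpretations in one environment and the induction hypothesis
  applies.\<close>

lemma alpha_complete:
  "nint f P = d \<Longrightarrow> nint f Q = d \<Longrightarrow> inj f \<Longrightarrow> pwf P \<Longrightarrow> pwf Q \<Longrightarrow> P =\<^sub>\<alpha> Q"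
proof (induction d arbitrary: f P Q)
  case DNull
  then show ?case by (cases P; simp; cases Q; simp add: alpha_refl)
next
  case (DOut c us)
  then obtain ch ts where "P = Out ch ts" "rento f ch = c" "rents f ts = us" by (cases P) auto
  then show ?case using DOut
    by (cases Q) (auto simp: subst_tm_inj_option subst_tm_inj_list alpha_refl)
next
  case (DOutC c us d)
  from DOutC.prems(1) obtain ch ts P' where P: "P = OutC ch ts P'" "rento f ch = c" "rents f ts = us" by (cases P) auto
  from DOutC.prems(2,3) P obtain Q' where "Q = OutC ch ts Q'"
    by (cases Q) (auto simp: subst_tm_inj_option subst_tm_inj_list)
  then show ?case using DOutC P(1) by (auto intro: alpha_cong_OutC)
next
  case (DIn c ds' d)
  note inj = \<open>inj f\<close>
  obtain ch ps P' where P: "P = In ch ps P'" "rento f ch = c" "map (rdp f) ps = ds'"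
    "interp (ext (binders ps) (\<lambda>a. Nm (f a))) P' = d"
    using DIn.prems(1) by (cases P) auto
  obtain qs Q' where Q: "Q = In ch qs Q'" "map (rdp f) qs = ds'"
    "interp (ext (binders qs) (\<lambda>a. Nm (f a))) Q' = d"
    using DIn.prems(2) inj P(2) by (cases Q) (auto simp: subst_tm_inj_option)
  define xs where "xs = binders ps"
  define ys where "ys = binders qs"
  \<comment> \<open>A bound on the free names of both bodies, so that one block of names starting at
    \<open>m\<close> can replace the binders on either side.\<close>
  define m where "m = fresh (fn P' \<union> fn Q')"
  have len: "length xs = length ys"
    using P(3) Q(2) nbs_dp unfolding xs_def ys_def by metis
  have dist: "distinct xs" "distinct ys"
    using DIn.prems P Q by (auto simp: xs_def ys_def)
  have fresh: "b < m" if "b \<in> fn P' \<union> fn Q'" for b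
    using that unfolding m_def by (intro less_fresh) auto
  define r1 where "r1 = rename_list xs m"
  define r2 where "r2 = rename_list ys m"
  have r: "map r1 xs = map r2 ys"
    using dist len by (simp add: r1_def r2_def rename_list_map)
  have i1: "inj_on r1 (set xs)" and i2: "inj_on r2 (set ys)"
    by (auto simp: r1_def r2_def rename_list_inj)
  have o1: "r1 ` set xs \<inter> fn P' = {}"
    using fresh by (fastforce simp: r1_def rename_list_eq)
  have o2: "r2 ` set ys \<inter> fn Q' = {}"
    using fresh by (fastforce simp: r2_def rename_list_eq)
  define P1 where "P1 = subst (under_binders (set xs) r1 Nm) P'"
  define Q1 where "Q1 = subst (under_binders (set ys) r2 Nm) Q'"
  have a1: "P =\<^sub>\<alpha> In ch (map (subst_pat r1 Nm) ps) P1"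
    unfolding P P1_def xs_def using i1 o1 by (intro alpha_In) (auto simp: xs_def)
  have a2: "Q =\<^sub>\<alpha> In ch (map (subst_pat r2 Nm) qs) Q1"
    unfolding Q Q1_def ys_def using i2 o2 by (intro alpha_In) (auto simp: ys_def)
  have ps: "map (subst_pat r1 Nm) ps = map (subst_pat r2 Nm) qs"
    using inj
  proof (rule dp_inj_list)
    show "map (rdp f) (map (subst_pat r1 Nm) ps) = map (rdp f) (map (subst_pat r2 Nm) qs)"
      using P(3) Q(2) by (simp add: o_def dp_subst_pat)
    show "binders (map (subst_pat r1 Nm) ps) = binders (map (subst_pat r2 Nm) qs)"
      using r by (simp add: xs_def ys_def)
  qed
  have e1: "interp (\<lambda>a. subst_tm (ext (map r1 xs) (\<lambda>a. Nm (f a))) (under_binders (set xs) r1 Nm a)) P' =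
      interp (ext xs (\<lambda>a. rent f (Nm a))) P'"
    by (rule interp_under_binders[OF i1]) (use o1 in auto)
  have e2: "interp (\<lambda>a. subst_tm (ext (map r2 ys) (\<lambda>a. Nm (f a))) (under_binders (set ys) r2 Nm a)) Q' =
      interp (ext ys (\<lambda>a. rent f (Nm a))) Q'"
    by (rule interp_under_binders[OF i2]) (use o2 in auto)
  have "interp (ext (map r1 xs) (\<lambda>a. Nm (f a))) P1 = d"
    using e1 P(4) by (simp add: P1_def interp_subst xs_def)
  moreover have "interp (ext (map r1 xs) (\<lambda>a. Nm (f a))) Q1 = d"
    using e2 Q(3) by (simp add: Q1_def interp_subst r ys_def)
  ultimately have "P1 =\<^sub>\<alpha> Q1"
    unfolding ext_Nm by (rule DIn.IH) (use DIn.prems P Q in \<open>simp_all add: P1_def Q1_def inj_enf\<close>)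
  then have "In ch (map (subst_pat r1 Nm) ps) P1 =\<^sub>\<alpha> In ch (map (subst_pat r2 Nm) qs) Q1"
    unfolding ps by (rule alpha_cong_In)
  then show ?case by (rule alpha_trans[OF a1 alpha_trans[OF _ alpha_sym[OF a2]]])
next
  case (DRes d)
  obtain n P' where P: "P = Res n P'" using DRes.prems(1) by (cases P) auto
  obtain k Q' where Q: "Q = Res k Q'" using DRes.prems(2) by (cases Q) auto
  define z where "z = fresh (fn P' \<union> fn Q')"
  have "b < z" if "b \<in> fn P' \<union> fn Q'" for b
    using that unfolding z_def by (intro less_fresh) auto
  then have z: "z \<notin> fn P'" "z \<notin> fn Q'" by blast+
  define P1 where "P1 = rename (id(n := z)) P'"
  define Q1 where "Q1 = rename (id(k := z)) Q'"
  have a1: "P =\<^sub>\<alpha> Res z P1" and a2: "Q =\<^sub>\<alpha> Res z Q1"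
    unfolding P Q P1_def Q1_def using z by (auto intro: alpha_Res)
  have "interp (ext [z] (\<lambda>a. Nm (f a))) P1 = d" "interp (ext [z] (\<lambda>a. Nm (f a))) Q1 = d"
    using alpha_sound[OF a1] alpha_sound[OF a2] DRes.prems by simp_all
  then have "P1 =\<^sub>\<alpha> Q1"
    unfolding ext_Nm
    by (rule DRes.IH) (use DRes.prems P Q in \<open>simp_all add: P1_def Q1_def inj_enf rename_def\<close>)
  then have "Res z P1 =\<^sub>\<alpha> Res z Q1" by (rule alpha_cong_Res)
  then show ?case by (rule alpha_trans[OF a1 alpha_trans[OF _ alpha_sym[OF a2]]])
next
  case (DPar d1 d2)
  from DPar.prems(1) obtain P1 P2 where "P = Par P1 P2" by (cases P) auto
  moreover from DPar.prems(2) obtain Q1 Q2 where "Q = Par Q1 Q2" by (cases Q) auto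
  ultimately show ?case using DPar by (auto intro: alpha_cong_Par)
next
  case (DCond s' t' d1 d2)
  from DCond.prems(1) obtain s t P1 P2 where P: "P = Cond s t P1 P2" "rent f s = s'" "rent f t = t'" by (cases P) auto
  from DCond.prems(2,3) P obtain Q1 Q2 where "Q = Cond s t Q1 Q2" by (cases Q) (auto simp: subst_tm_inj)
  then show ?case using DCond P by (auto intro: alpha_cong_Cond)
next
  case (DRep d)
  from DRep.prems(1) obtain P' where "P = Rep P'" by (cases P) auto
  moreover from DRep.prems(2) obtain Q' where "Q = Rep Q'" by (cases Q) auto
  ultimately show ?case using DRep by (auto intro: alpha_cong_Rep)
next
  case DSucc
  then show ?case by (cases P; simp; cases Q; simp add: alpha_refl)
qed

section \<open>Structural equivalence and transitions\<close>

definition upf :: "nat \<Rightarrow> (nat \<Rightarrow> nat) \<Rightarrow> nat \<Rightarrow> nat" where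
  "upf k f i = (if i < k then i else f (i - k) + k)"

definition swap01 :: "nat \<Rightarrow> nat" where
  "swap01 i = (if i = 0 then 1 else if i = 1 then 0 else i)"

lemma up_ren: "up k (\<lambda>i. Nm (f i)) = (\<lambda>i. Nm (upf k f i))"
  by (auto simp: up_def upf_def)

lemma inj_upf: "inj f \<Longrightarrow> inj (upf k f)"
  unfolding inj_def upf_def by (metis add_right_cancel le_add_diff_inverse2 not_add_less2 not_less)

lemma inj_swap01: "inj swap01"
  by (auto simp: inj_def swap01_def)

lemma upf_Suc: "upf (Suc 0) f (Suc i) = Suc (f i)"
  by (simp add: upf_def)

lemma swap01_swap01 [simp]: "swap01 (swap01 i) = i"
  by (simp add: swap01_def)

lemma swap01_SucSuc [simp]: "swap01 (Suc (Suc i)) = Suc (Suc i)"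
  by (simp add: swap01_def)

lemma swap01_Suc: "swap01 (Suc i) = upf (Suc 0) Suc i"
  by (simp add: swap01_def upf_def)

lemma swap01_upf_Suc [simp]: "swap01 (upf (Suc 0) Suc i) = Suc i"
  by (simp add: swap01_def upf_def)

lemma upf_upf_swap01: "upf (Suc 0) (upf (Suc 0) f) (swap01 i) = swap01 (upf (Suc 0) (upf (Suc 0) f) i)"
  by (auto simp: upf_def swap01_def)

lemma ren_DRes: "ren f (DRes p) = DRes (ren (upf 1 f) p)"
  by (simp add: up_ren)

fun dmatch :: "tm \<Rightarrow> dpat \<Rightarrow> tm list option" where
  "dmatch t DBind = Some [t]"
| "dmatch (Nm a) (DMatch b) = (if a = b then Some [] else None)"
| "dmatch (Cmp s t) (DCmp p q) =
     (case (dmatch s p, dmatch t q) of (Some vs, Some ws) \<Rightarrow> Some (vs @ ws) | _ \<Rightarrow> None)"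
| "dmatch _ _ = None"

fun dmatches :: "tm list \<Rightarrow> dpat list \<Rightarrow> tm list option" where
  "dmatches [] [] = Some []"
| "dmatches (t # ts) (p # ps) =
     (case (dmatch t p, dmatches ts ps) of (Some vs, Some ws) \<Rightarrow> Some (vs @ ws) | _ \<Rightarrow> None)"
| "dmatches _ _ = None"

definition inst :: "tm list \<Rightarrow> nat \<Rightarrow> tm" where
  "inst vs i = (if i < length vs then vs ! i else Nm (i - length vs))"

lemma dmatch_length: "dmatch t p = Some vs \<Longrightarrow> length vs = nb p"
  by (induction t p arbitrary: vs rule: dmatch.induct) (auto split: option.splits if_splits)

lemma dmatches_length: "dmatches ts ps = Some vs \<Longrightarrow> length vs = nbs ps"
  by (induction ts ps arbitrary: vs rule: dmatches.induct)
     (auto split: option.splits dest: dmatch_length)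

text \<open>The equation includes failure of a match, hence injectivity: a renaming that identifies
  two names would create new matches.\<close>

lemma dmatch_ren:
  "inj f \<Longrightarrow> dmatch (rent f t) (rdps f p) = map_option (rents f) (dmatch t p)"
  by (induction t p rule: dmatch.induct) (auto split: option.splits dest: injD)

lemma dmatches_ren:
  "inj f \<Longrightarrow> dmatches (rents f ts) (map (rdps f) ps) =
    map_option (rents f) (dmatches ts ps)"
  by (induction ts ps rule: dmatches.induct) (auto split: option.splits simp: dmatch_ren)

lemma ren_inst:
  "ren f (ds (inst vs) p) = ds (inst (rents f vs)) (ren (upf (length vs) f) p)"
  unfolding ds_ds by (rule arg_cong[where f = "\<lambda>\<sigma>. ds \<sigma> p"]) (auto simp: inst_def upf_def)

lemma ren_ren: "ren f (ren g p) = ren (\<lambda>i. f (g i)) p"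
  by (simp add: ds_ds)

text \<open>The laws for conditionals and replication, read as unfolding steps, are shared by \<open>dscong\<close> and the transitions.\<close>

inductive unfold :: "dproc \<Rightarrow> dproc \<Rightarrow> bool" where
  unfold_Rep: "unfold (DRep p) (DPar p (DRep p))"
| unfold_eq: "unfold (DCond s s p q) p"
| unfold_neq: "s \<noteq> t \<Longrightarrow> unfold (DCond s t p q) q"

inductive_simps unfold_simps [simp]:
  "unfold DNull x" "unfold (DOut ch ts) x" "unfold (DOutC ch ts p) x" "unfold (DIn ch ps p) x"
  "unfold (DRes p) x" "unfold (DPar p q) x" "unfold (DRep p) x" "unfold DSucc x"

lemma unfold_Cond [simp]: "unfold (DCond s t p q) x \<longleftrightarrow> x = (if s = t then p else q)"
  by (auto elim: unfold.cases intro: unfold.intros)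

text \<open>Elimination rules generated below contain an unfolding case for every constructor. Where
  the constructor never unfolds, its premise simplifies to \<open>False\<close>, and this rule lets
  the simplifier drop the case.\<close>

lemma False_implies_rule: "(False \<Longrightarrow> PROP A \<Longrightarrow> P) \<equiv> Trueprop True"
  by (rule equal_intr_rule) auto

lemmas no_unfold = unfold_simps False_implies_rule triv_forall_equality True_implies_equals

lemma unfold_ren: "unfold p q \<Longrightarrow> inj f \<Longrightarrow> unfold (ren f p) (ren f q)"
  by (cases p) (auto simp: subst_tm_inj)

lemma unfold_ren_inv: "unfold p q \<Longrightarrow> p = ren f p' \<Longrightarrow> inj f \<Longrightarrow> \<exists>q'. q = ren f q' \<and> unfold p' q'"
  by (cases p') (auto simp: subst_tm_inj)

text \<open>Renaming of bound names disappears. The side condition of scope extrusion turns into the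
  weakening \<open>ren Suc\<close>, and exchange of two restrictions needs
  \<open>swap01\<close>.\<close>

inductive dscong :: "dproc \<Rightarrow> dproc \<Rightarrow> bool" where
  dc_refl: "dscong p p"
| dc_sym: "dscong p q \<Longrightarrow> dscong q p"
| dc_trans: "dscong p q \<Longrightarrow> dscong q r \<Longrightarrow> dscong p r"
| dc_Par: "dscong p p' \<Longrightarrow> dscong (DPar p q) (DPar p' q)"
| dc_Res: "dscong p p' \<Longrightarrow> dscong (DRes p) (DRes p')"
| dc_par_nil: "dscong (DPar p DNull) p"
| dc_par_comm: "dscong (DPar p q) (DPar q p)"
| dc_par_assoc: "dscong (DPar p (DPar q r)) (DPar (DPar p q) r)"
| dc_res_nil: "dscong (DRes DNull) DNull"
| dc_res_comm: "dscong (DRes (DRes p)) (DRes (DRes (ren swap01 p)))"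
| dc_scope: "dscong (DPar p (DRes q)) (DRes (DPar (ren Suc p) q))"
| dc_unfold: "unfold p q \<Longrightarrow> dscong p q"

declare dc_refl [simp, intro] dc_trans [trans]

lemma dc_Par2: "dscong q q' \<Longrightarrow> dscong (DPar p q) (DPar p q')"
  by (rule dc_trans[OF dc_par_comm dc_trans[OF dc_Par dc_par_comm]])

lemma dc_par_assoc2: "dscong (DPar (DPar p q) r) (DPar p (DPar q r))"
  by (rule dc_sym[OF dc_par_assoc])

lemma dc_swap_right: "dscong (DPar (DPar p q) r) (DPar (DPar p r) q)"
  by (rule dc_trans[OF dc_par_assoc2 dc_trans[OF dc_Par2[OF dc_par_comm] dc_par_assoc]])

lemma dc_left_comm: "dscong (DPar p (DPar q r)) (DPar q (DPar p r))"
  by (rule dc_trans[OF dc_par_assoc dc_trans[OF dc_Par[OF dc_par_comm] dc_par_assoc2]])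

lemma dc_scope2: "dscong (DPar (DRes q) p) (DRes (DPar q (ren Suc p)))"
  by (rule dc_trans[OF dc_par_comm dc_trans[OF dc_scope dc_Res[OF dc_par_comm]]])

lemma dc_nil2: "dscong (DPar DNull p) p"
  by (rule dc_trans[OF dc_par_comm dc_par_nil])

text \<open>Garbage collection, derived by extruding over \<open>DRes DNull\<close>. It removes the
  private name of a handshake once the acknowledgement has been consumed.\<close>

lemma dc_res_unused: "dscong (DRes (ren Suc p)) p"
proof -
  have "dscong (DRes (ren Suc p)) (DRes (DPar (ren Suc p) DNull))"
    by (rule dc_Res[OF dc_sym[OF dc_par_nil]])
  also have "dscong \<dots> (DPar p (DRes DNull))"
    by (rule dc_sym[OF dc_scope])
  also have "dscong \<dots> (DPar p DNull)"
    by (rule dc_Par2[OF dc_res_nil])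
  also have "dscong \<dots> p"
    by (rule dc_par_nil)
  finally show ?thesis .
qed

lemma dscong_ren: "dscong p q \<Longrightarrow> inj f \<Longrightarrow> dscong (ren f p) (ren f q)"
proof (induction arbitrary: f rule: dscong.induct)
  case (dc_Res p p')
  then show ?case by (simp add: up_ren inj_upf dscong.dc_Res)
next
  case (dc_unfold p q)
  then show ?case by (intro dscong.dc_unfold unfold_ren)
next
  case (dc_res_comm p)
  have "ren (upf 1 (upf 1 f)) (ren swap01 p) = ren swap01 (ren (upf 1 (upf 1 f)) p)"
    by (simp add: ren_ren upf_upf_swap01)
  then show ?case using dscong.dc_res_comm by (simp add: up_ren)
next
  case (dc_scope p q)
  have "ren (upf 1 f) (ren Suc p) = ren Suc (ren f p)"
    by (simp add: ren_ren upf_Suc)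
  then show ?case using dscong.dc_scope[of "ren f p" "ren (upf 1 f) q"] by (simp add: up_ren)
qed (auto intro: dscong.intros)

text \<open>Early style: the label carries the received terms. It is shifted on passing a
  restriction, so a term received from outside never mentions the restricted index 0.\<close>

inductive inp :: "dproc \<Rightarrow> tm option \<Rightarrow> tm list \<Rightarrow> dproc \<Rightarrow> bool" where
  inp_In: "dmatches ts ps = Some vs \<Longrightarrow> inp (DIn ch ps p) ch ts (ds (inst vs) p)"
| inp_Par1: "inp p ch ts p' \<Longrightarrow> inp (DPar p q) ch ts (DPar p' q)"
| inp_Par2: "inp q ch ts q' \<Longrightarrow> inp (DPar p q) ch ts (DPar p q')"
| inp_Res: "inp p (rento Suc ch) (rents Suc ts) p' \<Longrightarrow> inp (DRes p) ch ts (DRes p')"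
| inp_unfold: "unfold p q \<Longrightarrow> inp q ch ts r \<Longrightarrow> inp p ch ts r"

inductive_cases inp_NullE0: "inp DNull ch ts x"
inductive_cases inp_OutE0: "inp (DOut c t) ch ts x"
inductive_cases inp_OutCE0: "inp (DOutC c t p) ch ts x"
inductive_cases inp_SuccE0: "inp DSucc ch ts x"
inductive_cases inp_InE0: "inp (DIn c ps p) ch ts x"
inductive_cases inp_ParE0: "inp (DPar p q) ch ts x"
inductive_cases inp_ResE0: "inp (DRes p) ch ts x"

lemmas inp_elims [elim!] = inp_NullE0[simplified no_unfold] inp_OutE0[simplified no_unfold]
  inp_OutCE0[simplified no_unfold] inp_SuccE0[simplified no_unfold] inp_InE0[simplified no_unfold]
lemmas inp_ParE [consumes 1] = inp_ParE0[simplified no_unfold]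
lemmas inp_ResE [consumes 1] = inp_ResE0[simplified no_unfold]

inductive out_thread :: "dproc \<Rightarrow> tm option \<Rightarrow> tm list \<Rightarrow> dproc \<Rightarrow> bool" where
  "out_thread (DOut ch ts) ch ts DNull"
| "out_thread (DOutC ch ts p) ch ts p"

inductive_simps out_thread_simps [simp]:
  "out_thread DNull c us x" "out_thread (DOut ch ts) c us x" "out_thread (DOutC ch ts p) c us x"
  "out_thread (DIn ch ps p) c us x" "out_thread (DRes p) c us x" "out_thread (DPar p q) c us x"
  "out_thread (DCond s t p q) c us x" "out_thread (DRep p) c us x" "out_thread DSucc c us x"

lemma out_thread_ren:
  "out_thread p ch ts p' \<Longrightarrow> out_thread (ren f p) (rento f ch) (rents f ts) (ren f p')"
  by (cases p) auto

lemma out_thread_ren_inv: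
  "out_thread (ren f p) ch ts q \<Longrightarrow>
    \<exists>c us p'. ch = rento f c \<and> ts = rents f us \<and> q = ren f p' \<and> out_thread p c us p'"
  by (cases p) auto

text \<open>
  \<open>send p x r\<close>: if \<open>p\<close> sends and \<open>x\<close> receives, their parallel composition becomes \<open>r\<close>. Carrying the
  receiver along, shifted under each restriction of \<open>p\<close>, makes labels for bound output unnecessary.
\<close>

inductive send :: "dproc \<Rightarrow> dproc \<Rightarrow> dproc \<Rightarrow> bool" where
  send_out: "out_thread p ch ts p' \<Longrightarrow> inp x ch ts x' \<Longrightarrow> send p x (DPar p' x')"
| send_Par1: "send p x r \<Longrightarrow> send (DPar p q) x (DPar r q)"
| send_Par2: "send q x r \<Longrightarrow> send (DPar p q) x (DPar p r)"
| send_Res: "send p (ren Suc x) r \<Longrightarrow> send (DRes p) x (DRes r)"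
| send_unfold: "unfold p q \<Longrightarrow> send q x r \<Longrightarrow> send p x r"

lemmas no_send = no_unfold out_thread_simps implies_True_equals

inductive_cases send_NullE0: "send DNull x r"
inductive_cases send_SuccE0: "send DSucc x r"
inductive_cases send_InE0: "send (DIn c ps p) x r"
inductive_cases send_ParE0: "send (DPar p q) x r"
inductive_cases send_ResE0: "send (DRes p) x r"

lemmas send_elims [elim!] = send_NullE0[simplified no_send] send_SuccE0[simplified no_send]
  send_InE0[simplified no_send]
lemmas send_ParE [consumes 1] = send_ParE0[simplified no_send]
lemmas send_ResE [consumes 1] = send_ResE0[simplified no_send]

inductive tau :: "dproc \<Rightarrow> dproc \<Rightarrow> bool" where
  tau_comm1: "send p q r \<Longrightarrow> tau (DPar p q) r"
| tau_comm2: "send q p r \<Longrightarrow> tau (DPar p q) r"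
| tau_Par1: "tau p p' \<Longrightarrow> tau (DPar p q) (DPar p' q)"
| tau_Par2: "tau q q' \<Longrightarrow> tau (DPar p q) (DPar p q')"
| tau_Res: "tau p p' \<Longrightarrow> tau (DRes p) (DRes p')"
| tau_unfold: "unfold p q \<Longrightarrow> tau q r \<Longrightarrow> tau p r"

inductive_cases tau_NullE0: "tau DNull r"
inductive_cases tau_SuccE0: "tau DSucc r"
inductive_cases tau_InE0: "tau (DIn c ps p) r"
inductive_cases tau_OutE0: "tau (DOut c ts) r"
inductive_cases tau_OutCE0: "tau (DOutC c ts p) r"
inductive_cases tau_ParE0: "tau (DPar p q) r"
inductive_cases tau_ResE0: "tau (DRes p) r"

lemmas tau_elims [elim!] = tau_NullE0[simplified no_unfold] tau_SuccE0[simplified no_unfold]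
  tau_InE0[simplified no_unfold] tau_OutE0[simplified no_unfold] tau_OutCE0[simplified no_unfold]
lemmas tau_ParE [consumes 1] = tau_ParE0[simplified no_unfold]
lemmas tau_ResE [consumes 1] = tau_ResE0[simplified no_unfold]

text \<open>Only conditionals and replications unfold, each in exactly one way, and unfolding is the
  only rule through which they act.\<close>

lemma inp_unfold_iff: "unfold p q \<Longrightarrow> inp p ch ts r \<longleftrightarrow> inp q ch ts r"
  by (cases p) (auto elim: inp.cases intro: inp_unfold)

lemma send_unfold_iff: "unfold p q \<Longrightarrow> send p x r \<longleftrightarrow> send q x r"
  by (cases p) (auto elim: send.cases intro: send_unfold)

lemma tau_unfold_iff: "unfold p q \<Longrightarrow> tau p r \<longleftrightarrow> tau q r"
  by (cases p) (auto elim: tau.cases intro: tau_unfold)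

section \<open>Transitions and injective renamings\<close>

lemma rent_upf_Suc: "rent (upf (Suc 0) f) (rent Suc t) = rent Suc (rent f t)"
  by (simp add: subst_tm_comp upf_Suc)

lemma map_rent_upf_Suc:
  "rents (upf (Suc 0) f) (rents Suc ts) = rents Suc (rents f ts)"
  "rento (upf (Suc 0) f) (rento Suc ch) = rento Suc (rento f ch)"
  by (simp_all add: rent_upf_Suc option.map_comp o_def)

lemma ren_upf_Suc: "ren (upf (Suc 0) f) (ren Suc p) = ren Suc (ren f p)"
  by (simp add: ren_ren upf_Suc)

lemma inp_ren:
  "inp p ch ts p' \<Longrightarrow> inj f \<Longrightarrow> inp (ren f p) (rento f ch) (rents f ts) (ren f p')"
proof (induction arbitrary: f rule: inp.induct)
  case (inp_In ts ps vs ch p)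
  then have "dmatches (rents f ts) (map (rdps f) ps) = Some (rents f vs)"
    by (simp add: dmatches_ren)
  then show ?case
    using dmatches_length[OF inp_In(1)] by (auto simp: up_ren ren_inst intro: inp.inp_In)
next
  case (inp_Res p ch ts p')
  then have "inp (ren (upf 1 f) p) (rento Suc (rento f ch))
      (rents Suc (rents f ts)) (ren (upf 1 f) p')"
    using inp_Res.IH[OF inj_upf, of f 1] inp_Res.prems
    by (simp only: map_rent_upf_Suc One_nat_def)
  then show ?case by (simp only: ren_DRes inp.inp_Res)
qed (auto intro: inp.intros unfold_ren)

text \<open>With the label in the image of \<open>f\<close>, injectivity pulls the successful match
  back. This is what reverses the laws in which a process is weakened by
  \<open>ren Suc\<close>.\<close>

lemma inp_ren_inv:
  "inp p ch ts p' \<Longrightarrow> p = ren f q \<Longrightarrow> ch = rento f c \<Longrightarrow> ts = rents f us \<Longrightarrow> inj f \<Longrightarrow>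
    \<exists>q'. p' = ren f q' \<and> inp q c us q'"
proof (induction arbitrary: f q c us rule: inp.induct)
  case (inp_In ts ps vs ch p)
  then obtain ps' q' where q: "q = DIn c ps' q'" "ps = map (rdps f) ps'"
    "p = ren (upf (nbs ps') f) q'"
    by (cases q) (auto simp: up_ren subst_tm_inj_option)
  then obtain ws where "dmatches us ps' = Some ws" "vs = rents f ws"
    using inp_In by (auto simp: dmatches_ren)
  moreover have "ds (inst vs) p = ren f (ds (inst ws) q')"
    using \<open>vs = _\<close> q dmatches_length[OF \<open>dmatches us ps' = Some ws\<close>] ren_inst by metis
  moreover have "c' = c" if "rento f c' = rento f c" for c'
    using that inp_In.prems(4) by (simp add: subst_tm_inj_option)
  ultimately show ?case
    using q inp.inp_In inp_In.prems by auto
next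
  case (inp_Par1 p ch ts p' q0)
  then obtain q1 q2 where q: "q = DPar q1 q2" "p = ren f q1" "q0 = ren f q2" by (cases q) auto
  then obtain r0 where "p' = ren f r0" "inp q1 c us r0"
    using inp_Par1.IH[OF q(2) inp_Par1.prems(2-4)] by blast
  then show ?case using q by (auto intro!: exI[of _ "DPar r0 q2"] inp.inp_Par1)
next
  case (inp_Par2 p ch ts p' q0)
  then obtain q1 q2 where q: "q = DPar q1 q2" "p = ren f q2" "q0 = ren f q1" by (cases q) auto
  then obtain r0 where "p' = ren f r0" "inp q2 c us r0"
    using inp_Par2.IH[OF q(2) inp_Par2.prems(2-4)] by blast
  then show ?case using q by (auto intro!: exI[of _ "DPar q1 r0"] inp.inp_Par2)
next
  case (inp_Res p ch ts p')
  then obtain q1 where q: "q = DRes q1" "p = ren (upf 1 f) q1" by (cases q) (auto simp: up_ren)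
  then obtain q' where "p' = ren (upf 1 f) q'" "inp q1 (rento Suc c) (rents Suc us) q'"
    using inp_Res.IH[of "upf 1 f" q1 "rento Suc c" "rents Suc us"] inp_Res.prems
    by (auto simp: inj_upf rent_upf_Suc option.map_comp o_def)
  then show ?case using q by (auto simp: up_ren intro!: exI[of _ "DRes q'"] inp.inp_Res)
next
  case (inp_unfold p p1 ch ts p')
  then obtain q1 where q: "p1 = ren f q1" "unfold q q1" using unfold_ren_inv by blast
  then obtain r0 where "p' = ren f r0" "inp q1 c us r0"
    using inp_unfold.IH[OF q(1) inp_unfold.prems(2-4)] by blast
  then show ?case using q(2) by (blast intro: inp.inp_unfold)
qed

lemma send_ren: "send p x r \<Longrightarrow> inj f \<Longrightarrow> send (ren f p) (ren f x) (ren f r)"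
proof (induction arbitrary: f rule: send.induct)
  case (send_Res p x r)
  then have "send (ren (upf 1 f) p) (ren Suc (ren f x)) (ren (upf 1 f) r)"
    using send_Res.IH[OF inj_upf, of f 1] send_Res.prems by (simp only: ren_upf_Suc One_nat_def)
  then show ?case by (simp only: ren_DRes send.send_Res)
qed (auto intro: send.intros inp_ren unfold_ren out_thread_ren)

lemma send_ren_inv:
  "send p x r \<Longrightarrow> p = ren f q \<Longrightarrow> x = ren f y \<Longrightarrow> inj f \<Longrightarrow> \<exists>r'. r = ren f r' \<and> send q y r'"
proof (induction arbitrary: f q y rule: send.induct)
  case (send_out p ch ts p1 x x')
  then obtain c us q1 where q: "ch = rento f c" "ts = rents f us" "p1 = ren f q1" "out_thread q c us q1"
    using out_thread_ren_inv by blast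
  obtain y' where "x' = ren f y'" "inp y c us y'"
    using inp_ren_inv[OF send_out(2) _ q(1,2)] send_out.prems by blast
  then show ?case using q(3,4) by (auto intro!: exI[of _ "DPar q1 y'"] send.send_out)
next
  case (send_Par1 p x r q0)
  then obtain q1 q2 where q: "q = DPar q1 q2" "p = ren f q1" "q0 = ren f q2" by (cases q) auto
  then obtain r0 where "r = ren f r0" "send q1 y r0"
    using send_Par1.IH[OF q(2) send_Par1.prems(2-3)] by blast
  then show ?case using q by (auto intro!: exI[of _ "DPar r0 q2"] send.send_Par1)
next
  case (send_Par2 p x r q0)
  then obtain q1 q2 where q: "q = DPar q1 q2" "p = ren f q2" "q0 = ren f q1" by (cases q) auto
  then obtain r0 where "r = ren f r0" "send q2 y r0"
    using send_Par2.IH[OF q(2) send_Par2.prems(2-3)] by blast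
  then show ?case using q by (auto intro!: exI[of _ "DPar q1 r0"] send.send_Par2)
next
  case (send_Res p x r)
  then obtain q1 where q: "q = DRes q1" "p = ren (upf 1 f) q1" by (cases q) (auto simp: up_ren)
  then obtain r' where "r = ren (upf 1 f) r'" "send q1 (ren Suc y) r'"
    using send_Res.IH[of "upf 1 f" q1 "ren Suc y"] send_Res.prems
    by (auto simp: inj_upf ren_upf_Suc)
  then show ?case using q by (auto simp: up_ren intro!: exI[of _ "DRes r'"] send.send_Res)
next
  case (send_unfold p p1 x r)
  then obtain q1 where q: "p1 = ren f q1" "unfold q q1" using unfold_ren_inv by blast
  then obtain r0 where "r = ren f r0" "send q1 y r0"
    using send_unfold.IH[OF q(1) send_unfold.prems(2-3)] by blast
  then show ?case using q(2) by (blast intro: send.send_unfold)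
qed

lemma tau_ren: "tau p r \<Longrightarrow> inj f \<Longrightarrow> tau (ren f p) (ren f r)"
proof (induction arbitrary: f rule: tau.induct)
  case (tau_Res p r)
  then have "tau (ren (upf 1 f) p) (ren (upf 1 f) r)" by (simp add: inj_upf)
  then show ?case by (simp only: ren_DRes tau.tau_Res)
qed (auto intro: tau.intros send_ren unfold_ren)

lemma tau_ren_inv:
  "tau p r \<Longrightarrow> p = ren f q \<Longrightarrow> inj f \<Longrightarrow> \<exists>r'. r = ren f r' \<and> tau q r'"
proof (induction arbitrary: f q rule: tau.induct)
  case (tau_comm1 p x r)
  then obtain q1 q2 where q: "q = DPar q1 q2" "p = ren f q1" "x = ren f q2" by (cases q) auto
  then show ?case using send_ren_inv[OF tau_comm1(1) q(2,3)] tau_comm1.prems by (auto intro: tau.tau_comm1)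
next
  case (tau_comm2 p x r)
  then obtain q1 q2 where q: "q = DPar q1 q2" "p = ren f q2" "x = ren f q1" by (cases q) auto
  then show ?case using send_ren_inv[OF tau_comm2(1) q(2,3)] tau_comm2.prems by (auto intro: tau.tau_comm2)
next
  case (tau_Par1 p r q0)
  then obtain q1 q2 where q: "q = DPar q1 q2" "p = ren f q1" "q0 = ren f q2" by (cases q) auto
  then obtain r0 where "r = ren f r0" "tau q1 r0"
    using tau_Par1.IH[OF q(2) tau_Par1.prems(2)] by blast
  then show ?case using q by (auto intro!: exI[of _ "DPar r0 q2"] tau.tau_Par1)
next
  case (tau_Par2 p r q0)
  then obtain q1 q2 where q: "q = DPar q1 q2" "p = ren f q2" "q0 = ren f q1" by (cases q) auto
  then obtain r0 where "r = ren f r0" "tau q2 r0"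
    using tau_Par2.IH[OF q(2) tau_Par2.prems(2)] by blast
  then show ?case using q by (auto intro!: exI[of _ "DPar q1 r0"] tau.tau_Par2)
next
  case (tau_Res p r)
  then obtain q1 where q: "q = DRes q1" "p = ren (upf 1 f) q1" by (cases q) (auto simp: up_ren)
  then obtain r' where "r = ren (upf 1 f) r'" "tau q1 r'"
    using tau_Res.IH[OF q(2) inj_upf] tau_Res.prems by blast
  then show ?case using q by (auto simp: up_ren intro!: exI[of _ "DRes r'"] tau.tau_Res)
next
  case (tau_unfold p p1 r)
  then obtain q1 where q: "p1 = ren f q1" "unfold q q1" using unfold_ren_inv by blast
  then obtain r0 where "r = ren f r0" "tau q1 r0"
    using tau_unfold.IH[OF q(1) tau_unfold.prems(2)] by blast
  then show ?case using q(2) by (blast intro: tau.tau_unfold)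
qed

text \<open>
  Input and output transitions are invariant under \<open>dscong\<close> for the same reasons. The label of an output
  is the receiver; passing a restriction shifts the label.
\<close>

locale transition =
  fixes R :: "dproc \<Rightarrow> 'l \<Rightarrow> dproc \<Rightarrow> bool" and shift :: "'l \<Rightarrow> 'l"
  assumes Null: "\<not> R DNull l r"
    and Par: "R (DPar p q) l r \<longleftrightarrow> (\<exists>p'. r = DPar p' q \<and> R p l p') \<or> (\<exists>q'. r = DPar p q' \<and> R q l q')"
    and Res: "R (DRes p) l r \<longleftrightarrow> (\<exists>r'. r = DRes r' \<and> R p (shift l) r')"
    and unfold: "unfold p q \<Longrightarrow> R p l r \<longleftrightarrow> R q l r"
    and ren_Suc: "R p l r \<Longrightarrow> R (ren Suc p) (shift l) (ren Suc r)"
    and ren_Suc_inv: "R (ren Suc p) (shift l) r \<Longrightarrow> \<exists>r'. r = ren Suc r' \<and> R p l r'"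
    and ren_swap: "R p (shift (shift l)) r \<Longrightarrow> R (ren swap01 p) (shift (shift l)) (ren swap01 r)"
begin

lemma Par1: "R p l p' \<Longrightarrow> R (DPar p q) l (DPar p' q)"
  and Par2: "R q l q' \<Longrightarrow> R (DPar p q) l (DPar p q')"
  and Res1: "R p (shift l) p' \<Longrightarrow> R (DRes p) l (DRes p')"
  by (auto simp: Par Res)

lemma ParE [consumes 1, case_names left right]:
  assumes "R (DPar p q) l r"
  obtains p' where "r = DPar p' q" "R p l p'" | q' where "r = DPar p q'" "R q l q'"
  using assms by (auto simp: Par)

lemma ResE [consumes 1]:
  assumes "R (DRes p) l r" obtains r' where "r = DRes r'" "R p (shift l) r'"
  using assms by (auto simp: Res)

text \<open>Only one step is matched, and the results are compared by \<open>dscong\<close>, since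
  it is \<open>dscong\<close> itself that is to be shown a bisimulation.\<close>

definition sim :: "dproc \<Rightarrow> dproc \<Rightarrow> bool" where
  "sim p q \<longleftrightarrow> (\<forall>l p'. R p l p' \<longrightarrow> (\<exists>q'. R q l q' \<and> dscong p' q'))"

lemma simI: "(\<And>l p'. R p l p' \<Longrightarrow> \<exists>q'. R q l q' \<and> dscong p' q') \<Longrightarrow> sim p q"
  by (auto simp: sim_def)

lemma simD: "sim p q \<Longrightarrow> R p l p' \<Longrightarrow> \<exists>q'. R q l q' \<and> dscong p' q'"
  by (auto simp: sim_def)

lemma sim_trans:
  assumes "sim p q" "sim q r" shows "sim p r"
  by (rule simI) (blast dest: simD[OF assms(1)] simD[OF assms(2)] intro: dc_trans)

text \<open>The second hypothesis covers steps of \<open>q\<close>, after which \<open>p\<close> and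
  \<open>p'\<close> are still there unchanged.\<close>

lemma sim_Par:
  assumes "sim p p'" "dscong p p'" shows "sim (DPar p q) (DPar p' q)"
  by (rule simI) (auto simp: Par intro: dc_Par dc_Par[OF assms(2)] dest!: simD[OF assms(1)])

lemma sim_Res:
  assumes "sim p p'" shows "sim (DRes p) (DRes p')"
  by (rule simI) (auto simp: Res intro: dc_Res dest!: simD[OF assms])

lemma sim_comm: "sim (DPar p q) (DPar q p)"
  by (rule simI) (auto simp: Par intro: dc_par_comm)

lemma sim_assoc: "sim (DPar p (DPar q r)) (DPar (DPar p q) r)"
  by (rule simI) (auto simp: Par intro: dc_par_assoc)

lemma sim_assoc2: "sim (DPar (DPar p q) r) (DPar p (DPar q r))"
proof (rule simI)
  fix l x assume "R (DPar (DPar p q) r) l x"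
  then show "\<exists>y. R (DPar p (DPar q r)) l y \<and> dscong x y"
    by (elim ParE; hypsubst) (blast intro: Par1 Par2 dc_par_assoc2)+
qed

lemma sim_res_comm: "sim (DRes (DRes p)) (DRes (DRes (ren swap01 p)))"
proof (rule simI)
  fix l x assume "R (DRes (DRes p)) l x"
  then obtain x' where x': "x = DRes (DRes x')" "R p (shift (shift l)) x'" by (auto simp: Res)
  show "\<exists>y. R (DRes (DRes (ren swap01 p))) l y \<and> dscong x y"
    using ren_swap[OF x'(2)] dc_res_comm[of x'] x'(1) by (auto simp: Res)
qed

lemma sim_scope: "sim (DPar p (DRes q)) (DRes (DPar (ren Suc p) q))"
proof (rule simI)
  fix l x assume "R (DPar p (DRes q)) l x"
  then show "\<exists>y. R (DRes (DPar (ren Suc p) q)) l y \<and> dscong x y"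
  proof (cases rule: ParE)
    case (left p')
    then show ?thesis using ren_Suc Res1 Par1 dc_scope by blast
  next
    case (right q')
    then show ?thesis by (elim ResE) (use Res1 Par2 dc_scope in blast)
  qed
qed

lemma sim_scope2: "sim (DRes (DPar (ren Suc p) q)) (DPar p (DRes q))"
proof (rule simI)
  fix l x assume "R (DRes (DPar (ren Suc p) q)) l x"
  then obtain x' where x': "x = DRes x'" "R (DPar (ren Suc p) q) (shift l) x'"
    by (rule ResE)
  from x'(2) show "\<exists>y. R (DPar p (DRes q)) l y \<and> dscong x y"
  proof (cases rule: ParE)
    case (left p')
    then obtain p'' where "p' = ren Suc p''" "R p l p''" using ren_Suc_inv by blast
    then show ?thesis using left x'(1) Par1 dc_sym[OF dc_scope] by blast
  next
    case (right q')
    then show ?thesis using x'(1) Res1 Par2 dc_sym[OF dc_scope] by blast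
  qed
qed

text \<open>Both directions are proved together because \<open>dscong\<close> has a symmetry rule.
  The exchange of restrictions is its own inverse, as \<open>swap01\<close> is an
  involution.\<close>

lemma scong_sim: "dscong p q \<Longrightarrow> sim p q \<and> sim q p"
proof (induction rule: dscong.induct)
  case (dc_refl p)
  then show ?case by (auto simp: sim_def)
next
  case (dc_trans p q r)
  then show ?case using sim_trans by blast
next
  case (dc_Par p p' q)
  then show ?case using sim_Par dc_sym by blast
next
  case (dc_par_nil p)
  show ?case
    by (intro conjI simI) (auto simp: Par Null intro: dscong.dc_par_nil dscong.dc_sym[OF dscong.dc_par_nil])
next
  case (dc_unfold p q)
  then show ?case using dc_refl by (simp add: sim_def unfold) blast
next
  case dc_res_nil
  show ?case by (auto simp: sim_def Res Null)
next
  case (dc_res_comm p)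
  have "sim (DRes (DRes (ren swap01 p))) (DRes (DRes p))"
    using sim_res_comm[of "ren swap01 p"] by (simp add: ren_ren)
  then show ?case using sim_res_comm by blast
qed (auto intro: sim_Res sim_comm sim_assoc sim_assoc2 sim_scope sim_scope2)

lemma scong: "dscong p q \<Longrightarrow> R p l r \<Longrightarrow> \<exists>r'. R q l r' \<and> dscong r r'"
  by (rule simD[OF conjunct1[OF scong_sim]])

end

section \<open>Inputs and sends respect structural equivalence, also in the receiver\<close>

interpretation inp: transition "\<lambda>p l. inp p (fst l) (snd l)" "map_prod (rento Suc) (rents Suc)"
proof
  fix p q l r
  show "inp (DPar p q) (fst l) (snd l) r \<longleftrightarrow> (\<exists>p'. r = DPar p' q \<and> inp p (fst l) (snd l) p') \<or>
      (\<exists>q'. r = DPar p q' \<and> inp q (fst l) (snd l) q')"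
    by (auto elim: inp_ParE intro: inp_Par1 inp_Par2)
next
  fix p r and l :: "tm option \<times> tm list"
  let ?l = "map_prod (rento Suc) (rents Suc) l"
  show "inp (DRes p) (fst l) (snd l) r \<longleftrightarrow> (\<exists>r'. r = DRes r' \<and> inp p (fst ?l) (snd ?l) r')"
    by (auto elim: inp_ResE intro: inp_Res)
  show "\<exists>r'. r = ren Suc r' \<and> inp p (fst l) (snd l) r'" if "inp (ren Suc p) (fst ?l) (snd ?l) r"
    using inp_ren_inv[OF that refl] by simp
next
  fix p r and l :: "tm option \<times> tm list"
  let ?s = "map_prod (rento Suc) (rents Suc)"
  assume "inp p (fst (?s (?s l))) (snd (?s (?s l))) r"
  from inp_ren[OF this inj_swap01]
  show "inp (ren swap01 p) (fst (?s (?s l))) (snd (?s (?s l))) (ren swap01 r)"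
    by (simp add: option.map_comp o_def subst_tm_comp)
qed (auto simp: inp_unfold_iff inp_ren)

lemma inp_scong: "dscong p q \<Longrightarrow> inp p ch ts p' \<Longrightarrow> \<exists>q'. inp q ch ts q' \<and> dscong p' q'"
  using inp.scong[of p q "(ch, ts)" p'] by simp

interpretation send: transition send "ren Suc"
proof
  fix p q l r
  show "send (DPar p q) l r \<longleftrightarrow> (\<exists>p'. r = DPar p' q \<and> send p l p') \<or> (\<exists>q'. r = DPar p q' \<and> send q l q')"
    by (auto elim: send_ParE intro: send_Par1 send_Par2)
next
  fix p l r
  show "send (DRes p) l r \<longleftrightarrow> (\<exists>r'. r = DRes r' \<and> send p (ren Suc l) r')"
    by (auto elim: send_ResE intro: send_Res)
  show "\<exists>r'. r = ren Suc r' \<and> send p l r'" if "send (ren Suc p) (ren Suc l) r"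
    using send_ren_inv[OF that refl refl] by simp
next
  fix p l r assume "send p (ren Suc (ren Suc l)) r"
  from send_ren[OF this inj_swap01]
  show "send (ren swap01 p) (ren Suc (ren Suc l)) (ren swap01 r)" by (simp add: ren_ren)
qed (auto simp: send_unfold_iff send_ren)

text \<open>The locale treats the receiver as a fixed label; this adds that the label may vary up to
  \<open>dscong\<close>.\<close>

lemma send_recv_scong: "send p x r \<Longrightarrow> dscong x y \<Longrightarrow> \<exists>r'. send p y r' \<and> dscong r r'"
proof (induction arbitrary: y rule: send.induct)
  case (send_out p ch ts p1 x x')
  then obtain y' where "inp y ch ts y'" "dscong x' y'" using inp_scong by blast
  then show ?case using send.send_out[OF send_out(1)] dc_Par2 by blast
next
  case (send_Par1 p x r q)
  then show ?case using send.send_Par1 dc_Par by blast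
next
  case (send_Par2 p x r q)
  then show ?case using send.send_Par2 dc_Par2 by blast
next
  case (send_Res p x r)
  have "dscong (ren Suc x) (ren Suc y)" using send_Res.prems by (rule dscong_ren) simp
  then show ?case using send_Res.IH send.send_Res dc_Res by blast
next
  case (send_unfold p q x r)
  then show ?case using send.send_unfold by blast
qed

text \<open>An input is made by a single component. The other one is a bystander, which structural
  laws carry out of the sender's context.\<close>

lemma send_recv_Par:
  "send p z r \<Longrightarrow> z = DPar x y \<Longrightarrow>
    (\<exists>r1. send p x r1 \<and> dscong r (DPar r1 y)) \<or> (\<exists>r1. send p y r1 \<and> dscong r (DPar x r1))"
proof (induction arbitrary: x y rule: send.induct)
  case (send_out p ch ts p1 z z')
  then show ?case
    by (auto elim!: inp_ParE) (blast intro: send.send_out dc_par_assoc dc_left_comm)+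
next
  case (send_Par1 p z r q)
  from send_Par1.IH[OF send_Par1.prems] show ?case
  proof (elim disjE exE conjE)
    fix r1 assume "send p x r1" "dscong r (DPar r1 y)"
    then show ?thesis using send.send_Par1 dc_trans[OF dc_Par dc_swap_right] by blast
  next
    fix r1 assume "send p y r1" "dscong r (DPar x r1)"
    then show ?thesis using send.send_Par1 dc_trans[OF dc_Par dc_par_assoc2] by blast
  qed
next
  case (send_Par2 q z r p)
  from send_Par2.IH[OF send_Par2.prems] show ?case
  proof (elim disjE exE conjE)
    fix r1 assume "send q x r1" "dscong r (DPar r1 y)"
    then show ?thesis using send.send_Par2 dc_trans[OF dc_Par2 dc_par_assoc] by blast
  next
    fix r1 assume "send q y r1" "dscong r (DPar x r1)"
    then show ?thesis using send.send_Par2 dc_trans[OF dc_Par2 dc_left_comm] by blast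
  qed
next
  case (send_Res p z r)
  have "ren Suc z = DPar (ren Suc x) (ren Suc y)" using send_Res.prems by simp
  from send_Res.IH[OF this] show ?case
  proof (elim disjE exE conjE)
    fix r1 assume "send p (ren Suc x) r1" "dscong r (DPar r1 (ren Suc y))"
    then show ?thesis using send.send_Res dc_trans[OF dc_Res dc_sym[OF dc_scope2]] by blast
  next
    fix r1 assume "send p (ren Suc y) r1" "dscong r (DPar (ren Suc x) r1)"
    then show ?thesis using send.send_Res dc_trans[OF dc_Res dc_sym[OF dc_scope]] by blast
  qed
qed (blast intro: send.intros)+

lemma send_recv_Par1: "send p x r \<Longrightarrow> \<exists>r'. send p (DPar x y) r' \<and> dscong r' (DPar r y)"
proof (induction arbitrary: y rule: send.induct)
  case (send_out p ch ts p1 x x')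
  then show ?case using send.send_out[OF send_out(1)] inp_Par1 dc_par_assoc by blast
next
  case (send_Par1 p x r q)
  then show ?case using send.send_Par1 dc_trans[OF dc_Par dc_swap_right] by blast
next
  case (send_Par2 q x r p)
  then show ?case using send.send_Par2 dc_trans[OF dc_Par2 dc_par_assoc] by blast
next
  case (send_Res p x r)
  obtain r' where "send p (DPar (ren Suc x) (ren Suc y)) r'" "dscong r' (DPar r (ren Suc y))"
    using send_Res.IH by blast
  then show ?case
    using send.send_Res[of p "DPar x y" r'] dc_trans[OF dc_Res dc_sym[OF dc_scope2]] by auto
qed (blast intro: send.intros)+

lemma send_recv_Par2: "send p y r \<Longrightarrow> \<exists>r'. send p (DPar x y) r' \<and> dscong r' (DPar x r)"
proof -
  assume "send p y r"
  then obtain r' where r': "send p (DPar y x) r'" "dscong r' (DPar r x)"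
    using send_recv_Par1 by blast
  then obtain r'' where "send p (DPar x y) r''" "dscong r' r''"
    using send_recv_scong dc_par_comm by blast
  then show ?thesis using r' dc_trans[OF dc_sym dc_trans[OF _ dc_par_comm]] by blast
qed

text \<open>The receiver's restriction is pulled out over the sender, which is weakened. When the
  sender has a restriction of its own, the two binders meet in the wrong order and
  \<open>swap01\<close> exchanges them.\<close>

lemma send_recv_Res:
  "send p z r \<Longrightarrow> z = DRes x \<Longrightarrow> \<exists>r1. send (ren Suc p) x r1 \<and> dscong r (DRes r1)"
proof (induction arbitrary: x rule: send.induct)
  case (send_out p ch ts p1 z z')
  then obtain x' where x': "z' = DRes x'" "inp x (rento Suc ch) (rents Suc ts) x'"
    by (auto elim!: inp_ResE)
  have "send (ren Suc p) x (DPar (ren Suc p1) x')"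
    using out_thread_ren[OF send_out(1)] x'(2) by (rule send.send_out)
  then show ?case using dc_scope[of p1 x'] x'(1) by blast
next
  case (send_Par1 p z r q)
  then obtain r1 where "send (ren Suc p) x r1" "dscong r (DRes r1)" by blast
  then show ?case
    using send.send_Par1[of "ren Suc p" x r1 "ren Suc q"] dc_trans[OF dc_Par dc_scope2] by auto
next
  case (send_Par2 q z r p)
  then obtain r1 where "send (ren Suc q) x r1" "dscong r (DRes r1)" by blast
  then show ?case
    using send.send_Par2[of "ren Suc q" x r1 "ren Suc p"] dc_trans[OF dc_Par2 dc_scope] by auto
next
  case (send_Res p z r)
  have "ren Suc z = DRes (ren (upf 1 Suc) x)" using send_Res.prems by (simp add: up_ren)
  from send_Res.IH[OF this] obtain r1
    where r1: "send (ren Suc p) (ren (upf 1 Suc) x) r1" "dscong r (DRes r1)" by blast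
  have "send (ren (upf 1 Suc) p) (ren Suc x) (ren swap01 r1)"
    using send_ren[OF r1(1) inj_swap01] by (simp add: ren_ren swap01_Suc)
  then have "send (ren Suc (DRes p)) x (DRes (ren swap01 r1))"
    by (simp add: up_ren send.send_Res)
  moreover have "dscong (DRes r) (DRes (DRes (ren swap01 r1)))"
    using dc_trans[OF dc_Res[OF r1(2)] dc_res_comm] .
  ultimately show ?case by blast
next
  case (send_unfold p q z r)
  then have "unfold (ren Suc p) (ren Suc q)" by (intro unfold_ren) simp_all
  moreover obtain r1 where "send (ren Suc q) x r1" "dscong r (DRes r1)" using send_unfold by blast
  ultimately show ?case using send.send_unfold by blast
qed

text \<open>\<open>g 0\<close> is the index of the receiver's restriction as seen below the
  restrictions of the sender passed so far, and \<open>h\<close> brings it back to 0. The intended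
  case, with both maps the identity, is not inductive, because each restriction passed moves this
  index.\<close>

lemma send_recv_Res_conv_aux:
  "send p' x r \<Longrightarrow> p' = ren (\<lambda>i. g (Suc i)) p \<Longrightarrow> inj g \<Longrightarrow> inj h \<Longrightarrow> (\<And>i. h (g i) = i) \<Longrightarrow>
    \<exists>r1. send p (DRes (ren h x)) r1 \<and> dscong r1 (DRes (ren h r))"
proof (induction arbitrary: g h p rule: send.induct)
  case (send_out q ch ts q1 x x')
  then obtain c us p1 where p: "ch = rento (\<lambda>i. g (Suc i)) c" "ts = rents (\<lambda>i. g (Suc i)) us"
    "q1 = ren (\<lambda>i. g (Suc i)) p1" "out_thread p c us p1"
    using out_thread_ren_inv[where f = "\<lambda>i. g (Suc i)" and p = p] send_out by blast
  have "inp (ren h x) (rento Suc c) (rents Suc us) (ren h x')"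
    using inp_ren[OF send_out.hyps(2) send_out.prems(3)] send_out.prems(4)
    by (simp add: p option.map_comp o_def subst_tm_comp)
  then have "send p (DRes (ren h x)) (DPar p1 (DRes (ren h x')))"
    using p(4) by (intro send.send_out inp_Res)
  then show ?case using dc_scope[of p1 "ren h x'"] send_out.prems(4) by (auto simp: p ren_ren)
next
  case (send_Par1 q x r q0)
  then obtain p1 p2 where p: "p = DPar p1 p2" "q = ren (\<lambda>i. g (Suc i)) p1" "q0 = ren (\<lambda>i. g (Suc i)) p2"
    by (cases p) auto
  obtain r1 where "send p1 (DRes (ren h x)) r1" "dscong r1 (DRes (ren h r))"
    using send_Par1.IH[OF p(2) send_Par1.prems(2-4)] by blast
  then show ?case
    using send.send_Par1[of p1 "DRes (ren h x)" r1 p2] dc_trans[OF dc_Par dc_scope2, of r1 "ren h r" p2]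
      send_Par1.prems(4) by (auto simp: p ren_ren)
next
  case (send_Par2 q x r q0)
  then obtain p1 p2 where p: "p = DPar p1 p2" "q = ren (\<lambda>i. g (Suc i)) p2" "q0 = ren (\<lambda>i. g (Suc i)) p1"
    by (cases p) auto
  obtain r1 where "send p2 (DRes (ren h x)) r1" "dscong r1 (DRes (ren h r))"
    using send_Par2.IH[OF p(2) send_Par2.prems(2-4)] by blast
  then show ?case
    using send.send_Par2[of p2 "DRes (ren h x)" r1 p1] dc_trans[OF dc_Par2 dc_scope, of r1 "ren h r" p1]
      send_Par2.prems(4) by (auto simp: p ren_ren)
next
  case (send_Res q x r)
  then obtain p0 where p: "p = DRes p0" "q = ren (upf 1 (\<lambda>i. g (Suc i))) p0"
    by (cases p) (auto simp: up_ren)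
  \<comment> \<open>Here \<open>g1 0 = Suc (g 0)\<close>, the receiver's restriction below one more
    binder, while \<open>g1 1 = 0\<close> is that new binder of the sender. \<open>h1\<close>
    inverts this.\<close>
  define g1 where "g1 = (\<lambda>i. upf 1 g (swap01 i))"
  define h1 where "h1 = (\<lambda>i. swap01 (upf 1 h i))"
  have inj: "inj g1" "inj h1"
    using inj_compose[OF inj_upf[OF send_Res.prems(2), of 1] inj_swap01]
      inj_compose[OF inj_swap01 inj_upf[OF send_Res.prems(3), of 1]]
    by (simp_all add: g1_def h1_def o_def)
  have hg: "h1 (g1 i) = i" for i
    using send_Res.prems(4) by (simp add: h1_def g1_def upf_def swap01_def)
  have "upf 1 (\<lambda>i. g (Suc i)) = (\<lambda>i. g1 (Suc i))"
    by (auto simp: g1_def upf_def swap01_def fun_eq_iff)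
  then have "q = ren (\<lambda>i. g1 (Suc i)) p0" using p(2) by simp
  from send_Res.IH[OF this inj hg] obtain r1 where
    r1: "send p0 (DRes (ren h1 (ren Suc x))) r1" "dscong r1 (DRes (ren h1 r))" by blast
  have "h1 (Suc i) = upf 1 Suc (h i)" for i
    by (auto simp: h1_def upf_def swap01_def)
  then have "DRes (ren h1 (ren Suc x)) = ren Suc (DRes (ren h x))"
    by (simp add: up_ren ren_ren)
  then have "send p (DRes (ren h x)) (DRes r1)" using r1(1) p(1) send.send_Res by simp
  moreover have "ren h1 r = ren swap01 (ren (upf 1 h) r)"
    by (simp add: ren_ren h1_def)
  then have "dscong (DRes r1) (DRes (DRes (ren swap01 (ren (upf 1 h) r))))"
    using dc_Res[OF r1(2)] by simp
  then have "dscong (DRes r1) (DRes (DRes (ren (upf 1 h) r)))"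
    by (rule dc_trans[OF _ dc_sym[OF dc_res_comm]])
  ultimately show ?case by (auto simp: up_ren)
next
  case (send_unfold q q1 x r)
  have "inj (\<lambda>i. g (Suc i))" using send_unfold.prems(2) by (auto simp: inj_def)
  then obtain p1 where "q1 = ren (\<lambda>i. g (Suc i)) p1" "unfold p p1"
    using unfold_ren_inv[OF send_unfold.hyps(1) send_unfold.prems(1)] by blast
  then show ?case using send_unfold.IH[OF _ send_unfold.prems(2-4)] by (blast intro: send.send_unfold)
qed

lemma send_recv_Res_conv: "send (ren Suc p) x r \<Longrightarrow> \<exists>r1. send p (DRes x) r1 \<and> dscong r1 (DRes r)"
  using send_recv_Res_conv_aux[of "ren Suc p" x r "\<lambda>i. i" p "\<lambda>i. i"] by (simp add: inj_def)

text \<open>Excludes a communication with the unit in the law for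
  \<open>DPar p DNull\<close>.\<close>

lemma send_DNull: "send p x r \<Longrightarrow> x \<noteq> DNull"
proof (induction rule: send.induct)
  case (send_Res p x r)
  then show ?case by auto
qed auto

section \<open>Internal steps respect structural equivalence\<close>

definition tau_sim :: "dproc \<Rightarrow> dproc \<Rightarrow> bool" where
  "tau_sim p q \<longleftrightarrow> (\<forall>r. tau p r \<longrightarrow> (\<exists>r'. tau q r' \<and> dscong r r'))"

lemma tau_simI: "(\<And>r. tau p r \<Longrightarrow> \<exists>r'. tau q r' \<and> dscong r r') \<Longrightarrow> tau_sim p q"
  by (auto simp: tau_sim_def)

lemma tau_simD: "tau_sim p q \<Longrightarrow> tau p r \<Longrightarrow> \<exists>r'. tau q r' \<and> dscong r r'"
  by (auto simp: tau_sim_def)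

lemma tau_sim_Par:
  assumes "tau_sim p p'" "dscong p p'" shows "tau_sim (DPar p q) (DPar p' q)"
proof (rule tau_simI)
  fix r assume "tau (DPar p q) r"
  then show "\<exists>r'. tau (DPar p' q) r' \<and> dscong r r'"
  proof (cases rule: tau_ParE)
    case 1
    then show ?thesis using send.scong[OF assms(2)] tau_comm1 by blast
  next
    case 2
    then show ?thesis using send_recv_scong[OF _ assms(2)] tau_comm2 by blast
  next
    case (3 r0)
    then show ?thesis using tau_simD[OF assms(1)] tau_Par1 dc_Par by blast
  next
    case (4 r0)
    then show ?thesis using tau_Par2 dc_Par[OF assms(2)] by blast
  qed
qed

lemma tau_sim_Res:
  assumes "tau_sim p p'" shows "tau_sim (DRes p) (DRes p')"
  by (rule tau_simI) (auto elim!: tau_ResE dest!: tau_simD[OF assms] intro: tau_Res dc_Res)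

lemma tau_sim_comm: "tau_sim (DPar p q) (DPar q p)"
proof (rule tau_simI)
  fix r assume "tau (DPar p q) r"
  then show "\<exists>r'. tau (DPar q p) r' \<and> dscong r r'"
    by (cases rule: tau_ParE) (blast intro: tau_comm1 tau_comm2 tau_Par1 tau_Par2 dc_par_comm dc_refl)+
qed

lemma tau_sim_nil: "tau_sim (DPar p DNull) p"
  by (rule tau_simI) (auto elim!: tau_ParE dest: send_DNull intro: dc_par_nil)

lemma tau_sim_nil2: "tau_sim p (DPar p DNull)"
  by (rule tau_simI) (blast intro: tau_Par1 dc_sym[OF dc_par_nil])

text \<open>The delicate case is a communication across the brackets: one partner is then a
  composition, which is split by \<open>send_recv_Par\<close> or assembled by its two
  converses.\<close>

lemma tau_sim_assoc: "tau_sim (DPar p (DPar q r)) (DPar (DPar p q) r)"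
proof (rule tau_simI)
  fix x assume "tau (DPar p (DPar q r)) x"
  then show "\<exists>y. tau (DPar (DPar p q) r) y \<and> dscong x y"
  proof (cases rule: tau_ParE)
    case 1
    from send_recv_Par[OF 1 refl] show ?thesis
    proof (elim disjE exE conjE)
      fix r1 assume "send p q r1" "dscong x (DPar r1 r)"
      then show ?thesis using tau_Par1 tau_comm1 by blast
    next
      fix r1 assume "send p r r1" "dscong x (DPar q r1)"
      moreover have "send (DPar p q) r (DPar r1 q)" using \<open>send p r r1\<close> by (rule send_Par1)
      ultimately show ?thesis using tau_comm1 dc_trans[OF _ dc_par_comm] by blast
    qed
  next
    case 2
    then show ?thesis
    proof (cases rule: send_ParE)
      case (1 r0)
      then show ?thesis using tau_Par1 tau_comm2 dc_refl by blast
    next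
      case (2 r0)
      then obtain r' where "send r (DPar p q) r'" "dscong r' (DPar r0 q)" using send_recv_Par1 by blast
      then show ?thesis using 2 tau_comm2 dc_trans[OF dc_par_comm dc_sym] by blast
    qed
  next
    case (3 p')
    then show ?thesis using tau_Par1 dc_par_assoc by blast
  next
    case (4 y)
    from 4(2) show ?thesis
    proof (cases rule: tau_ParE)
      case 1
      then obtain r' where "send (DPar p q) r r'" "r' = DPar p y" using send_Par2 by blast
      then show ?thesis using 4 tau_comm1 dc_refl by blast
    next
      case 2
      then obtain r' where "send r (DPar p q) r'" "dscong r' (DPar p y)" using send_recv_Par2 by blast
      then show ?thesis using 4 tau_comm2 dc_sym by blast
    next
      case (3 q')
      then show ?thesis using 4 tau_Par1 tau_Par2 dc_par_assoc by blast
    next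
      case (4 r')
      then show ?thesis using \<open>x = DPar p y\<close> tau_Par2 dc_par_assoc by blast
    qed
  qed
qed

lemma tau_sim_trans:
  assumes "tau_sim p q" "tau_sim q r" shows "tau_sim p r"
  by (rule tau_simI) (blast dest: tau_simD[OF assms(1)] tau_simD[OF assms(2)] intro: dc_trans)

lemma tau_sim_assoc2: "tau_sim (DPar (DPar p q) r) (DPar p (DPar q r))"
proof -
  have right: "tau_sim (DPar u (DPar v w)) (DPar u (DPar w v))" for u v w
    by (rule tau_sim_trans[OF tau_sim_comm tau_sim_trans[OF tau_sim_Par[OF tau_sim_comm dc_par_comm] tau_sim_comm]])
  have "tau_sim (DPar (DPar p q) r) (DPar r (DPar p q))" by (rule tau_sim_comm)
  moreover have "tau_sim \<dots> (DPar r (DPar q p))" by (rule right)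
  moreover have "tau_sim (DPar r (DPar q p)) (DPar (DPar r q) p)" by (rule tau_sim_assoc)
  moreover have "tau_sim \<dots> (DPar p (DPar r q))" by (rule tau_sim_comm)
  moreover have "tau_sim \<dots> (DPar p (DPar q r))" by (rule right)
  ultimately show ?thesis using tau_sim_trans by blast
qed

lemma tau_sim_res_comm: "tau_sim (DRes (DRes p)) (DRes (DRes (ren swap01 p)))"
proof (rule tau_simI)
  fix r assume "tau (DRes (DRes p)) r"
  then obtain r' where r': "r = DRes (DRes r')" "tau p r'"
    by (elim tau_ResE) auto
  have "tau (DRes (DRes (ren swap01 p))) (DRes (DRes (ren swap01 r')))"
    by (intro tau_Res tau_ren[OF r'(2) inj_swap01])
  then show "\<exists>y. tau (DRes (DRes (ren swap01 p))) y \<and> dscong r y"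
    unfolding r'(1) using dc_res_comm by blast
qed

lemma tau_sim_scope: "tau_sim (DPar p (DRes q)) (DRes (DPar (ren Suc p) q))"
proof (rule tau_simI)
  fix x assume "tau (DPar p (DRes q)) x"
  then show "\<exists>y. tau (DRes (DPar (ren Suc p) q)) y \<and> dscong x y"
  proof (cases rule: tau_ParE)
    case 1
    then show ?thesis using send_recv_Res[OF 1 refl] tau_Res tau_comm1 by blast
  next
    case 2
    then show ?thesis by (elim send_ResE) (blast intro: tau_Res tau_comm2 dc_refl)
  next
    case (3 p')
    then have "tau (ren Suc p) (ren Suc p')" by (intro tau_ren) auto
    then show ?thesis using 3 tau_Res tau_Par1 dc_scope by blast
  next
    case (4 q')
    then show ?thesis by (auto elim!: tau_ResE) (blast intro: tau_Res tau_Par2 dc_scope)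
  qed
qed

lemma tau_sim_scope2: "tau_sim (DRes (DPar (ren Suc p) q)) (DPar p (DRes q))"
proof (rule tau_simI)
  fix x assume "tau (DRes (DPar (ren Suc p) q)) x"
  then obtain x' where x: "x = DRes x'" "tau (DPar (ren Suc p) q) x'" by (elim tau_ResE)
  from x(2) show "\<exists>y. tau (DPar p (DRes q)) y \<and> dscong x y"
  proof (cases rule: tau_ParE)
    case 1
    then show ?thesis using send_recv_Res_conv[OF 1] x(1) tau_comm1 dc_sym by blast
  next
    case 2
    then show ?thesis using x(1) tau_comm2 send_Res dc_refl by blast
  next
    case (3 p')
    then obtain p'' where "p' = ren Suc p''" "tau p p''" using tau_ren_inv[OF 3(2) refl] by auto
    then show ?thesis using 3 x(1) tau_Par1 dc_sym[OF dc_scope] by blast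
  next
    case (4 q')
    then show ?thesis using x(1) tau_Par2 tau_Res dc_sym[OF dc_scope] by blast
  qed
qed

lemma tau_scong_sim: "dscong p q \<Longrightarrow> tau_sim p q \<and> tau_sim q p"
proof (induction rule: dscong.induct)
  case (dc_refl p)
  then show ?case by (auto simp: tau_sim_def)
next
  case (dc_trans p q r)
  then show ?case using tau_sim_trans by blast
next
  case (dc_Par p p' q)
  then show ?case using tau_sim_Par dc_sym by blast
next
  case dc_res_nil
  show ?case unfolding tau_sim_def by (auto elim!: tau_ResE)
next
  case (dc_res_comm p)
  have "tau_sim (DRes (DRes (ren swap01 p))) (DRes (DRes p))"
    using tau_sim_res_comm[of "ren swap01 p"] by (simp add: ren_ren)
  then show ?case using tau_sim_res_comm by blast
next
  case (dc_unfold p q)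
  then show ?case using dc_refl by (simp add: tau_sim_def tau_unfold_iff) blast
next
  case (dc_sym p q)
  then show ?case by blast
next
  case (dc_Res p p')
  then show ?case by (intro conjI tau_sim_Res) simp_all
next
  case (dc_par_nil p)
  show ?case by (intro conjI tau_sim_nil tau_sim_nil2)
next
  case (dc_par_comm p q)
  show ?case by (intro conjI tau_sim_comm)
next
  case (dc_par_assoc p q r)
  show ?case by (intro conjI tau_sim_assoc tau_sim_assoc2)
next
  case (dc_scope p q)
  show ?case by (intro conjI tau_sim_scope tau_sim_scope2)
qed

lemma tau_scong: "dscong p q \<Longrightarrow> tau p r \<Longrightarrow> \<exists>r'. tau q r' \<and> dscong r r'"
  by (rule tau_simD[OF conjunct1[OF tau_scong_sim]])

text \<open>An unguarded \<open>DSucc\<close>, with conditionals resolved. This computable property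
  is invariant under \<open>dscong\<close> and stands in for the existential in
  \<open>succeeds\<close>.\<close>

primrec tops :: "dproc \<Rightarrow> bool" where
  "tops DNull \<longleftrightarrow> False"
| "tops (DOut ch ts) \<longleftrightarrow> False"
| "tops (DOutC ch ts p) \<longleftrightarrow> False"
| "tops (DIn ch ps p) \<longleftrightarrow> False"
| "tops (DRes p) \<longleftrightarrow> tops p"
| "tops (DPar p q) \<longleftrightarrow> tops p \<or> tops q"
| "tops (DCond s t p q) \<longleftrightarrow> (if s = t then tops p else tops q)"
| "tops (DRep p) \<longleftrightarrow> tops p"
| "tops DSucc \<longleftrightarrow> True"

lemma tops_ren [simp]: "inj f \<Longrightarrow> tops (ren f p) \<longleftrightarrow> tops p"
  by (induction p arbitrary: f) (auto simp: up_ren inj_upf subst_tm_inj)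

lemma tops_scong: "dscong p q \<Longrightarrow> tops p \<longleftrightarrow> tops q"
  by (induction rule: dscong.induct) (auto simp: inj_swap01 elim: unfold.cases)

lemma tops_dscong: "tops p \<Longrightarrow> \<exists>q. dscong p (DPar q DSucc)"
proof (induction p)
  case (DRes p)
  then obtain q where "dscong p (DPar q DSucc)" by auto
  then have "dscong (DRes p) (DRes (DPar q (ren Suc DSucc)))" by (simp add: dc_Res)
  also have "dscong \<dots> (DPar (DRes q) DSucc)" by (rule dc_sym[OF dc_scope2])
  finally show ?case by blast
next
  case (DPar p1 p2)
  show ?case
  proof (cases "tops p1")
    case True
    then obtain q where "dscong p1 (DPar q DSucc)" using DPar by auto
    then have "dscong (DPar p1 p2) (DPar (DPar q p2) DSucc)" by (rule dc_trans[OF dc_Par dc_swap_right])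
    then show ?thesis by blast
  next
    case False
    then obtain q where "dscong p2 (DPar q DSucc)" using DPar by auto
    then have "dscong (DPar p1 p2) (DPar (DPar p1 q) DSucc)" by (rule dc_trans[OF dc_Par2 dc_par_assoc])
    then show ?thesis by blast
  qed
next
  case (DCond s t p1 p2)
  then obtain q where "dscong (if s = t then p1 else p2) (DPar q DSucc)" by (auto split: if_splits)
  then have "dscong (DCond s t p1 p2) (DPar q DSucc)" by (rule dc_trans[OF dc_unfold, rotated]) simp
  then show ?case by blast
next
  case (DRep p)
  then obtain q where "dscong p (DPar q DSucc)" by auto
  then have "dscong (DRep p) (DPar (DPar q (DRep p)) DSucc)"
    by (rule dc_trans[OF dc_unfold[OF unfold_Rep] dc_trans[OF dc_Par dc_swap_right]])
  then show ?case by blast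
next
  case DSucc
  show ?case by (rule exI, rule dc_sym[OF dc_nil2])
qed simp_all

section \<open>Transfer to named processes\<close>

lemma nint_Res: "nint f (Res n P) = DRes (nint (enf [n] f) P)"
  by (simp add: ext_Nm)

text \<open>\<open>map_of\<close> prefers the first occurrence of a key and \<open>++\<close> its
  right argument. Distinctness makes the domains disjoint, so the orders agree.\<close>

lemma map_of_zip_append:
  assumes "length xs = length vs" "length ys = length ws" "distinct (xs @ ys)"
  shows "map_of (zip (xs @ ys) (vs @ ws)) = map_of (zip xs vs) ++ map_of (zip ys ws)"
proof -
  have "dom (map_of (zip xs vs)) \<inter> dom (map_of (zip ys ws)) = {}"
    using assms by (simp add: dom_map_of_zip)
  then show ?thesis using assms by (subst map_add_comm) simp_all
qed

lemma match1_dmatch: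
  "distinct (binders_pat p) \<Longrightarrow>
    match1 t p = map_option (\<lambda>vs. map_of (zip (binders_pat p) vs)) (dmatch t (dp Nm p))"
proof (induction t p rule: match1.induct)
  case (3 s t p q)
  then show ?case
    by (auto split: option.splits dest!: dmatch_length simp: map_of_zip_append[symmetric])
qed auto

lemma matches_dmatches:
  "distinct (binders ps) \<Longrightarrow>
    matches ts ps = map_option (\<lambda>vs. map_of (zip (binders ps) vs)) (dmatches ts (map (dp Nm) ps))"
proof (induction ts ps rule: matches.induct)
  case (2 t ts p ps)
  then show ?case
    by (auto split: option.splits dest!: dmatch_length dmatches_length simp: match1_dmatch map_of_zip_append[symmetric])
qed auto

lemma map_of_zip_pos:
  "length vs = length xs \<Longrightarrow> map_of (zip xs vs) a = (if a \<in> set xs then Some (vs ! pos xs a) else None)"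
  by (induction xs vs rule: list_induct2') auto

lemma inst_ext: "length vs = length xs \<Longrightarrow>
    subst_tm (inst vs) (ext xs \<rho> a) = (if a \<in> set xs then vs ! pos xs a else \<rho> a)"
proof -
  assume "length vs = length xs"
  then have "(\<lambda>i. subst_tm (inst vs) (Nm (i + length xs))) = Nm"
    by (auto simp: inst_def)
  then show ?thesis
    using \<open>length vs = length xs\<close> by (auto simp: ext_def inst_def pos_less sh_def subst_tm_comp)
qed

text \<open>The continuation of an input agrees in both settings: \<open>inst\<close> undoes the
  indices introduced by \<open>ext\<close>, binder by binder.\<close>

lemma interp_map_subst:
  assumes "length vs = length xs"
  shows "interp \<rho> (map_subst (map_of (zip xs vs)) Q) = ds (inst (map (subst_tm \<rho>) vs)) (interp (ext xs \<rho>) Q)"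
  unfolding map_subst_def interp_subst ds_interp
  by (rule arg_cong[where f = "\<lambda>\<sigma>. interp \<sigma> Q"])
     (auto simp: fun_eq_iff inst_ext assms map_of_zip_pos[OF assms] pos_less)

lemma matches_sound:
  assumes "matches ts ps = Some \<sigma>" "distinct (binders ps)" "inj f"
  obtains vs where "dmatches (rents f ts) (map (rdp f) ps) = Some vs"
    "nint f (map_subst \<sigma> Q) = ds (inst vs) (nint (enf (binders ps) f) Q)"
proof -
  obtain vs where vs: "dmatches ts (map (dp Nm) ps) = Some vs" "\<sigma> = map_of (zip (binders ps) vs)"
    using assms by (auto simp: matches_dmatches)
  have len: "length vs = length (binders ps)"
    using dmatches_length[OF vs(1)] by simp
  have "map (rdp f) ps = map (rdps f) (map (dp Nm) ps)"
    by (simp add: dps_dp)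
  then have "dmatches (rents f ts) (map (rdp f) ps) = Some (rents f vs)"
    using vs(1) assms(3) by (simp only: dmatches_ren) simp
  moreover have "nint f (map_subst \<sigma> Q) = ds (inst (rents f vs)) (nint (enf (binders ps) f) Q)"
    using interp_map_subst[OF len, of "\<lambda>a. Nm (f a)" Q] by (simp add: vs(2) ext_Nm)
  ultimately show ?thesis using that by blast
qed

lemma matches_inp:
  assumes "matches ts ps = Some \<sigma>" "distinct (binders ps)" "inj f"
  shows "inp (nint f (In ch ps Q)) (rento f ch) (rents f ts) (nint f (map_subst \<sigma> Q))"
  by (rule matches_sound[OF assms, of Q]) (auto simp: ext_Nm intro: inp_In)

lemma matches_complete:
  assumes "dmatches (rents f ts) (map (rdp f) ps) = Some vs" "distinct (binders ps)" "inj f"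
  obtains \<sigma> where "matches ts ps = Some \<sigma>"
    "nint f (map_subst \<sigma> Q) = ds (inst vs) (nint (enf (binders ps) f) Q)"
proof -
  have "map (rdp f) ps = map (rdps f) (map (dp Nm) ps)"
    by (simp add: dps_dp)
  then have "dmatches ts (map (dp Nm) ps) \<noteq> None"
    using assms(1,3) dmatches_ren[of f ts "map (dp Nm) ps"] by (metis option.map(1) option.distinct(1))
  then obtain \<sigma> where \<sigma>: "matches ts ps = Some \<sigma>"
    using assms(2) by (auto simp: matches_dmatches)
  then show ?thesis using matches_sound[OF \<sigma> assms(2,3), of Q] assms(1) that by (metis option.inject)
qed

lemma scong_procs: "scong L P Q \<Longrightarrow> P \<in> procs L \<and> Q \<in> procs L"
  by (induction rule: scong.induct) (auto simp: procs_def)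

lemma nint_unused: "n \<notin> fn P \<Longrightarrow> nint (enf [n] f) P = ren Suc (nint f P)"
  unfolding ds_interp by (rule interp_cong) (auto simp: enf_def)

lemma nint_swap: "a \<noteq> b \<Longrightarrow> nint (enf [a] (enf [b] f)) P = ren swap01 (nint (enf [b] (enf [a] f)) P)"
  unfolding ds_interp by (rule interp_cong) (auto simp: enf_def swap01_def)

lemma scong_sound: "scong L P Q \<Longrightarrow> inj f \<Longrightarrow> dscong (nint f P) (nint f Q)"
proof (induction arbitrary: f rule: scong.induct)
  case (sc_sym P Q)
  then show ?case by (blast intro: dc_sym)
next
  case (sc_trans P Q R)
  then show ?case by (blast intro: dc_trans)
next
  case (sc_Par P P' Q)
  then show ?case by (simp add: dc_Par)
next
  case (sc_Res P P' n)
  then show ?case unfolding nint_Res by (intro dc_Res) (blast intro: inj_enf)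
next
  case (sc_alpha P P')
  then show ?case by (simp add: alpha_sound)
next
  case (sc_res_comm P a b)
  \<comment> \<open>For equal names \<open>nint_swap\<close> does not apply, but then both sides are
    the same process.\<close>
  show ?case
  proof (cases "a = b")
    case False
    then show ?thesis using dc_res_comm by (simp add: nint_Res nint_swap[of a b] del: interp.simps)
  qed simp
next
  case (sc_scope P Q a)
  then show ?case using dc_scope by (simp add: nint_Res ext_Nm nint_unused)
qed (auto simp: subst_tm_inj ext_Nm intro: dscong.intros unfold.intros)

text \<open>Equality at the end would be too much: an asynchronous output leaves
  \<open>DNull\<close> behind, and \<open>red\<close> absorbs \<open>scong\<close> on both ends. The
  congruence in front is carried over the step by \<open>tau_scong\<close>.\<close>

lemma red_sound: "red L P P' \<Longrightarrow> inj f \<Longrightarrow> \<exists>U. tau (nint f P) U \<and> dscong U (nint f P')"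
proof (induction arbitrary: f rule: red.induct)
  case (red_async ch ts ps Q \<sigma>)
  then have "distinct (binders ps)" by (simp add: procs_def ok_in_def)
  note inp = matches_inp[OF red_async(2) this red_async.prems]
  have "tau (nint f (Par (Out ch ts) (In ch ps Q))) (DPar DNull (nint f (map_subst \<sigma> Q)))"
    unfolding interp.simps(2,6) by (intro tau_comm1 send_out[OF _ inp]) simp
  then show ?case using dc_nil2 by blast
next
  case (red_sync ch ts P ps Q \<sigma>)
  then have "distinct (binders ps)" by (simp add: procs_def ok_in_def)
  note inp = matches_inp[OF red_sync(2) this red_sync.prems]
  have "tau (nint f (Par (OutC ch ts P) (In ch ps Q))) (nint f (Par P (map_subst \<sigma> Q)))"
    unfolding interp.simps(3,6) by (intro tau_comm1 send_out[OF _ inp]) simp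
  then show ?case by blast
next
  case (red_Par P P' Q)
  then obtain U where "tau (nint f P) U" "dscong U (nint f P')" by blast
  then show ?case by (auto intro!: exI[of _ "DPar U (nint f Q)"] tau_Par1 dc_Par)
next
  case (red_Res P P' n)
  then obtain U where "tau (nint (enf [n] f) P) U" "dscong U (nint (enf [n] f) P')"
    using inj_enf by blast
  then show ?case unfolding nint_Res by (blast intro: tau_Res dc_Res)
next
  case (red_scong P Q Q' P')
  then obtain U where U: "tau (nint f Q) U" "dscong U (nint f Q')" by blast
  obtain V where "tau (nint f P) V" "dscong U V"
    using tau_scong[OF dc_sym[OF scong_sound[OF red_scong(1) red_scong.prems]] U(1)] by blast
  moreover have "dscong (nint f Q') (nint f P')"
    using scong_sound[OF red_scong(3) red_scong.prems] .
  ultimately show ?case using U(2) dc_trans dc_sym by blast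
qed

section \<open>Languages of de Bruijn processes and their named representatives\<close>

definition dok_pat :: "lang \<Rightarrow> dpat \<Rightarrow> bool" where
  "dok_pat L p \<longleftrightarrow>
     (case matching L of
        NoMatch \<Rightarrow> p = DBind
      | NameMatch \<Rightarrow> p = DBind \<or> (\<exists>a. p = DMatch a)
      | Intensional \<Rightarrow> True)"

primrec din :: "lang \<Rightarrow> dproc \<Rightarrow> bool" where
  "din L DNull \<longleftrightarrow> True"
| "din L (DOut ch ts) \<longleftrightarrow> synchronism L = Asynchronous \<and> ok_out L ch ts"
| "din L (DOutC ch ts p) \<longleftrightarrow> synchronism L = Synchronous \<and> ok_out L ch ts \<and> din L p"
| "din L (DIn ch ps p) \<longleftrightarrow> ok_channel L ch \<and> ok_arity L ps \<and> (\<forall>q\<in>set ps. dok_pat L q) \<and> din L p"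
| "din L (DRes p) \<longleftrightarrow> din L p"
| "din L (DPar p q) \<longleftrightarrow> din L p \<and> din L q"
| "din L (DCond s t p q) \<longleftrightarrow> din L p \<and> din L q"
| "din L (DRep p) \<longleftrightarrow> din L p"
| "din L DSucc \<longleftrightarrow> True"

lemma ok_tm_ren [simp]: "ok_tm L (rent f t) \<longleftrightarrow> ok_tm L t"
  by (cases t) (auto simp: ok_tm_def)

lemma ok_channel_ren [simp]: "ok_channel L (rento f ch) \<longleftrightarrow> ok_channel L ch"
  by (cases ch) (auto simp: ok_channel_def split: medium.splits)

lemma ok_arity_map [simp]: "ok_arity L (map f xs) \<longleftrightarrow> ok_arity L xs"
  by (simp add: ok_arity_def)

lemma ok_out_ren [simp]: "ok_out L (rento f ch) (rents f ts) \<longleftrightarrow> ok_out L ch ts"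
  by (simp add: ok_out_def)

lemma dok_pat_dp [simp]: "dok_pat L (rdp f p) \<longleftrightarrow> ok_pat L p"
  by (cases p) (auto simp: dok_pat_def ok_pat_def split: matching.splits)

lemma dok_pat_ren [simp]: "dok_pat L (rdps f p) \<longleftrightarrow> dok_pat L p"
  by (cases p) (auto simp: dok_pat_def split: matching.splits)

text \<open>Distinctness of binder names is invisible after interpretation, so \<open>pwf\<close>
  has to be added to \<open>din\<close>.\<close>

lemma in_lang_iff: "in_lang L P \<longleftrightarrow> din L (nint f P) \<and> pwf P"
  by (induction P arbitrary: f) (auto simp: ext_Nm ok_in_def)

lemma din_ren [simp]: "din L (ren f p) \<longleftrightarrow> din L p"
  by (induction p arbitrary: f) (auto simp: up_ren)

lemma procs_iff: "P \<in> procs L \<longleftrightarrow> din L (nint f P) \<and> pwf P"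
  by (simp add: procs_def in_lang_iff[of L P f])

primrec dpnames :: "dpat \<Rightarrow> nat set" where
  "dpnames DBind = {}"
| "dpnames (DMatch a) = {a}"
| "dpnames (DCmp p q) = dpnames p \<union> dpnames q"

text \<open>Indices are collected without regard to binders, so this is only an upper bound.\<close>

primrec dnames :: "dproc \<Rightarrow> nat set" where
  "dnames DNull = {}"
| "dnames (DOut ch ts) = fn_out ch ts"
| "dnames (DOutC ch ts p) = fn_out ch ts \<union> dnames p"
| "dnames (DIn ch ps p) = \<Union> (names_tm ` set_option ch) \<union> \<Union> (dpnames ` set ps) \<union> dnames p"
| "dnames (DRes p) = dnames p"
| "dnames (DPar p q) = dnames p \<union> dnames q"
| "dnames (DCond s t p q) = names_tm s \<union> names_tm t \<union> dnames p \<union> dnames q"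
| "dnames (DRep p) = dnames p"
| "dnames DSucc = {}"

lemma finite_dpnames [simp]: "finite (dpnames p)"
  by (induction p) auto

lemma finite_dnames [simp]: "finite (dnames p)"
  by (induction p) (auto simp: fn_out_def)

lemma subst_tm_id: "(\<And>i. i \<in> names_tm t \<Longrightarrow> \<tau> i = Nm i) \<Longrightarrow> subst_tm \<tau> t = t"
  by (induction t) auto

lemma dps_id: "(\<And>i. i \<in> dpnames p \<Longrightarrow> \<tau> i = Nm i) \<Longrightarrow> dps \<tau> p = p"
  by (induction p) auto

lemma up_id: "(\<And>i. i < M \<Longrightarrow> \<tau> i = Nm i) \<Longrightarrow> i < M \<Longrightarrow> up k \<tau> i = Nm i"
  by (auto simp: up_def)

lemma subst_out_id:
  assumes "\<And>i. i < M \<Longrightarrow> \<tau> i = Nm i" "fn_out ch ts \<subseteq> {..<M}"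
  shows "map_option (subst_tm \<tau>) ch = ch" "map (subst_tm \<tau>) ts = ts"
proof -
  have id: "subst_tm \<tau> t = t" if t: "t \<in> set_option ch \<union> set ts" for t
  proof (rule subst_tm_id)
    fix i assume "i \<in> names_tm t"
    then have "i \<in> fn_out ch ts" using t by (auto simp: fn_out_def)
    then show "\<tau> i = Nm i" using assms by auto
  qed
  show "map_option (subst_tm \<tau>) ch = ch" using id by (cases ch) auto
  show "map (subst_tm \<tau>) ts = ts" using id by (intro map_idI) auto
qed

text \<open>Lifting a map that is the identity below \<open>M\<close> gives a map with the same
  property, so a single bound on all indices, bound or free, survives the descent below
  binders.\<close>

lemma ds_id: "dnames d \<subseteq> {..<M} \<Longrightarrow> (\<And>i. i < M \<Longrightarrow> \<tau> i = Nm i) \<Longrightarrow> ds \<tau> d = d"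
proof (induction d arbitrary: \<tau>)
  case (DOut ch ts)
  then show ?case using subst_out_id[of M \<tau> ch ts] by simp
next
  case (DOutC ch ts d)
  then show ?case using subst_out_id[of M \<tau> ch ts] by simp
next
  case (DIn ch ps d)
  have "map_option (subst_tm \<tau>) ch = ch"
    using DIn.prems by (intro subst_out_id(1)[of M \<tau> ch "[]"]) (auto simp: fn_out_def)
  moreover have "map (dps \<tau>) ps = ps"
  proof (rule map_idI, rule dps_id)
    fix p i assume "p \<in> set ps" "i \<in> dpnames p"
    then have "i \<in> dnames (DIn ch ps d)" by auto
    then show "\<tau> i = Nm i" using DIn.prems by blast
  qed
  moreover have "ds (up (nbs ps) \<tau>) d = d"
    using DIn.prems by (intro DIn.IH up_id) auto
  ultimately show ?case by simp
next
  case (DRes d)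
  have "ds (up 1 \<tau>) d = d"
    using DRes.prems by (intro DRes.IH up_id) auto
  then show ?case by simp
next
  case (DCond s t d1 d2)
  have "subst_tm \<tau> s = s" "subst_tm \<tau> t = t"
    using DCond.prems by (auto intro!: subst_tm_id)
  then show ?case using DCond by simp
qed auto

text \<open>
  An environment for the scope of \<open>k\<close> binders is never surjective, because the bound names shadow free ones.
  It agrees, however, with a bijective environment on all names below a given bound.
\<close>

lemma binder_env:
  fixes \<pi> :: "name \<Rightarrow> nat"
  assumes "bij \<pi>"
  obtains xs \<pi>' where "bij \<pi>'" "distinct xs" "length xs = k" "\<And>x. x \<in> set xs \<Longrightarrow> M \<le> \<pi> x"
    "\<And>d P. dnames d \<subseteq> {..<M} \<Longrightarrow> nint \<pi>' P = d \<Longrightarrow> nint (enf xs \<pi>) P = d"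
proof -
  \<comment> \<open>The block of \<open>k\<close> indices from \<open>M\<close> on moves to the
    front and those below \<open>M\<close> shift up by \<open>k\<close>, just as on entering the
    scope of the names in that block. Indices from \<open>M + k\<close> on stay put, which makes the
    map a bijection.\<close>
  define \<theta> where "\<theta> = (\<lambda>i. if i < M then i + k else if i < M + k then i - M else i)"
  define \<theta>' where "\<theta>' = (\<lambda>i. if i < k then i + M else if i < M + k then i - k else i)"
  have "\<theta> \<circ> \<theta>' = id" "\<theta>' \<circ> \<theta> = id"
    by (auto simp: \<theta>_def \<theta>'_def fun_eq_iff)
  then have bt: "bij \<theta>" by (rule o_bij[rotated])
  define \<pi>' where "\<pi>' = \<theta> \<circ> \<pi>"
  have b: "bij \<pi>'" unfolding \<pi>'_def using assms bt by (rule bij_comp)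
  define xs where "xs = map (inv \<pi>) [M..<M + k]"
  have \<pi>inv: "\<pi> (inv \<pi> i) = i" "inv \<pi> (\<pi> a) = a" for i a
    using assms by (auto simp: bij_def surj_f_inv_f)
  have dist: "distinct xs"
    unfolding xs_def distinct_map using \<pi>inv by (metis distinct_upt inj_on_def)
  have len: "length xs = k" by (simp add: xs_def)
  have mem: "a \<in> set xs \<longleftrightarrow> M \<le> \<pi> a \<and> \<pi> a < M + k" for a
    unfolding xs_def using \<pi>inv by (auto simp: image_iff) (metis atLeastLessThan_iff)
  have pos: "pos xs a = \<pi> a - M" if "a \<in> set xs" for a
  proof -
    have "xs ! (\<pi> a - M) = a" "\<pi> a - M < length xs" using that mem \<pi>inv by (auto simp: xs_def)
    then show ?thesis using pos_nth[OF dist] by metis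
  qed
  have agree: "enf xs \<pi> a = \<pi>' a" if "\<pi>' a < M" for a
  proof (cases "a \<in> set xs")
    case True
    then show ?thesis using mem[of a] pos by (auto simp: enf_def \<pi>'_def \<theta>_def)
  next
    case False
    then show ?thesis using mem[of a] that len by (auto simp: enf_def \<pi>'_def \<theta>_def split: if_splits)
  qed
  have \<pi>'inv: "\<pi>' (inv \<pi>' i) = i" "inv \<pi>' (\<pi>' a) = a" for i a
    using b by (auto simp: bij_def surj_f_inv_f)
  have "nint (enf xs \<pi>) P = d" if "dnames d \<subseteq> {..<M}" "nint \<pi>' P = d" for d P
  proof -
    have "nint (enf xs \<pi>) P = ds (\<lambda>i. Nm (enf xs \<pi> (inv \<pi>' i))) (nint \<pi>' P)"
      by (simp add: ds_interp \<pi>'inv)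
    also have "\<dots> = nint \<pi>' P"
      using that agree \<pi>'inv by (intro ds_id[of _ M]) auto
    finally show ?thesis using that by simp
  qed
  then show ?thesis using that b dist len mem by blast
qed

text \<open>The case of one binder. The set \<open>A\<close> holds names to be avoided, such as the
  free names in the scope law or the other binder in the exchange law.\<close>

lemma Res_env:
  assumes "bij \<pi>" "finite N" "finite A"
  shows "\<exists>x \<pi>'. bij \<pi>' \<and> x \<notin> A \<and>
    (\<forall>d P. dnames d \<subseteq> N \<longrightarrow> nint \<pi>' P = d \<longrightarrow> nint (enf [x] \<pi>) P = d)"
proof -
  define M where "M = fresh (N \<union> \<pi> ` A)"
  have M: "i < M" if "i \<in> N \<union> \<pi> ` A" for i
    unfolding M_def using that assms by (intro less_fresh) auto
  obtain xs \<pi>' where xs: "bij \<pi>'" "length xs = 1" "\<And>x. x \<in> set xs \<Longrightarrow> M \<le> \<pi> x"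
    "\<And>d P. dnames d \<subseteq> {..<M} \<Longrightarrow> nint \<pi>' P = d \<Longrightarrow> nint (enf xs \<pi>) P = d"
    using binder_env[OF assms(1), of 1 M] by metis
  then obtain x where x: "xs = [x]" by (auto simp: length_Suc_conv)
  have "x \<notin> A" using xs(3)[of x] M[of "\<pi> x"] x by auto
  moreover have "nint (enf [x] \<pi>) P = d" if "dnames d \<subseteq> N" "nint \<pi>' P = d" for d P
    using xs(4)[of d P] that M x by auto
  ultimately show ?thesis using xs(1) by (intro exI[of _ x] exI[of _ \<pi>']) simp
qed

lemma pat_surj:
  assumes "bij \<pi>"
  shows "length xs = nb p \<Longrightarrow> \<exists>p'. binders_pat p' = xs \<and> rdp \<pi> p' = p"
proof (induction p arbitrary: xs)
  case DBind
  then obtain x where "xs = [x]" by (auto simp: length_Suc_conv)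
  then show ?case by (intro exI[of _ "Bind x"]) simp
next
  case (DMatch a)
  then show ?case using assms by (intro exI[of _ "Match (inv \<pi> a)"]) (simp add: bij_def surj_f_inv_f)
next
  case (DCmp p q)
  obtain p' where "binders_pat p' = take (nb p) xs" "rdp \<pi> p' = p"
    using DCmp.IH(1)[of "take (nb p) xs"] DCmp.prems by auto
  moreover obtain q' where "binders_pat q' = drop (nb p) xs" "rdp \<pi> q' = q"
    using DCmp.IH(2)[of "drop (nb p) xs"] DCmp.prems by auto
  ultimately show ?case by (intro exI[of _ "PCmp p' q'"]) simp
qed

lemma pats_surj:
  assumes "bij \<pi>"
  shows "length xs = nbs ps \<Longrightarrow> \<exists>ps'. binders ps' = xs \<and> map (rdp \<pi>) ps' = ps"
proof (induction ps arbitrary: xs)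
  case (Cons p ps)
  obtain p' where "binders_pat p' = take (nb p) xs" "rdp \<pi> p' = p"
    using pat_surj[OF assms, of "take (nb p) xs" p] Cons.prems by auto
  moreover obtain qs where "binders qs = drop (nb p) xs" "map (rdp \<pi>) qs = ps"
    using Cons.IH[of "drop (nb p) xs"] Cons.prems by auto
  ultimately show ?case by (intro exI[of _ "p' # qs"]) simp
qed (auto intro: exI[of _ "[]"])

lemma rent_inv: "bij \<pi> \<Longrightarrow> rent \<pi> (rent (inv \<pi>) t) = t"
  by (simp add: subst_tm_comp bij_def surj_f_inv_f)

lemma rent_inv_out:
  "bij \<pi> \<Longrightarrow> rents \<pi> (rents (inv \<pi>) ts) = ts"
  "bij \<pi> \<Longrightarrow> rento \<pi> (rento (inv \<pi>) ch) = ch"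
  by (auto simp: o_def rent_inv option.map_comp option.map_ident)

text \<open>A bijective environment gives every index a name. Below binders
  \<open>binder_env\<close> supplies another bijective one, chosen after the body is known.\<close>

lemma nint_surj: "bij \<pi> \<Longrightarrow> \<exists>P. nint \<pi> P = d \<and> pwf P"
proof (induction d arbitrary: \<pi>)
  case DNull
  show ?case by (intro exI[of _ Null]) simp
next
  case (DOut ch ts)
  show ?case
    by (intro exI[of _ "Out (rento (inv \<pi>) ch) (rents (inv \<pi>) ts)"])
       (simp only: interp.simps pwf.simps rent_inv_out[OF DOut])
next
  case (DOutC ch ts d)
  then obtain P where "nint \<pi> P = d" "pwf P" by blast
  then show ?case
    by (intro exI[of _ "OutC (rento (inv \<pi>) ch) (rents (inv \<pi>) ts) P"])
       (simp only: interp.simps pwf.simps rent_inv_out[OF DOutC.prems])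
next
  case (DIn ch ps d)
  define M where "M = fresh (dnames d)"
  have M: "dnames d \<subseteq> {..<M}" unfolding M_def using less_fresh[of "dnames d"] by auto
  obtain xs \<pi>' where xs: "bij \<pi>'" "distinct xs" "length xs = nbs ps"
    "\<And>d P. dnames d \<subseteq> {..<M} \<Longrightarrow> nint \<pi>' P = d \<Longrightarrow> nint (enf xs \<pi>) P = d"
    using binder_env[OF DIn.prems, of "nbs ps" M] by metis
  obtain P where P: "nint \<pi>' P = d" "pwf P" using DIn.IH[OF xs(1)] by blast
  obtain ps' where "binders ps' = xs" "map (rdp \<pi>) ps' = ps"
    using pats_surj[OF DIn.prems xs(3)] by blast
  then show ?case using xs(2) xs(4)[OF M P(1)] P(2) rent_inv_out(2)[OF DIn.prems, of ch]
    by (intro exI[of _ "In (rento (inv \<pi>) ch) ps' P"]) (simp add: ext_Nm)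
next
  case (DRes d)
  obtain x \<pi>' where x: "bij \<pi>'" "\<forall>d' P. dnames d' \<subseteq> dnames d \<longrightarrow> nint \<pi>' P = d' \<longrightarrow> nint (enf [x] \<pi>) P = d'"
    using Res_env[OF DRes.prems finite_dnames finite.emptyI, of d] by blast
  obtain P where P: "nint \<pi>' P = d" "pwf P" using DRes.IH[OF x(1)] by blast
  then show ?case using x(2)[rule_format, OF order.refl P(1)] by (intro exI[of _ "Res x P"]) (simp add: ext_Nm)
next
  case (DPar d1 d2)
  then obtain P Q where "nint \<pi> P = d1" "pwf P" "nint \<pi> Q = d2" "pwf Q" by meson
  then show ?case by (intro exI[of _ "Par P Q"]) simp
next
  case (DCond s t d1 d2)
  then obtain P Q where "nint \<pi> P = d1" "pwf P" "nint \<pi> Q = d2" "pwf Q" by meson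
  then show ?case
    using rent_inv[OF DCond.prems] by (intro exI[of _ "Cond (rent (inv \<pi>) s) (rent (inv \<pi>) t) P Q"]) simp
next
  case (DRep d)
  then obtain P where "nint \<pi> P = d" "pwf P" by blast
  then show ?case by (intro exI[of _ "Rep P"]) simp
next
  case DSucc
  show ?case by (intro exI[of _ Succ]) simp
qed

lemma procs_surj: "bij \<pi> \<Longrightarrow> din L d \<Longrightarrow> \<exists>P. P \<in> procs L \<and> nint \<pi> P = d"
  using nint_surj procs_iff by metis

text \<open>Structural equivalence on \<open>dproc\<close> ignores the language; \<open>clean\<close> projects its derivations into a language.\<close>

primrec clean :: "lang \<Rightarrow> dproc \<Rightarrow> dproc" where
  "clean L DNull = DNull"
| "clean L (DOut ch ts) = (if din L (DOut ch ts) then DOut ch ts else DNull)"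
| "clean L (DOutC ch ts p) = (if din L (DOutC ch ts p) then DOutC ch ts p else DNull)"
| "clean L (DIn ch ps p) = (if din L (DIn ch ps p) then DIn ch ps p else DNull)"
| "clean L (DRes p) = DRes (clean L p)"
| "clean L (DPar p q) = DPar (clean L p) (clean L q)"
| "clean L (DCond s t p q) = DCond s t (clean L p) (clean L q)"
| "clean L (DRep p) = DRep (clean L p)"
| "clean L DSucc = DSucc"

lemma din_clean [simp]: "din L (clean L d)"
  by (induction d) auto

lemma clean_id: "din L d \<Longrightarrow> clean L d = d"
  by (induction d) auto

lemma clean_ren: "clean L (ren f d) = ren f (clean L d)"
  by (induction d arbitrary: f) (auto simp: up_ren)

text \<open>Quantifying over all named representatives avoids a choice; since representatives are
  unique up to alpha, \<open>scong_relI\<close> needs only one pair.\<close>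

definition scong_rel :: "lang \<Rightarrow> (name \<Rightarrow> nat) \<Rightarrow> dproc \<Rightarrow> dproc \<Rightarrow> bool" where
  "scong_rel L \<pi> d e \<longleftrightarrow>
     (\<forall>P\<in>procs L. \<forall>Q\<in>procs L. nint \<pi> P = d \<longrightarrow> nint \<pi> Q = e \<longrightarrow> scong L P Q)"

lemma scong_nint_eq:
  assumes "bij \<pi>" "P \<in> procs L" "Q \<in> procs L" "nint \<pi> P = nint \<pi> Q" shows "scong L P Q"
proof (rule sc_alpha)
  show "P =\<^sub>\<alpha> Q"
    using assms procs_iff[of P L \<pi>] procs_iff[of Q L \<pi>] by (auto intro: alpha_complete[OF _ refl, of \<pi>] bij_is_inj)
qed (use assms in auto)

lemma scong_relI:
  assumes "bij \<pi>" "nint \<pi> P = d" "nint \<pi> Q = e" "scong L P Q"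
  shows "scong_rel L \<pi> d e"
  unfolding scong_rel_def
proof (intro ballI impI)
  fix P' Q' assume *: "P' \<in> procs L" "Q' \<in> procs L" "nint \<pi> P' = d" "nint \<pi> Q' = e"
  have "P \<in> procs L" "Q \<in> procs L" using scong_procs[OF assms(4)] by auto
  then have "scong L P' P" "scong L Q Q'"
    using * assms by (auto intro!: scong_nint_eq[of \<pi>])
  then show "scong L P' Q'" using assms(4) by (blast intro: sc_trans)
qed

lemma scong_relD:
  "scong_rel L \<pi> d e \<Longrightarrow> P \<in> procs L \<Longrightarrow> Q \<in> procs L \<Longrightarrow> nint \<pi> P = d \<Longrightarrow> nint \<pi> Q = e \<Longrightarrow> scong L P Q"
  by (simp add: scong_rel_def)

lemma procs_simps:
  "Null \<in> procs L" "Res n P \<in> procs L \<longleftrightarrow> P \<in> procs L"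
  "Par P Q \<in> procs L \<longleftrightarrow> P \<in> procs L \<and> Q \<in> procs L"
  "Cond s t P Q \<in> procs L \<longleftrightarrow> P \<in> procs L \<and> Q \<in> procs L"
  "Rep P \<in> procs L \<longleftrightarrow> P \<in> procs L" "Succ \<in> procs L"
  by (auto simp: procs_def)

definition readback :: "lang \<Rightarrow> (name \<Rightarrow> nat) \<Rightarrow> dproc \<Rightarrow> proc" where
  "readback L \<pi> d = (SOME P. P \<in> procs L \<and> nint \<pi> P = clean L d)"

lemma readback:
  assumes "bij \<pi>" shows "readback L \<pi> d \<in> procs L" "nint \<pi> (readback L \<pi> d) = clean L d"
  using someI_ex[OF procs_surj[OF assms, of L "clean L d"]] by (simp_all add: readback_def)

text \<open>The middle term of \<open>dc_trans\<close> may lie outside the language. No law reaches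
  below a prefix and \<open>clean\<close> erases only prefixed processes, so it turns each law into
  an instance of the same law inside the language.\<close>

lemma scong_complete_clean: "dscong d e \<Longrightarrow> bij \<pi> \<Longrightarrow> scong_rel L \<pi> (clean L d) (clean L e)"
proof (induction arbitrary: \<pi> rule: dscong.induct)
  case (dc_refl p)
  then show ?case by (auto simp: scong_rel_def intro: scong_nint_eq)
next
  case (dc_sym p q)
  then show ?case by (auto simp: scong_rel_def intro: sc_sym)
next
  case (dc_trans p q r)
  show ?case using readback[OF dc_trans.prems, of L q] dc_trans.IH[OF dc_trans.prems] unfolding scong_rel_def by (blast intro: sc_trans)
next
  case (dc_Par p p' q)
  note P = readback[OF dc_Par.prems, of L p]
  note P' = readback[OF dc_Par.prems, of L p']
  note Q = readback[OF dc_Par.prems, of L q]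
  note PP = scong_relD[OF dc_Par.IH[OF dc_Par.prems] P(1) P'(1) P(2) P'(2)]
  from sc_Par[OF PP Q(1)] show ?case by (rule scong_relI[OF dc_Par.prems, rotated 2]) (simp_all add: P P' Q)
next
  case (dc_Res p p')
  \<comment> \<open>One binder and one environment must serve both \<open>p\<close> and
    \<open>p'\<close>, so the bound covers the indices of both.\<close>
  obtain x \<pi>' where x: "bij \<pi>'" and
    env: "\<forall>d P. dnames d \<subseteq> dnames (clean L p) \<union> dnames (clean L p') \<longrightarrow> nint \<pi>' P = d \<longrightarrow> nint (enf [x] \<pi>) P = d"
    using Res_env[OF dc_Res.prems finite_UnI[OF finite_dnames finite_dnames] finite.emptyI, of "clean L p" "clean L p'"] by blast
  note P = readback[OF x, of L p]
  note P' = readback[OF x, of L p']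
  note PP = scong_relD[OF dc_Res.IH[OF x] P(1) P'(1) P(2) P'(2)]
  from sc_Res[OF PP] show ?case
    by (rule scong_relI[OF dc_Res.prems, rotated 2]) (use env[rule_format, OF _ P(2)] env[rule_format, OF _ P'(2)] in \<open>simp_all add: nint_Res del: interp.simps\<close>)
next
  case (dc_par_nil p)
  note P = readback[OF dc_par_nil, of L p]
  from sc_par_nil[OF P(1)] show ?case by (rule scong_relI[OF dc_par_nil, rotated 2]) (simp_all add: P)
next
  case (dc_par_comm p q)
  note P = readback[OF dc_par_comm, of L p]
  note Q = readback[OF dc_par_comm, of L q]
  from sc_par_comm[OF P(1) Q(1)] show ?case by (rule scong_relI[OF dc_par_comm, rotated 2]) (simp_all add: P Q)
next
  case (dc_par_assoc p q r)
  note P = readback[OF dc_par_assoc, of L p]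
  note Q = readback[OF dc_par_assoc, of L q]
  note R = readback[OF dc_par_assoc, of L r]
  from sc_par_assoc[OF P(1) Q(1) R(1)] show ?case
    by (rule scong_relI[OF dc_par_assoc, rotated 2]) (simp_all add: P Q R)
next
  case (dc_unfold p q)
  then show ?case
  proof cases
    case (unfold_Rep r)
    note P = readback[OF dc_unfold.prems, of L r]
    from sc_rep[OF P(1)] show ?thesis
      by (rule scong_relI[OF dc_unfold.prems, rotated 2]) (simp_all add: P unfold_Rep)
  next
    case (unfold_eq s r)
    note P = readback[OF dc_unfold.prems, of L q]
    note R = readback[OF dc_unfold.prems, of L r]
    from sc_if_eq[OF P(1) R(1) refl, of "rent (inv \<pi>) s"] show ?thesis
      by (rule scong_relI[OF dc_unfold.prems, rotated 2])
         (simp_all add: P R unfold_eq rent_inv[OF dc_unfold.prems])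
  next
    case (unfold_neq s t r)
    note P = readback[OF dc_unfold.prems, of L r]
    note Q = readback[OF dc_unfold.prems, of L q]
    have ne: "rent (inv \<pi>) s \<noteq> rent (inv \<pi>) t"
      using unfold_neq(2) rent_inv[OF dc_unfold.prems] by metis
    from sc_if_neq[OF P(1) Q(1) ne] show ?thesis
      by (rule scong_relI[OF dc_unfold.prems, rotated 2])
         (simp_all add: P Q unfold_neq rent_inv[OF dc_unfold.prems])
  qed
next
  case dc_res_nil
  from sc_res_nil[of L 0] show ?case by (rule scong_relI[OF dc_res_nil, rotated 2]) simp_all
next
  case (dc_res_comm p)
  let ?p = "clean L p"
  obtain x \<pi>1 where x: "bij \<pi>1"
    "\<forall>d P. dnames d \<subseteq> dnames ?p \<longrightarrow> nint \<pi>1 P = d \<longrightarrow> nint (enf [x] \<pi>) P = d"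
    using Res_env[OF dc_res_comm finite_dnames finite.emptyI, of ?p] by blast
  \<comment> \<open>The second binder avoids the first because \<open>nint_swap\<close> needs
    distinct names.\<close>
  obtain y \<pi>2 where y: "bij \<pi>2" "y \<notin> {x}"
    "\<forall>d P. dnames d \<subseteq> dnames ?p \<longrightarrow> nint \<pi>2 P = d \<longrightarrow> nint (enf [y] \<pi>1) P = d"
    using Res_env[OF x(1) finite_dnames, of "{x}" ?p] by blast
  obtain P where P: "P \<in> procs L" "nint \<pi>2 P = ?p" using readback[OF y(1)] by blast
  have "nint \<pi>1 (Res y P) = DRes ?p" using y(3)[rule_format, OF order.refl P(2)] by (simp only: nint_Res)
  then have "nint (enf [x] \<pi>) (Res y P) = DRes ?p" by (intro x(2)[rule_format]) simp_all
  then have l: "nint \<pi> (Res x (Res y P)) = DRes (DRes ?p)" by (simp only: nint_Res)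
  have "nint (enf [y] (enf [x] \<pi>)) P = ?p"
    using \<open>nint (enf [x] \<pi>) (Res y P) = DRes ?p\<close> unfolding nint_Res by simp
  then have r: "nint \<pi> (Res y (Res x P)) = DRes (DRes (ren swap01 ?p))"
    using y(2) nint_swap[of x y \<pi> P] by (simp add: nint_Res del: interp.simps)
  from sc_res_comm[OF P(1)] show ?case
    by (rule scong_relI[OF dc_res_comm, rotated 2]) (use l r in \<open>simp_all add: clean_ren del: interp.simps\<close>)
next
  case (dc_scope p q)
  obtain P where P: "P \<in> procs L" "nint \<pi> P = clean L p" using readback[OF dc_scope] by blast
  obtain x \<pi>' where x: "bij \<pi>'" "x \<notin> fn P"
    "\<forall>d P. dnames d \<subseteq> dnames (clean L q) \<longrightarrow> nint \<pi>' P = d \<longrightarrow> nint (enf [x] \<pi>) P = d"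
    using Res_env[OF dc_scope finite_dnames finite_fn, of P "clean L q"] by blast
  obtain Q where Q: "Q \<in> procs L" "nint \<pi>' Q = clean L q" using readback[OF x(1)] by blast
  have Q': "nint (enf [x] \<pi>) Q = clean L q" using x(3)[rule_format, OF order.refl Q(2)] .
  have "nint \<pi> (Par P (Res x Q)) = DPar (clean L p) (DRes (clean L q))"
    using Q' P(2) by (simp add: ext_Nm)
  moreover have "nint \<pi> (Res x (Par P Q)) = DRes (DPar (ren Suc (clean L p)) (clean L q))"
    using Q' P(2) nint_unused[OF x(2), of \<pi>] by (simp add: ext_Nm)
  ultimately show ?case using sc_scope[OF P(1) Q(1) x(2)]
    by (intro scong_relI[OF dc_scope, rotated 2]) (auto simp: clean_ren)
qed

lemma scong_complete:
  assumes "dscong (nint \<pi> P) (nint \<pi> Q)" "bij \<pi>" "P \<in> procs L" "Q \<in> procs L"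
  shows "scong L P Q"
proof -
  have "clean L (nint \<pi> P) = nint \<pi> P" "clean L (nint \<pi> Q) = nint \<pi> Q"
    using assms procs_iff clean_id by blast+
  then show ?thesis
    using scong_complete_clean[OF assms(1,2), of L] assms(3,4) by (simp add: scong_rel_def)
qed

section \<open>Closure of the languages under transitions, and reductions that realise them\<close>

lemma dmatch_ok: "dmatch t p = Some vs \<Longrightarrow> ok_tm L t \<Longrightarrow> \<forall>v\<in>set vs. ok_tm L v"
  by (induction t p arbitrary: vs rule: dmatch.induct) (auto split: option.splits if_splits simp: ok_tm_def)

lemma dmatches_ok: "dmatches ts ps = Some vs \<Longrightarrow> \<forall>t\<in>set ts. ok_tm L t \<Longrightarrow> \<forall>v\<in>set vs. ok_tm L v"
proof (induction ts ps arbitrary: vs rule: dmatches.induct)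
  case (2 t ts p ps)
  then obtain us ws where u: "dmatch t p = Some us" "dmatches ts ps = Some ws" "vs = us @ ws"
    by (auto split: option.splits)
  moreover have "\<forall>v\<in>set us. ok_tm L v" using dmatch_ok[OF u(1)] 2 by auto
  moreover have "\<forall>v\<in>set ws. ok_tm L v" using 2 u(2) by auto
  ultimately show ?case by auto
qed auto

lemma ok_tm_subst: "(\<And>i. ok_tm L (\<sigma> i)) \<Longrightarrow> ok_tm L t \<Longrightarrow> ok_tm L (subst_tm \<sigma> t)"
  by (cases t) (auto simp: ok_tm_def)

text \<open>Where patterns are restricted, so are values: a matched name is then replaced by a name,
  and compounds arise only in languages that allow every pattern.\<close>

lemma dok_pat_subst: "(\<And>i. ok_tm L (\<sigma> i)) \<Longrightarrow> dok_pat L p \<Longrightarrow> dok_pat L (dps \<sigma> p)"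
proof (cases p)
  case (DMatch a)
  assume "\<And>i. ok_tm L (\<sigma> i)" and "dok_pat L p"
  then have "ok_tm L (\<sigma> a)" by blast
  then show ?thesis using DMatch \<open>dok_pat L p\<close> by (auto simp: dok_pat_def ok_tm_def split: matching.splits)
qed (auto simp: dok_pat_def split: matching.splits)

lemma din_ds: "(\<And>i. ok_tm L (\<sigma> i)) \<Longrightarrow> din L p \<Longrightarrow> din L (ds \<sigma> p)"
proof (induction p arbitrary: \<sigma>)
  case (DIn ch ps p)
  have "ok_tm L (up (nbs ps) \<sigma> i)" for i
    using DIn.prems(1) by (auto simp: up_def sh_def) (simp add: ok_tm_def)
  then show ?case using DIn
    by (cases ch) (auto simp: ok_channel_def ok_tm_subst dok_pat_subst split: medium.splits)
next
  case (DRes p)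
  have "ok_tm L (up 1 \<sigma> i)" for i
    using DRes.prems(1) by (auto simp: up_def sh_def) (simp add: ok_tm_def)
  then show ?case using DRes by simp
next
  case (DOut ch ts)
  then show ?case
    by (cases ch) (auto simp: ok_out_def ok_channel_def ok_tm_subst split: medium.splits)
next
  case (DOutC ch ts p)
  then show ?case
    by (cases ch) (auto simp: ok_out_def ok_channel_def ok_tm_subst split: medium.splits)
qed auto

lemma unfold_din: "unfold p q \<Longrightarrow> din L p \<Longrightarrow> din L q"
  by (cases p) auto

lemma inp_din: "inp x ch ts x' \<Longrightarrow> din L x \<Longrightarrow> \<forall>t\<in>set ts. ok_tm L t \<Longrightarrow> din L x'"
proof (induction rule: inp.induct)
  case (inp_In ts ps vs ch p)
  have "ok_tm L (inst vs i)" for i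
    using dmatches_ok[OF inp_In(1,3)] by (auto simp: inst_def) (simp add: ok_tm_def)
  then show ?case using inp_In by (auto intro: din_ds)
qed (auto dest: unfold_din)

lemma out_thread_din: "out_thread p ch ts p' \<Longrightarrow> din L p \<Longrightarrow> din L p' \<and> (\<forall>t\<in>set ts. ok_tm L t)"
  by (cases p) (auto simp: ok_out_def)

lemma out_inp_din:
  "out_thread p ch ts p' \<Longrightarrow> din L p \<Longrightarrow> inp x ch ts x' \<Longrightarrow> din L x \<Longrightarrow> din L p' \<and> din L x'"
  using out_thread_din inp_din by blast

lemma send_din: "send p x r \<Longrightarrow> din L p \<Longrightarrow> din L x \<Longrightarrow> din L r"
  by (induction rule: send.induct) (auto dest: out_inp_din unfold_din)

lemma tau_din: "tau p r \<Longrightarrow> din L p \<Longrightarrow> din L r"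
  by (induction rule: tau.induct) (auto dest: send_din unfold_din)

text \<open>Read off from the input transition that the match induces, since transitions stay in the
  language.\<close>

lemma map_subst_procs:
  assumes "matches ts ps = Some \<sigma>" "In ch ps Q \<in> procs L" "\<forall>t\<in>set ts. ok_tm L t"
  shows "map_subst \<sigma> Q \<in> procs L"
proof -
  have "distinct (binders ps)" "pwf Q" using assms(2) procs_iff[of _ L "\<lambda>a. a"] by auto
  have "inp (nint (\<lambda>a. a) (In ch ps Q)) ch ts (nint (\<lambda>a. a) (map_subst \<sigma> Q))"
    using matches_inp[OF assms(1) \<open>distinct _\<close>, of "\<lambda>a. a" ch Q] by (simp add: inj_def option.map_id)
  moreover have "din L (nint (\<lambda>a. a) (In ch ps Q))"
    using assms(2) procs_iff[of _ L "\<lambda>a. a"] by blast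
  ultimately have "din L (nint (\<lambda>a. a) (map_subst \<sigma> Q))"
    using inp_din assms(3) by blast
  then show ?thesis using \<open>pwf Q\<close> procs_iff[of _ L "\<lambda>a. a"] by (simp add: map_subst_def)
qed

lemma red_procs: "red L P Q \<Longrightarrow> P \<in> procs L \<and> Q \<in> procs L"
proof (induction rule: red.induct)
  case (red_async ch ts ps Q \<sigma>)
  have "In ch ps Q \<in> procs L" "\<forall>t\<in>set ts. ok_tm L t"
    using red_async(1) by (auto simp: procs_def ok_out_def)
  then show ?case using red_async map_subst_procs by blast
next
  case (red_sync ch ts P ps Q \<sigma>)
  have "In ch ps Q \<in> procs L" "P \<in> procs L" "\<forall>t\<in>set ts. ok_tm L t"
    using red_sync(1) by (auto simp: procs_def ok_out_def)
  then show ?case using red_sync map_subst_procs procs_simps(3) by blast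
next
  case (red_scong P Q Q' P')
  then show ?case using scong_procs by blast
qed (auto simp: procs_simps)

definition red_rel :: "lang \<Rightarrow> (name \<Rightarrow> nat) \<Rightarrow> dproc \<Rightarrow> dproc \<Rightarrow> bool" where
  "red_rel L \<pi> d e \<longleftrightarrow>
     (\<forall>P\<in>procs L. \<forall>Q\<in>procs L. nint \<pi> P = d \<longrightarrow> nint \<pi> Q = e \<longrightarrow> red L P Q)"

lemma red_relI:
  assumes "bij \<pi>" "dscong d (nint \<pi> P)" "dscong (nint \<pi> Q) e" "red L P Q"
  shows "red_rel L \<pi> d e"
  unfolding red_rel_def
proof (intro ballI impI)
  fix P' Q' assume *: "P' \<in> procs L" "Q' \<in> procs L" "nint \<pi> P' = d" "nint \<pi> Q' = e"
  have "P \<in> procs L" "Q \<in> procs L" using red_procs[OF assms(4)] by auto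
  then have "scong L P' P" "scong L Q Q'"
    using * assms by (auto intro!: scong_complete[of \<pi>])
  then show "red L P' Q'" using assms(4) by (blast intro: red_scong)
qed

lemma red_rel_scong:
  assumes "red_rel L \<pi> d e" "bij \<pi>" "dscong d' d" "dscong e e'" "din L d" "din L e"
  shows "red_rel L \<pi> d' e'"
proof -
  obtain P Q where PQ: "P \<in> procs L" "nint \<pi> P = d" "Q \<in> procs L" "nint \<pi> Q = e"
    using procs_surj[OF assms(2)] assms(5,6) by meson
  then have "red L P Q" using assms(1) by (simp add: red_rel_def)
  then show ?thesis using assms PQ by (intro red_relI[of \<pi> d' P Q e']) auto
qed

lemma red_rel_Par:
  assumes "red_rel L \<pi> d e" "bij \<pi>" "din L d" "din L e" "din L q"
  shows "red_rel L \<pi> (DPar d q) (DPar e q)"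
proof -
  obtain P Q R where PQ: "P \<in> procs L" "nint \<pi> P = d" "Q \<in> procs L" "nint \<pi> Q = e" "R \<in> procs L" "nint \<pi> R = q"
    using procs_surj[OF assms(2)] assms(3-5) by meson
  then have "red L P Q" using assms(1) by (simp add: red_rel_def)
  then have "red L (Par P R) (Par Q R)" using PQ by (intro red_Par)
  then show ?thesis using assms PQ by (intro red_relI[of \<pi> _ "Par P R" "Par Q R"]) auto
qed

lemma red_rel_Res:
  assumes "\<And>\<pi>. bij \<pi> \<Longrightarrow> red_rel L \<pi> d e" "bij \<pi>" "din L d" "din L e"
  shows "red_rel L \<pi> (DRes d) (DRes e)"
proof -
  obtain x \<pi>' where x: "bij \<pi>'"
    "\<forall>d' P. dnames d' \<subseteq> dnames d \<union> dnames e \<longrightarrow> nint \<pi>' P = d' \<longrightarrow> nint (enf [x] \<pi>) P = d'"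
    using Res_env[OF assms(2) finite_UnI[OF finite_dnames finite_dnames] finite.emptyI, of d e] by blast
  obtain P Q where PQ: "P \<in> procs L" "nint \<pi>' P = d" "Q \<in> procs L" "nint \<pi>' Q = e"
    using procs_surj[OF x(1)] assms(3,4) by meson
  then have "red L P Q" using assms(1)[OF x(1)] by (simp add: red_rel_def)
  then have "red L (Res x P) (Res x Q)" by (rule red_Res)
  then show ?thesis using assms x(2)[rule_format, OF _ PQ(2)] x(2)[rule_format, OF _ PQ(4)]
    by (intro red_relI[of \<pi> _ "Res x P" "Res x Q"]) (auto simp: nint_Res simp del: interp.simps)
qed

text \<open>The receiving prefix may sit deep inside \<open>x\<close>. Each layer around it is moved
  out by a structural law, until the output stands next to the prefix and \<open>red_async\<close>
  or \<open>red_sync\<close> applies to named representatives.\<close>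

lemma inp_red:
  "inp x ch ts x' \<Longrightarrow> out_thread p ch ts p' \<Longrightarrow> din L p \<Longrightarrow> din L x \<Longrightarrow> bij \<pi> \<Longrightarrow>
    red_rel L \<pi> (DPar p x) (DPar p' x')"
proof (induction arbitrary: p p' \<pi> rule: inp.induct)
  case (inp_In ts ps vs ch q)
  have inj: "inj \<pi>" using inp_In.prems by (simp add: bij_is_inj)
  obtain Y where Y: "Y \<in> procs L" "nint \<pi> Y = DIn ch ps q"
    using procs_surj[OF inp_In.prems(4,3)] by blast
  then obtain c qs Q where Y_eq: "Y = In c qs Q" "rento \<pi> c = ch"
    "map (rdp \<pi>) qs = ps" "nint (enf (binders qs) \<pi>) Q = q"
    by (cases Y) (auto simp: ext_Nm)
  obtain O' where O: "O' \<in> procs L" "nint \<pi> O' = p"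
    using procs_surj[OF inp_In.prems(4,2)] by blast
  have dist: "distinct (binders qs)" using Y Y_eq by (simp add: procs_def ok_in_def)
  have c: "c' = c" if "rento \<pi> c' = ch" for c'
    using that by (simp add: Y_eq(2)[symmetric] subst_tm_inj_option[OF inj])
  from inp_In.prems(1) consider "p = DOut ch ts" "p' = DNull" | "p = DOutC ch ts p'"
    by (auto elim: out_thread.cases)
  then show ?case
  proof cases
    case 1
    then obtain us where us: "O' = Out c us" "rents \<pi> us = ts"
      using O(2) c by (cases O') auto
    obtain \<sigma> where "matches us qs = Some \<sigma>" "nint \<pi> (map_subst \<sigma> Q) = ds (inst vs) q"
      using matches_complete[of \<pi> us qs vs Q] inp_In.hyps us Y_eq dist inj by auto
    moreover have "red L (Par (Out c us) (In c qs Q)) (map_subst \<sigma> Q)"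
      using O Y us Y_eq calculation by (intro red_async) (auto simp: procs_simps)
    ultimately show ?thesis using O Y us Y_eq 1 inp_In.prems(4)
      by (intro red_relI[of \<pi> _ "Par O' Y" "map_subst \<sigma> Q"]) (auto intro: dc_sym[OF dc_nil2])
  next
    case 2
    then obtain us O1 where us: "O' = OutC c us O1" "rents \<pi> us = ts" "nint \<pi> O1 = p'"
      using O(2) c by (cases O') auto
    obtain \<sigma> where "matches us qs = Some \<sigma>" "nint \<pi> (map_subst \<sigma> Q) = ds (inst vs) q"
      using matches_complete[of \<pi> us qs vs Q] inp_In.hyps us Y_eq dist inj by auto
    moreover have "red L (Par (OutC c us O1) (In c qs Q)) (Par O1 (map_subst \<sigma> Q))"
      using O Y us Y_eq calculation by (intro red_sync) (auto simp: procs_simps)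
    ultimately show ?thesis using O Y us Y_eq 2 inp_In.prems(4)
      by (intro red_relI[of \<pi> _ "Par O' Y" "Par O1 (map_subst \<sigma> Q)"]) auto
  qed
next
  case (inp_Par1 x ch ts x' y)
  have "din L p'" "din L x'" using out_inp_din[OF inp_Par1.prems(1,2) inp_Par1.hyps] inp_Par1.prems by simp_all
  then show ?case using inp_Par1
    by (intro red_rel_scong[OF red_rel_Par[of L \<pi> "DPar p x" "DPar p' x'" y] _ dc_par_assoc dc_par_assoc2]) auto
next
  case (inp_Par2 y ch ts y' x)
  have "din L p'" "din L y'" using out_inp_din[OF inp_Par2.prems(1,2) inp_Par2.hyps] inp_Par2.prems by simp_all
  then show ?case using inp_Par2
    by (intro red_rel_scong[OF red_rel_Par[of L \<pi> "DPar p y" "DPar p' y'" x] _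
          dc_trans[OF dc_Par2[OF dc_par_comm] dc_par_assoc] dc_trans[OF dc_par_assoc2 dc_Par2[OF dc_par_comm]]]) auto
next
  case (inp_Res x ch ts x')
  have d: "din L p'" "\<forall>t\<in>set ts. ok_tm L t" using out_thread_din inp_Res.prems by auto
  then have "din L x'" using inp_din[OF inp_Res.hyps] inp_Res.prems by auto
  moreover have "red_rel L \<pi>' (DPar (ren Suc p) x) (DPar (ren Suc p') x')" if "bij \<pi>'" for \<pi>'
    using inp_Res.IH[OF out_thread_ren[OF inp_Res.prems(1)]] inp_Res.prems that by auto
  ultimately have "red_rel L \<pi> (DRes (DPar (ren Suc p) x)) (DRes (DPar (ren Suc p') x'))"
    using inp_Res.prems d by (intro red_rel_Res) auto
  then show ?case
    by (rule red_rel_scong[OF _ _ dc_scope dc_sym[OF dc_scope]]) (use inp_Res.prems d \<open>din L x'\<close> in auto)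
next
  case (inp_unfold x y ch ts x')
  have "din L y" using unfold_din inp_unfold.hyps(1) inp_unfold.prems(3) by blast
  moreover have "din L p'" "din L x'"
    using out_inp_din[OF inp_unfold.prems(1,2) inp_unfold.hyps(2) \<open>din L y\<close>] by simp_all
  ultimately show ?case using inp_unfold.prems
    by (intro red_rel_scong[OF inp_unfold.IH _ dc_Par2[OF dc_unfold[OF inp_unfold.hyps(1)]] dc_refl]) auto
qed

lemma send_red: "send p x r \<Longrightarrow> din L p \<Longrightarrow> din L x \<Longrightarrow> bij \<pi> \<Longrightarrow> red_rel L \<pi> (DPar p x) r"
proof (induction arbitrary: \<pi> rule: send.induct)
  case (send_out p ch ts p' x x')
  then show ?case by (intro inp_red)
next
  case (send_Par1 p x r q)
  then show ?case
    by (intro red_rel_scong[OF red_rel_Par[of L \<pi> "DPar p x" r q] _ dc_swap_right dc_refl]) (auto dest: send_din)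
next
  case (send_Par2 q x r p)
  then show ?case
    by (intro red_rel_scong[OF red_rel_Par[of L \<pi> "DPar q x" r p] _
          dc_trans[OF dc_par_assoc2 dc_par_comm] dc_par_comm]) (auto dest: send_din)
next
  case (send_Res p x r)
  have "din L r" using send_din[OF send_Res.hyps] send_Res.prems by auto
  then have "red_rel L \<pi> (DRes (DPar p (ren Suc x))) (DRes r)"
    using send_Res by (intro red_rel_Res) auto
  then show ?case
    by (rule red_rel_scong[OF _ _ dc_scope2 dc_refl]) (use send_Res.prems \<open>din L r\<close> in auto)
next
  case (send_unfold p q x r)
  have "din L q" using unfold_din send_unfold.hyps(1) send_unfold.prems(1) by blast
  moreover have "din L r" using send_din[OF send_unfold.hyps(2) \<open>din L q\<close>] send_unfold.prems by simp
  ultimately show ?case using send_unfold.prems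
    by (intro red_rel_scong[OF send_unfold.IH _ dc_Par[OF dc_unfold[OF send_unfold.hyps(1)]] dc_refl]) auto
qed

lemma tau_red: "tau p r \<Longrightarrow> din L p \<Longrightarrow> bij \<pi> \<Longrightarrow> red_rel L \<pi> p r"
proof (induction arbitrary: \<pi> rule: tau.induct)
  case (tau_comm1 p q r)
  then show ?case by (intro send_red) auto
next
  case (tau_comm2 q p r)
  then show ?case
    by (intro red_rel_scong[OF send_red _ dc_par_comm dc_refl]) (auto dest: send_din)
next
  case (tau_Par1 p p' q)
  then show ?case by (intro red_rel_Par) (auto dest: tau_din)
next
  case (tau_Par2 q q' p)
  then show ?case
    by (intro red_rel_scong[OF red_rel_Par[of L \<pi> q q' p] _ dc_par_comm dc_par_comm]) (auto dest: tau_din)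
next
  case (tau_Res p p')
  then show ?case by (intro red_rel_Res) (auto dest: tau_din)
next
  case (tau_unfold p q r)
  have "din L q" using unfold_din tau_unfold.hyps(1) tau_unfold.prems(1) by blast
  moreover have "din L r" using tau_din[OF tau_unfold.hyps(2) \<open>din L q\<close>] .
  ultimately show ?case using tau_unfold.prems
    by (intro red_rel_scong[OF tau_unfold.IH _ dc_unfold[OF tau_unfold.hyps(1)] dc_refl]) auto
qed

lemma bij_ident: "bij (\<lambda>a::'a. a)"
  using bij_id by (simp add: id_def)

text \<open>Transitions preserve \<open>din\<close>, so \<open>U\<close> has a named representative
  in the language, and \<open>tau_red\<close> applies to that one.\<close>

lemma red_complete:
  assumes "tau (interp Nm P) U" "P \<in> procs L"
  obtains P' where "red L P P'" "interp Nm P' = U"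
proof -
  have "din L (interp Nm P)" using assms(2) procs_iff[of P L "\<lambda>a. a"] by simp
  moreover from this have "din L U" using assms(1) tau_din by blast
  then obtain P' where "P' \<in> procs L" "interp Nm P' = U" using procs_surj[OF bij_ident] by blast
  ultimately show ?thesis
    using tau_red[OF assms(1) _ bij_ident, of L] assms(2) that unfolding red_rel_def by blast
qed

lemma scong_iff:
  assumes "P \<in> procs L" "Q \<in> procs L"
  shows "scong L P Q \<longleftrightarrow> dscong (interp Nm P) (interp Nm Q)"
proof -
  show ?thesis
    using scong_sound[of L P Q "\<lambda>a. a"] scong_complete[OF _ bij_ident] assms bij_is_inj[OF bij_ident] by auto
qed

lemma reds_procs: "reds L P Q \<Longrightarrow> P \<in> procs L \<Longrightarrow> Q \<in> procs L"
  by (induction rule: rtranclp_induct) (auto dest: red_procs)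

lemma succeeds_iff:
  assumes "P \<in> procs L"
  shows "succeeds L P \<longleftrightarrow> (\<exists>P'. reds L P P' \<and> tops (interp Nm P'))"
proof
  assume "succeeds L P"
  then obtain P' P'' where "reds L P P'" "scong L P' (Par P'' Succ)" by (auto simp: succeeds_def)
  moreover from this have "dscong (interp Nm P') (interp Nm (Par P'' Succ))"
    using scong_iff scong_procs by blast
  ultimately show "\<exists>P'. reds L P P' \<and> tops (interp Nm P')" using tops_scong by fastforce
next
  assume "\<exists>P'. reds L P P' \<and> tops (interp Nm P')"
  then obtain P' where P': "reds L P P'" "tops (interp Nm P')" by blast
  then have p: "P' \<in> procs L" using reds_procs assms by blast
  obtain q where "dscong (interp Nm P') (DPar q DSucc)" using tops_dscong[OF P'(2)] by blast
  \<comment> \<open>The language of \<open>q\<close> has not been tracked, so the representative of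
    its cleaned form is taken.\<close>
  note Q = readback[OF bij_ident, of L q]
  have "clean L (interp Nm P') = interp Nm P'" using p procs_iff[of P' L "\<lambda>a. a"] by (simp add: clean_id)
  then have "scong L P' (Par (readback L (\<lambda>a. a) q) Succ)"
    using scong_complete_clean[OF \<open>dscong (interp Nm P') (DPar q DSucc)\<close> bij_ident, of L] p Q
    by (auto simp: scong_rel_def procs_simps)
  then show "succeeds L P" using P' by (auto simp: succeeds_def)
qed

section \<open>The encoding of de Bruijn processes\<close>

text \<open>Source channels travel inside the data, so a channel-based target needs a single
  channel, the reserved name.\<close>

definition tchan :: "lang \<Rightarrow> nat \<Rightarrow> tm option" where
  "tchan L r = (case medium L of Dataspace \<Rightarrow> None | Channel \<Rightarrow> Some (Nm r))"

definition dout :: "lang \<Rightarrow> nat \<Rightarrow> tm \<Rightarrow> dproc" where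
  "dout L r t =
     (case synchronism L of
        Asynchronous \<Rightarrow> DOut (tchan L r) [t]
      | Synchronous \<Rightarrow> DOutC (tchan L r) [t] DNull)"

fun chan_tm :: "nat \<Rightarrow> tm option \<Rightarrow> tm" where
  "chan_tm r None = Nm r"
| "chan_tm r (Some s) = Cmp (Nm r) s"

primrec list_tm :: "nat \<Rightarrow> tm list \<Rightarrow> tm" where
  "list_tm r [] = Nm r"
| "list_tm r (t # ts) = Cmp t (list_tm r ts)"

definition data_tm :: "nat \<Rightarrow> tm option \<Rightarrow> tm list \<Rightarrow> tm" where
  "data_tm r ch ts = Cmp (chan_tm r ch) (list_tm r ts)"

primrec list_dpat :: "nat \<Rightarrow> dpat list \<Rightarrow> dpat" where
  "list_dpat r [] = DMatch r"
| "list_dpat r (p # ps) = DCmp p (list_dpat r ps)"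

definition data_dpat :: "nat \<Rightarrow> tm option \<Rightarrow> dpat list \<Rightarrow> dpat" where
  "data_dpat r ch ps = DCmp (dmt (chan_tm r ch)) (list_dpat r ps)"

text \<open>This stands below the restriction of the private name, which has index 0 there; hence
  \<open>Suc r\<close> and the weakened continuation. The name-match admits no compound.\<close>

definition await :: "lang \<Rightarrow> nat \<Rightarrow> dproc \<Rightarrow> dproc" where
  "await L r p = DIn (tchan L (Suc r)) [DMatch 0] (ren Suc p)"

definition handshake :: "lang \<Rightarrow> nat \<Rightarrow> tm \<Rightarrow> dproc \<Rightarrow> dproc" where
  "handshake L r t p = DRes (DPar (dout L (Suc r) t) (await L r p))"

text \<open>Once the data are received, the restriction encloses just the receiver's acknowledgement
  and the waiting input, which is again a handshake, with the private name as its message.\<close>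

abbreviation pending :: "lang \<Rightarrow> nat \<Rightarrow> dproc \<Rightarrow> dproc" where
  "pending L r p \<equiv> handshake L r (Nm 0) p"

text \<open>The index \<open>r\<close> is that of the reserved name, which grows under binders.\<close>

primrec denc :: "lang \<Rightarrow> nat \<Rightarrow> dproc \<Rightarrow> dproc" where
  "denc L r DNull = DNull"
| "denc L r (DOut ch ts) = handshake L r (Cmp (Nm 0) (rent Suc (data_tm r ch ts))) DNull"
| "denc L r (DOutC ch ts p) = handshake L r (Cmp (Nm 0) (rent Suc (data_tm r ch ts))) (denc L r p)"
| "denc L r (DIn ch ps p) =
     DIn (tchan L r) [DCmp DBind (data_dpat r ch ps)]
       (DPar (dout L (Suc (r + nbs ps)) (Nm 0)) (ren Suc (denc L (r + nbs ps) p)))"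
| "denc L r (DRes p) = DRes (denc L (Suc r) p)"
| "denc L r (DPar p q) = DPar (denc L r p) (denc L r q)"
| "denc L r (DCond s t p q) = DCond s t (denc L r p) (denc L r q)"
| "denc L r (DRep p) = DRep (denc L r p)"
| "denc L r DSucc = DSucc"

lemma tchan_subst: "\<sigma> r = Nm r' \<Longrightarrow> map_option (subst_tm \<sigma>) (tchan L r) = tchan L r'"
  by (simp add: tchan_def split: medium.splits)

lemma dout_ds: "\<sigma> r = Nm r' \<Longrightarrow> ds \<sigma> (dout L r t) = dout L r' (subst_tm \<sigma> t)"
  by (simp add: dout_def tchan_subst split: synchronism.splits)

lemma chan_tm_subst: "\<sigma> r = Nm r' \<Longrightarrow> subst_tm \<sigma> (chan_tm r ch) = chan_tm r' (map_option (subst_tm \<sigma>) ch)"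
  by (cases ch) auto

lemma list_tm_subst: "\<sigma> r = Nm r' \<Longrightarrow> subst_tm \<sigma> (list_tm r ts) = list_tm r' (map (subst_tm \<sigma>) ts)"
  by (induction ts) auto

lemma data_tm_subst:
  "\<sigma> r = Nm r' \<Longrightarrow> subst_tm \<sigma> (data_tm r ch ts) = data_tm r' (map_option (subst_tm \<sigma>) ch) (map (subst_tm \<sigma>) ts)"
  by (simp add: data_tm_def chan_tm_subst list_tm_subst)

lemma list_dpat_subst: "\<sigma> r = Nm r' \<Longrightarrow> dps \<sigma> (list_dpat r ps) = list_dpat r' (map (dps \<sigma>) ps)"
  by (induction ps) auto

lemma data_dpat_subst:
  "\<sigma> r = Nm r' \<Longrightarrow> dps \<sigma> (data_dpat r ch ps) = data_dpat r' (map_option (subst_tm \<sigma>) ch) (map (dps \<sigma>) ps)"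
  by (simp add: data_dpat_def chan_tm_subst list_dpat_subst)

lemma nb_list_dpat [simp]: "nb (list_dpat r ps) = nbs ps"
  by (induction ps) auto

lemma nb_data_dpat [simp]: "nb (data_dpat r ch ps) = nbs ps"
  by (simp add: data_dpat_def)

lemma ds_up_ren: "ds (up (Suc k) \<sigma>) (ren Suc p) = ren Suc (ds (up k \<sigma>) p)"
proof -
  have "up (Suc k) \<sigma> (Suc i) = rent Suc (up k \<sigma> i)" for i
    by (auto simp: up_def sh_def subst_tm_comp)
  then show ?thesis by (simp add: ds_ds)
qed

lemma up_0 [simp]: "up 0 \<sigma> = \<sigma>"
  by (auto simp: up_def)

lemma subst_up_rent: "subst_tm (up (Suc 0) \<sigma>) (rent Suc t) = rent Suc (subst_tm \<sigma> t)"
  using subst_up_sh[of 1 \<sigma> t] by (simp add: sh_def)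

lemma handshake_ds:
  assumes "\<sigma> r = Nm r'"
  shows "ds \<sigma> (handshake L r t p) = handshake L r' (subst_tm (up 1 \<sigma>) t) (ds \<sigma> p)"
proof -
  have "up (Suc 0) \<sigma> (Suc r) = Nm (Suc r')" "up (Suc 0) \<sigma> 0 = Nm 0" using assms by (auto simp: up_def)
  then show ?thesis
    using ds_up_ren[of 0 \<sigma> p] by (simp add: handshake_def await_def dout_ds tchan_subst)
qed

text \<open>Compound terms may be substituted as well, as long as the reserved name stays a name:
  channels and matched names sit inside packed terms and patterns, where a compound is
  admissible.\<close>

lemma denc_ds: "\<sigma> r = Nm r' \<Longrightarrow> ds \<sigma> (denc L r d) = denc L r' (ds \<sigma> d)"
proof (induction d arbitrary: \<sigma> r r')
  case DNull
  show ?case by simp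
next
  case (DOut ch ts)
  have "subst_tm \<sigma> (data_tm r ch ts) = data_tm r' (map_option (subst_tm \<sigma>) ch) (map (subst_tm \<sigma>) ts)"
    using DOut by (rule data_tm_subst)
  moreover have "up 1 \<sigma> 0 = Nm 0" by (simp add: up_def)
  ultimately show ?case using DOut
    by (simp only: denc.simps ds.simps handshake_ds subst_tm.simps One_nat_def subst_up_rent)
next
  case (DOutC ch ts d)
  have "subst_tm \<sigma> (data_tm r ch ts) = data_tm r' (map_option (subst_tm \<sigma>) ch) (map (subst_tm \<sigma>) ts)"
    using DOutC.prems by (rule data_tm_subst)
  moreover have "up 1 \<sigma> 0 = Nm 0" by (simp add: up_def)
  ultimately show ?case using DOutC
    by (simp only: denc.simps ds.simps handshake_ds subst_tm.simps One_nat_def subst_up_rent)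
next
  case (DIn ch ps d)
  have 1: "up (nbs ps) \<sigma> (r + nbs ps) = Nm (r' + nbs ps)"
    using DIn.prems by (auto simp: up_def)
  have 2: "up (Suc (nbs ps)) \<sigma> (Suc (r + nbs ps)) = Nm (Suc (r' + nbs ps))" "up (Suc (nbs ps)) \<sigma> 0 = Nm 0"
    using DIn.prems by (auto simp: up_def)
  show ?case
    using DIn.prems by (simp add: tchan_subst data_dpat_subst dout_ds[of "up (Suc (nbs ps)) \<sigma>", OF 2(1)] 2(2) ds_up_ren DIn.IH[of "up (nbs ps) \<sigma>", OF 1])
next
  case (DRes d)
  have "up 1 \<sigma> (Suc r) = Nm (Suc r')" using DRes.prems by (auto simp: up_def)
  then show ?case by (simp add: DRes.IH[of "up 1 \<sigma>", simplified])
qed auto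

lemma denc_ren: "ren f (denc L r d) = denc L (f r) (ren f d)"
  by (rule denc_ds) simp

section \<open>Matching of packed data and the elementary steps of a handshake\<close>

lemma dmatch_dmt: "dmatch t (dmt s) = (if t = s then Some [] else None)"
proof (induction s arbitrary: t)
  case (Nm a) then show ?case by (cases t) auto
next
  case (Cmp s1 s2) then show ?case by (cases t) auto
qed

lemma dmatch_list: "dmatch (list_tm r ts) (list_dpat r ps) = dmatches ts ps"
proof (induction ps arbitrary: ts)
  case Nil then show ?case by (cases ts) auto
next
  case (Cons p ps) then show ?case by (cases ts) auto
qed

text \<open>The reserved name at the end of the spine forces the number of components. The received
  term is arbitrary, as needed for an induction over input transitions.\<close>

lemma dmatch_list_inv:
  "dmatch u (list_dpat r ps) = Some vs \<Longrightarrow> \<exists>ts. u = list_tm r ts \<and> dmatches ts ps = Some vs"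
proof (induction ps arbitrary: u vs)
  case Nil
  then show ?case by (cases u) (auto intro!: exI[of _ "[]"] split: if_splits)
next
  case (Cons p ps)
  then obtain t u' us ws where u: "u = Cmp t u'" "dmatch t p = Some us" "dmatch u' (list_dpat r ps) = Some ws" "vs = us @ ws"
    by (cases u) (auto split: option.splits)
  then obtain ts where "u' = list_tm r ts" "dmatches ts ps = Some ws" using Cons.IH by blast
  then show ?case using u by (auto intro!: exI[of _ "t # ts"])
qed

lemma dmatch_data:
  "dmatch (Cmp n (data_tm r ch ts)) (DCmp DBind (data_dpat r ch ps)) = map_option (\<lambda>vs. n # vs) (dmatches ts ps)"
  by (auto simp: data_tm_def data_dpat_def dmatch_dmt dmatch_list split: option.splits)

lemma dmatch_data_inv:
  assumes "dmatch u (DCmp DBind (data_dpat r ch ps)) = Some ws"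
  obtains n ts vs where "u = Cmp n (data_tm r ch ts)" "dmatches ts ps = Some vs" "ws = n # vs"
proof -
  obtain n d vs where u: "u = Cmp n d" "dmatch d (data_dpat r ch ps) = Some vs" "ws = n # vs"
    using assms by (cases u) (auto split: option.splits)
  then obtain c l where d: "d = Cmp c l" "c = chan_tm r ch" "dmatch l (list_dpat r ps) = Some vs"
    by (cases d) (auto simp: data_dpat_def dmatch_dmt split: option.splits if_splits)
  then show ?thesis using u dmatch_list_inv[OF d(3)] that by (auto simp: data_tm_def)
qed

lemma inst_Nil [simp]: "inst [] = Nm"
  by (auto simp: inst_def)

text \<open>The acknowledgement binder comes first in the packed pattern, so it has index 0 and the
  source continuation is weakened past it. After instantiation the continuation sees only
  \<open>vs\<close>.\<close>

lemma inp_denc_In: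
  assumes "dmatches ts ps = Some vs"
  shows "ds (inst (n # vs)) (DPar (dout L (Suc (r + nbs ps)) (Nm 0)) (ren Suc (denc L (r + nbs ps) p))) =
    DPar (dout L r n) (denc L r (ds (inst vs) p))"
proof -
  have len: "length vs = nbs ps" using assms by (rule dmatches_length)
  have 1: "inst (n # vs) (Suc (r + nbs ps)) = Nm r" "inst (n # vs) 0 = n" "inst vs (r + nbs ps) = Nm r"
    by (auto simp: inst_def len)
  have "(\<lambda>i. inst (n # vs) (Suc i)) = inst vs" by (auto simp: inst_def)
  then have "ds (inst (n # vs)) (ren Suc (denc L (r + nbs ps) p)) = ds (inst vs) (denc L (r + nbs ps) p)"
    by (simp add: ds_ds)
  then show ?thesis using 1 by (simp add: dout_ds denc_ds)
qed

lemma inp_denc: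
  assumes "dmatches ts ps = Some vs"
  shows "inp (denc L r (DIn ch ps p)) (tchan L r) [Cmp n (data_tm r ch ts)]
    (DPar (dout L r n) (denc L r (ds (inst vs) p)))"
proof -
  have "dmatches [Cmp n (data_tm r ch ts)] [DCmp DBind (data_dpat r ch ps)] = Some (n # vs)"
    using assms dmatch_data[of n r ch ts ps] by simp
  from inp_In[OF this] show ?thesis
    unfolding inp_denc_In[OF assms, symmetric] denc.simps .
qed

lemma dout_send: "inp x (tchan L r) [t] x' \<Longrightarrow> send (dout L r t) x (DPar DNull x')"
  by (auto simp: dout_def intro!: send_out split: synchronism.splits)

lemma dout_sendE: "send (dout L r t) x y \<Longrightarrow> \<exists>x'. y = DPar DNull x' \<and> inp x (tchan L r) [t] x'"
  by (auto simp: dout_def elim: send.cases split: synchronism.splits)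

lemma dout_inp: "\<not> inp (dout L r t) ch ts x"
  by (auto simp: dout_def split: synchronism.splits)

lemma dout_tau: "\<not> tau (dout L r t) x"
  by (auto simp: dout_def split: synchronism.splits)

text \<open>
  \<open>prel L r s t k\<close>: \<open>t\<close> is the encoding of \<open>s\<close> in which \<open>k\<close> outputs have been received, but the
  acknowledgement that releases their continuation is still pending.
\<close>

inductive prel :: "lang \<Rightarrow> nat \<Rightarrow> dproc \<Rightarrow> dproc \<Rightarrow> nat \<Rightarrow> bool" for L where
  pr_enc: "prel L r s (denc L r s) 0"
| pr_pending: "prel L r s (pending L r (denc L r s)) 1"
| pr_Par: "prel L r s1 t1 k1 \<Longrightarrow> prel L r s2 t2 k2 \<Longrightarrow> prel L r (DPar s1 s2) (DPar t1 t2) (k1 + k2)"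
| pr_Res: "prel L (Suc r) s t k \<Longrightarrow> prel L r (DRes s) (DRes t) k"

lemma pending_ren: "ren f (pending L r (denc L r s)) = pending L (f r) (denc L (f r) (ren f s))"
  using handshake_ds[of "\<lambda>i. Nm (f i)" r "f r"] by (simp add: denc_ren up_def)

lemma prel_ren: "prel L r s t k \<Longrightarrow> prel L (f r) (ren f s) (ren f t) k"
proof (induction arbitrary: f rule: prel.induct)
  case (pr_enc r s)
  then show ?case unfolding denc_ren by (rule prel.pr_enc)
next
  case (pr_pending r s)
  show ?case unfolding pending_ren by (rule prel.pr_pending)
next
  case (pr_Par r s1 t1 k1 s2 t2 k2)
  then show ?case by (simp add: prel.pr_Par)
next
  case (pr_Res r s t k)
  have "upf 1 f (Suc r) = Suc (f r)" by (simp add: upf_def)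
  then show ?case using pr_Res.IH[of "upf 1 f"] by (simp only: ren_DRes prel.pr_Res)
qed

lemma prel_ren_inv:
  "prel L r' s' t k \<Longrightarrow> s' = ren f s \<Longrightarrow> r' = f r \<Longrightarrow> \<exists>t'. t = ren f t' \<and> prel L r s t' k"
proof (induction arbitrary: f s r rule: prel.induct)
  case (pr_enc r' s')
  then show ?case using prel.pr_enc denc_ren by metis
next
  case (pr_pending r' s')
  then show ?case using prel.pr_pending pending_ren by metis
next
  case (pr_Par r' s1 t1 k1 s2 t2 k2)
  then obtain q1 q2 where q: "s = DPar q1 q2" "s1 = ren f q1" "s2 = ren f q2" by (cases s) auto
  obtain u1 where "t1 = ren f u1" "prel L r q1 u1 k1" using pr_Par.IH(1)[OF q(2) pr_Par.prems(2)] by blast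
  moreover obtain u2 where "t2 = ren f u2" "prel L r q2 u2 k2" using pr_Par.IH(2)[OF q(3) pr_Par.prems(2)] by blast
  ultimately show ?case using q(1) by (auto intro!: exI[of _ "DPar u1 u2"] prel.pr_Par)
next
  case (pr_Res r' s' t k)
  then obtain q where q: "s = DRes q" "s' = ren (upf 1 f) q" by (cases s) (auto simp: up_ren)
  have "Suc r' = upf 1 f (Suc r)" using pr_Res.prems by (simp add: upf_def)
  then obtain u where "t = ren (upf 1 f) u" "prel L (Suc r) q u k" using pr_Res.IH[OF q(2)] by blast
  then show ?case using q(1) by (auto simp: up_ren intro!: exI[of _ "DRes u"] prel.pr_Res)
qed

lemma prel_ParD:
  assumes "prel L r s (DPar t1 t2) k"
  shows "\<exists>s1 s2 k1 k2. s = DPar s1 s2 \<and> prel L r s1 t1 k1 \<and> prel L r s2 t2 k2 \<and> k = k1 + k2"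
  using assms
proof cases
  case (pr_enc)
  then obtain s1 s2 where "s = DPar s1 s2" "t1 = denc L r s1" "t2 = denc L r s2"
    by (cases s) (auto simp: handshake_def)
  then show ?thesis using pr_enc prel.pr_enc by fastforce
qed (auto simp: handshake_def)

text \<open>Encoded outputs begin with a restriction too, so the shape alone does not tell a source
  restriction from a handshake before or after reception.\<close>

lemma prel_ResD:
  assumes "prel L r s (DRes t) k"
  shows "(\<exists>ch ts p. out_thread s ch ts p \<and> k = 0 \<and>
       DRes t = handshake L r (Cmp (Nm 0) (rent Suc (data_tm r ch ts))) (denc L r p)) \<or>
    (DRes t = pending L r (denc L r s) \<and> k = 1) \<or>
    (\<exists>s'. s = DRes s' \<and> prel L (Suc r) s' t k)"
  using assms
proof cases
  case (pr_enc)
  then show ?thesis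
    by (cases s) (auto simp: handshake_def intro: prel.pr_enc)
qed auto

lemma unfold_denc: "unfold (denc L r s) t \<Longrightarrow> \<exists>s'. unfold s s' \<and> t = denc L r s'"
  by (cases s) (auto simp: handshake_def)

lemma prel_unfold:
  assumes "prel L r s t k" "unfold t t'"
  shows "\<exists>s'. unfold s s' \<and> prel L r s' t' k"
  using assms(1)
proof cases
  case pr_enc
  then show ?thesis using unfold_denc[of L r s t'] assms(2) prel.pr_enc by blast
qed (use assms(2) in \<open>auto simp: handshake_def\<close>)

lemma prel_InD:
  assumes "prel L r s (DIn c qs t) k"
  shows "\<exists>ch ps p. s = DIn ch ps p \<and> DIn c qs t = denc L r s \<and> k = 0"
  using assms
proof cases
  case (pr_enc)
  then show ?thesis by (cases s) (auto simp: handshake_def)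
qed (auto simp: handshake_def)

text \<open>Every output of an encoding lies below the restriction of its handshake or behind an
  input, so \<open>send_out\<close> never applies directly.\<close>

lemma prel_not_out: "prel L r s t k \<Longrightarrow> \<not> out_thread t ch ts t'"
proof (induction rule: prel.induct)
  case (pr_enc r s)
  then show ?case by (cases s) (auto simp: handshake_def)
qed (auto simp: handshake_def)

lemma list_tm_ren_inv: "rent Suc u = list_tm (Suc r) ts \<Longrightarrow> \<exists>ts'. u = list_tm r ts' \<and> ts = rents Suc ts'"
proof (induction ts arbitrary: u)
  case Nil
  then show ?case by (cases u) (auto intro: exI[of _ "[]"])
next
  case (Cons t ts)
  then obtain t' u' where u: "u = Cmp t' u'" "t = rent Suc t'" "rent Suc u' = list_tm (Suc r) ts" by (cases u) auto
  then obtain ts' where "u' = list_tm r ts'" "ts = rents Suc ts'" using Cons.IH by blast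
  then show ?case using u by (intro exI[of _ "t' # ts'"]) simp
qed

lemma chan_tm_ren_inv: "rent Suc u = chan_tm (Suc r) ch \<Longrightarrow> \<exists>ch'. u = chan_tm r ch' \<and> ch = rento Suc ch'"
proof (cases ch)
  case None
  assume "rent Suc u = chan_tm (Suc r) ch"
  then show ?thesis using None by (cases u) (auto intro: exI[of _ None])
next
  case (Some s)
  assume "rent Suc u = chan_tm (Suc r) ch"
  then obtain v w where "u = Cmp v w" "rent Suc v = Nm (Suc r)" "rent Suc w = s" using Some by (cases u) auto
  moreover from this have "v = Nm r" by (cases v) auto
  ultimately show ?thesis using Some by (auto intro!: exI[of _ "Some w"])
qed

text \<open>An input below a restriction sees a weakened label. This recovers the packed data as
  they were before weakening.\<close>

lemma data_tm_ren_inv: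
  assumes "rent Suc u = Cmp n (data_tm (Suc r) ch ts)"
  obtains n' ch' ts' where "u = Cmp n' (data_tm r ch' ts')" "n = rent Suc n'"
    "ch = rento Suc ch'" "ts = rents Suc ts'"
proof -
  from assms obtain n' d where u: "u = Cmp n' d" "n = rent Suc n'" "rent Suc d = data_tm (Suc r) ch ts"
    by (cases u) auto
  then obtain c l where d: "d = Cmp c l" "rent Suc c = chan_tm (Suc r) ch" "rent Suc l = list_tm (Suc r) ts"
    by (cases d) (auto simp: data_tm_def)
  then show ?thesis using chan_tm_ren_inv[OF d(2)] list_tm_ren_inv[OF d(3)] u that by (auto simp: data_tm_def)
qed

lemma list_tm_inj: "list_tm r ts = list_tm r ts' \<Longrightarrow> ts = ts' "
proof (induction ts arbitrary: ts')
  case Nil then show ?case by (cases ts') auto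
next
  case (Cons t ts) then show ?case by (cases ts') auto
qed

lemma data_tm_inj: "data_tm r ch ts = data_tm r ch' ts' \<longleftrightarrow> ch = ch' \<and> ts = ts'"
  by (cases ch; cases ch') (auto simp: data_tm_def dest: list_tm_inj)

lemma await_inp: "inp (await L r p) ch us x \<Longrightarrow> us = [Nm 0] \<and> x = ren Suc p"
  by (auto simp: await_def split: if_splits option.splits elim!: dmatches.elims dmatch.elims)

text \<open>Privacy of the acknowledgement: a label that enters the restriction is shifted and
  cannot be \<open>Nm 0\<close>, the only term that \<open>await\<close> accepts.\<close>

lemma handshake_inp: "\<not> inp (handshake L r t p) ch us x"
proof
  assume "inp (handshake L r t p) ch us x"
  then obtain x' where "inp (await L r p) (rento Suc ch) (rents Suc us) x'"
    by (auto simp: handshake_def dout_inp elim!: inp_ResE inp_ParE)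
  then have "rents Suc us = [Nm 0]" using await_inp by blast
  then show False by (auto simp: map_eq_Cons_conv) (metis nat.distinct(1) subst_tm.simps tm.distinct(1) tm.exhaust tm.inject(1))
qed

text \<open>By \<open>handshake_inp\<close>, waiting inputs are shielded, so the receiving prefix is
  an encoded input. The received term is thus a packed compound, which rules out the theft of an
  acknowledgement. The answer to \<open>n\<close> floats out through all restrictions, because
  \<open>n\<close> came from outside them.\<close>

lemma prel_inp:
  "inp t c us t' \<Longrightarrow> prel L r s t k \<Longrightarrow> us = [u] \<Longrightarrow>
    \<exists>n ch ts s' v k'. u = Cmp n (data_tm r ch ts) \<and> inp s ch ts s' \<and> prel L r s' v k' \<and>
      dscong t' (DPar (dout L r n) v)"
proof (induction arbitrary: r s k u rule: inp.induct)
  case (inp_In ts ps vs c q)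
  then obtain ch ps' p where s: "s = DIn ch ps' p" "DIn c ps q = denc L r s"
    using prel_InD by blast
  then have ps: "ps = [DCmp DBind (data_dpat r ch ps')]" by simp
  then have "dmatch u (DCmp DBind (data_dpat r ch ps')) = Some vs"
    using inp_In.hyps inp_In.prems(2) by (auto split: option.splits)
  then obtain n us ws where u: "u = Cmp n (data_tm r ch us)" "dmatches us ps' = Some ws" "vs = n # ws"
    by (rule dmatch_data_inv)
  have "ds (inst vs) q = DPar (dout L r n) (denc L r (ds (inst ws) p))"
    using inp_denc_In[OF u(2), of n L r p] s u(3) by simp
  moreover have "inp s ch us (ds (inst ws) p)" unfolding s(1) using u(2) by (rule inp.inp_In)
  ultimately show ?case using u(1) pr_enc by fastforce
next
  case (inp_Par1 t1 c us t1' t2)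
  obtain s1 s2 k1 k2 where s: "s = DPar s1 s2" "prel L r s1 t1 k1" "prel L r s2 t2 k2"
    using prel_ParD[OF inp_Par1.prems(1)] by blast
  obtain n ch ts s' v k' where *: "u = Cmp n (data_tm r ch ts)" "inp s1 ch ts s'" "prel L r s' v k'"
    "dscong t1' (DPar (dout L r n) v)"
    using inp_Par1.IH[OF s(2) inp_Par1.prems(2)] by blast
  have "dscong (DPar t1' t2) (DPar (dout L r n) (DPar v t2))"
    by (rule dc_trans[OF dc_Par[OF *(4)] dc_par_assoc2])
  moreover have "inp s ch ts (DPar s' s2)" unfolding s(1) using *(2) by (rule inp.inp_Par1)
  moreover have "prel L r (DPar s' s2) (DPar v t2) (k' + k2)" using *(3) s(3) by (rule pr_Par)
  ultimately show ?case using *(1) by blast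
next
  case (inp_Par2 t2 c us t2' t1)
  obtain s1 s2 k1 k2 where s: "s = DPar s1 s2" "prel L r s1 t1 k1" "prel L r s2 t2 k2"
    using prel_ParD[OF inp_Par2.prems(1)] by blast
  obtain n ch ts s' v k' where *: "u = Cmp n (data_tm r ch ts)" "inp s2 ch ts s'" "prel L r s' v k'"
    "dscong t2' (DPar (dout L r n) v)"
    using inp_Par2.IH[OF s(3) inp_Par2.prems(2)] by blast
  have "dscong (DPar t1 t2') (DPar (dout L r n) (DPar t1 v))"
    by (rule dc_trans[OF dc_Par2[OF *(4)] dc_left_comm])
  moreover have "inp s ch ts (DPar s1 s')" unfolding s(1) using *(2) by (rule inp.inp_Par2)
  moreover have "prel L r (DPar s1 s') (DPar t1 v) (k1 + k')" using s(2) *(3) by (rule pr_Par)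
  ultimately show ?case using *(1) by blast
next
  case (inp_Res t c us t')
  have "inp (DRes t) c us (DRes t')" using inp_Res.hyps by (rule inp.inp_Res)
  then obtain s0 where s: "s = DRes s0" "prel L (Suc r) s0 t k"
    using prel_ResD[OF inp_Res.prems(1)] handshake_inp by metis
  have "rents Suc us = [rent Suc u]" using inp_Res.prems(2) by simp
  from inp_Res.IH[OF s(2) this] obtain n0 ch0 ts0 s' v k' where *:
    "rent Suc u = Cmp n0 (data_tm (Suc r) ch0 ts0)" "inp s0 ch0 ts0 s'" "prel L (Suc r) s' v k'"
    "dscong t' (DPar (dout L (Suc r) n0) v)" by blast
  obtain n ch ts where u: "u = Cmp n (data_tm r ch ts)" "n0 = rent Suc n"
    "ch0 = rento Suc ch" "ts0 = rents Suc ts"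
    using data_tm_ren_inv[OF *(1)] by blast
  have "dout L (Suc r) n0 = ren Suc (dout L r n)" unfolding u(2) by (rule dout_ds[symmetric]) simp
  then have "dscong (DRes t') (DPar (dout L r n) (DRes v))"
    using dc_trans[OF dc_Res[OF *(4)]] dc_sym[OF dc_scope] by simp
  moreover have "inp s ch ts (DRes s')" unfolding s(1) using *(2) u(3,4) inp.inp_Res by blast
  moreover have "prel L r (DRes s') (DRes v) k'" using *(3) by (rule pr_Res)
  ultimately show ?case using u(1) by blast
next
  case (inp_unfold t t1 c us t')
  obtain s' where "unfold s s'" "prel L r s' t1 k"
    using prel_unfold[OF inp_unfold.prems(1) inp_unfold.hyps(1)] by blast
  then show ?case using inp_unfold.IH[OF _ inp_unfold.prems(2)] by (blast intro: inp.inp_unfold)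
qed

lemma handshake_sendE:
  assumes "send (handshake L r t p) x y"
  obtains x' where "inp (ren Suc x) (tchan L (Suc r)) [t] x'" "y = DRes (DPar (DPar DNull x') (await L r p))"
proof -
  obtain y' where y': "y = DRes y'" "send (DPar (dout L (Suc r) t) (await L r p)) (ren Suc x) y'"
    using assms by (auto simp: handshake_def elim: send_ResE)
  then obtain z where "send (dout L (Suc r) t) (ren Suc x) z" "y' = DPar z (await L r p)"
    by (auto simp: await_def elim: send_ParE)
  then show ?thesis using dout_sendE y'(1) that by blast
qed

text \<open>The receiver's continuation \<open>v\<close> does not use the private name and leaves
  its scope. Below the restriction remains the acknowledgement facing \<open>await\<close>.\<close>

lemma handshake_scong:
  assumes "dscong x (DPar (dout L (Suc r) (Nm 0)) (ren Suc v))"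
  shows "dscong (DRes (DPar (DPar DNull x) (await L r p))) (DPar (pending L r p) v)"
proof -
  have "dscong (DPar (DPar DNull x) (await L r p)) (DPar (DPar (dout L (Suc r) (Nm 0)) (ren Suc v)) (await L r p))"
    by (rule dc_Par[OF dc_trans[OF dc_nil2 assms]])
  then have "dscong (DPar (DPar DNull x) (await L r p)) (DPar (DPar (dout L (Suc r) (Nm 0)) (await L r p)) (ren Suc v))"
    by (rule dc_trans[OF _ dc_swap_right])
  then show ?thesis unfolding handshake_def by (rule dc_trans[OF dc_Res dc_sym[OF dc_scope2]])
qed

text \<open>What leaves a related process is an output not yet received, since acknowledgements find
  no receiver outside. Hence the exchange is a source communication that leaves one more
  acknowledgement pending.\<close>

lemma prel_send:
  "send t x t' \<Longrightarrow> prel L r s t k \<Longrightarrow> prel L r y x j \<Longrightarrow>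
    \<exists>s' v k'. send s y s' \<and> prel L r s' v k' \<and> dscong t' v"
proof (induction arbitrary: r s k y j rule: send.induct)
  case (send_Par1 t1 x t1' t2)
  obtain s1 s2 k1 k2 where s: "s = DPar s1 s2" "prel L r s1 t1 k1" "prel L r s2 t2 k2"
    using prel_ParD[OF send_Par1.prems(1)] by blast
  from send_Par1.IH[OF s(2) send_Par1.prems(2)] show ?case
    unfolding s(1) using s(3) by (blast intro: send.send_Par1 pr_Par dc_Par)
next
  case (send_Par2 t2 x t2' t1)
  obtain s1 s2 k1 k2 where s: "s = DPar s1 s2" "prel L r s1 t1 k1" "prel L r s2 t2 k2"
    using prel_ParD[OF send_Par2.prems(1)] by blast
  from send_Par2.IH[OF s(3) send_Par2.prems(2)] show ?case
    unfolding s(1) using s(2) by (blast intro: send.send_Par2 pr_Par dc_Par2)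
next
  case (send_Res t x t')
  have send: "send (DRes t) x (DRes t')" using send_Res.hyps by (rule send.send_Res)
  have x: "prel L (Suc r) (ren Suc y) (ren Suc x) j" using prel_ren[OF send_Res.prems(2)] .
  from prel_ResD[OF send_Res.prems(1)] show ?case
  proof (elim disjE exE conjE)
    fix ch ts p
    assume out: "out_thread s ch ts p" and "k = 0"
      and t: "DRes t = handshake L r (Cmp (Nm 0) (rent Suc (data_tm r ch ts))) (denc L r p)"
    obtain x' where x': "inp (ren Suc x) (tchan L (Suc r)) [Cmp (Nm 0) (rent Suc (data_tm r ch ts))] x'"
      "DRes t' = DRes (DPar (DPar DNull x') (await L r (denc L r p)))"
      using send unfolding t by (rule handshake_sendE)
    obtain n ch' ts' y1 v k' where *: "Cmp (Nm 0) (rent Suc (data_tm r ch ts)) = Cmp n (data_tm (Suc r) ch' ts')"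
      "inp (ren Suc y) ch' ts' y1" "prel L (Suc r) y1 v k'" "dscong x' (DPar (dout L (Suc r) n) v)"
      using prel_inp[OF x'(1) x refl] by blast
    \<comment> \<open>Injectivity of packing identifies what the receiver unpacked with what the
      sender packed, so both take part in the same source communication.\<close>
    then have n: "n = Nm 0" "ch' = rento Suc ch" "ts' = rents Suc ts"
      by (auto simp: data_tm_subst[of "\<lambda>i. Nm (Suc i)" r "Suc r"] data_tm_inj)
    obtain y2 where y2: "y1 = ren Suc y2" "inp y ch ts y2"
      using inp_ren_inv[OF *(2) refl n(2,3)] by auto
    obtain w where w: "v = ren Suc w" "prel L r y2 w k'"
      using prel_ren_inv[OF *(3) y2(1) refl] by blast
    have "send s y (DPar p y2)"
      using out y2(2) by (rule send_out)
    moreover have "prel L r (DPar p y2) (DPar (pending L r (denc L r p)) w) (1 + k')"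
      using w(2) by (intro pr_Par pr_pending)
    moreover have "dscong (DRes t') (DPar (pending L r (denc L r p)) w)"
      unfolding x'(2) using *(4) n(1) w(1) by (intro handshake_scong) simp
    ultimately show ?thesis by blast
  next
    \<comment> \<open>The message would be an atom, but a related receiver accepts only
      compounds.\<close>
    assume t: "DRes t = pending L r (denc L r s)" and "k = 1"
    obtain x' where x': "inp (ren Suc x) (tchan L (Suc r)) [Nm 0] x'"
      using send unfolding t by (rule handshake_sendE)
    show ?thesis using prel_inp[OF x' x refl] by auto
  next
    fix s0 assume s: "s = DRes s0" "prel L (Suc r) s0 t k"
    from send_Res.IH[OF s(2) x] show ?thesis
      unfolding s(1) by (blast intro: send.send_Res pr_Res dc_Res)
  qed
next
  case (send_unfold t t1 x t')
  obtain s' where "unfold s s'" "prel L r s' t1 k"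
    using prel_unfold[OF send_unfold.prems(1) send_unfold.hyps(1)] by blast
  then show ?case using send_unfold.IH[OF _ send_unfold.prems(2)] by (blast intro: send.send_unfold)
qed (simp_all add: prel_not_out)

text \<open>The message meets its own \<open>await\<close> only if it is the bare private name. An
  output not yet received carries a compound and makes no step by itself.\<close>

lemma handshake_tauE:
  assumes "tau (handshake L r t p) y"
  shows "t = Nm 0 \<and> dscong y p"
proof -
  obtain y' where y': "y = DRes y'" "tau (DPar (dout L (Suc r) t) (await L r p)) y'"
    using assms by (auto simp: handshake_def elim: tau_ResE)
  then have "send (dout L (Suc r) t) (await L r p) y'"
    by (auto simp: dout_tau await_def elim: tau_ParE)
  then obtain x' where x': "y' = DPar DNull x'" "inp (await L r p) (tchan L (Suc r)) [t] x'"
    using dout_sendE by blast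
  then have "t = Nm 0" "x' = ren Suc p" using await_inp by blast+
  then show ?thesis unfolding y'(1) x'(1) using dc_trans[OF dc_Res[OF dc_nil2] dc_res_unused] by simp
qed

lemma pending_tau: "\<exists>y. tau (pending L r p) y \<and> dscong y p"
proof -
  have "inp (await L r p) (tchan L (Suc r)) [Nm 0] (ds (inst []) (ren Suc p))"
    unfolding await_def by (rule inp_In) simp
  then have "tau (pending L r p) (DRes (DPar DNull (ds (inst []) (ren Suc p))))"
    unfolding handshake_def by (intro tau_Res tau_comm1 dout_send)
  then show ?thesis using handshake_tauE by blast
qed

text \<open>A communication between two components is a data exchange and thus a whole source step.
  A step inside one handshake is an acknowledgement and lowers \<open>k\<close>.\<close>

lemma prel_tau:
  "tau t t' \<Longrightarrow> prel L r s t k \<Longrightarrow>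
    (\<exists>s' v k'. tau s s' \<and> prel L r s' v k' \<and> dscong t' v) \<or>
    (\<exists>v k'. k' < k \<and> prel L r s v k' \<and> dscong t' v)"
proof (induction arbitrary: r s k rule: tau.induct)
  case (tau_comm1 t1 t2 t')
  obtain s1 s2 k1 k2 where s: "s = DPar s1 s2" "prel L r s1 t1 k1" "prel L r s2 t2 k2"
    using prel_ParD[OF tau_comm1.prems(1)] by blast
  from prel_send[OF tau_comm1.hyps s(2,3)] show ?case unfolding s(1) by (blast intro: tau.tau_comm1)
next
  case (tau_comm2 t2 t1 t')
  obtain s1 s2 k1 k2 where s: "s = DPar s1 s2" "prel L r s1 t1 k1" "prel L r s2 t2 k2"
    using prel_ParD[OF tau_comm2.prems(1)] by blast
  from prel_send[OF tau_comm2.hyps s(3,2)] show ?case unfolding s(1) by (blast intro: tau.tau_comm2)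
next
  case (tau_Par1 t1 t1' t2)
  obtain s1 s2 k1 k2 where s: "s = DPar s1 s2" "prel L r s1 t1 k1" "prel L r s2 t2 k2" "k = k1 + k2"
    using prel_ParD[OF tau_Par1.prems(1)] by blast
  from tau_Par1.IH[OF s(2)] show ?case
  proof (elim disjE exE conjE)
    fix s' v k' assume *: "tau s1 s'" "prel L r s' v k'" "dscong t1' v"
    then show ?thesis using s(3) unfolding s(1) by (blast intro: tau.tau_Par1 pr_Par dc_Par)
  next
    fix v k' assume *: "k' < k1" "prel L r s1 v k'" "dscong t1' v"
    then have "k' + k2 < k" "prel L r s (DPar v t2) (k' + k2)" "dscong (DPar t1' t2) (DPar v t2)"
      using s by (auto intro: pr_Par dc_Par)
    then show ?thesis by blast
  qed
next
  case (tau_Par2 t2 t2' t1)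
  obtain s1 s2 k1 k2 where s: "s = DPar s1 s2" "prel L r s1 t1 k1" "prel L r s2 t2 k2" "k = k1 + k2"
    using prel_ParD[OF tau_Par2.prems(1)] by blast
  from tau_Par2.IH[OF s(3)] show ?case
  proof (elim disjE exE conjE)
    fix s' v k' assume *: "tau s2 s'" "prel L r s' v k'" "dscong t2' v"
    then show ?thesis using s(2) unfolding s(1) by (blast intro: tau.tau_Par2 pr_Par dc_Par2)
  next
    fix v k' assume *: "k' < k2" "prel L r s2 v k'" "dscong t2' v"
    then have "k1 + k' < k" "prel L r s (DPar t1 v) (k1 + k')" "dscong (DPar t1 t2') (DPar t1 v)"
      using s by (auto intro: pr_Par dc_Par2)
    then show ?thesis by blast
  qed
next
  case (tau_Res t t')
  have tau: "tau (DRes t) (DRes t')" using tau_Res.hyps by (rule tau.tau_Res)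
  from prel_ResD[OF tau_Res.prems(1)] show ?case
  proof (elim disjE exE conjE)
    fix ch ts p
    assume "out_thread s ch ts p" "k = 0"
      and t: "DRes t = handshake L r (Cmp (Nm 0) (rent Suc (data_tm r ch ts))) (denc L r p)"
    show ?thesis using handshake_tauE[OF tau[unfolded t]] by simp
  next
    assume t: "DRes t = pending L r (denc L r s)" "k = 1"
    have "dscong (DRes t') (denc L r s)" using handshake_tauE[OF tau[unfolded t(1)]] by simp
    then show ?thesis using t(2) pr_enc[of L r s] by auto
  next
    fix s0 assume s: "s = DRes s0" "prel L (Suc r) s0 t k"
    from tau_Res.IH[OF s(2)] show ?thesis
      unfolding s(1) by (blast intro: tau.tau_Res pr_Res dc_Res)
  qed
next
  case (tau_unfold t t1 t')
  obtain s' where s': "unfold s s'" "prel L r s' t1 k"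
    using prel_unfold[OF tau_unfold.prems tau_unfold.hyps(1)] by blast
  \<comment> \<open>Only an encoding can unfold, and there nothing is pending. This excludes the
    second alternative of the induction hypothesis, which would relate the result to the unfolded
    \<open>s'\<close> rather than to \<open>s\<close>.\<close>
  have "k = 0" using tau_unfold.hyps(1) tau_unfold.prems by (cases rule: prel.cases[OF tau_unfold.prems]) (auto simp: handshake_def)
  then show ?case using tau_unfold.IH[OF s'(2)] s'(1) by (blast intro: tau.tau_unfold)
qed

lemma prel_0: "prel L r s t 0 \<Longrightarrow> t = denc L r s"
  by (induction r s t "0::nat" rule: prel.induct) auto

text \<open>A pending handshake contains both partners of its communication, so it can always be
  completed.\<close>

lemma prel_drain:
  "prel L r s t k \<Longrightarrow> k = Suc j \<Longrightarrow> \<exists>t' v. tau t t' \<and> dscong t' v \<and> prel L r s v j"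
proof (induction arbitrary: j rule: prel.induct)
  case (pr_pending r s)
  then show ?case using pending_tau[of L r "denc L r s"] prel.pr_enc[of L r s] by auto
next
  case (pr_Par r s1 t1 k1 s2 t2 k2)
  show ?case
  proof (cases k1)
    case 0
    then have "k2 = Suc j" using pr_Par.prems by simp
    from pr_Par.IH(2)[OF this] obtain t' v where "tau t2 t'" "dscong t' v" "prel L r s2 v j" by blast
    moreover have "prel L r (DPar s1 s2) (DPar t1 v) (k1 + j)" using pr_Par.hyps(1) calculation(3) by (rule prel.pr_Par)
    ultimately show ?thesis using 0 by (auto intro: tau_Par2 dc_Par2)
  next
    case (Suc i)
    from pr_Par.IH(1)[OF this] obtain t' v where "tau t1 t'" "dscong t' v" "prel L r s1 v i" by blast
    moreover have "prel L r (DPar s1 s2) (DPar v t2) (i + k2)" using calculation(3) pr_Par.hyps(2) by (rule prel.pr_Par)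
    moreover have "j = i + k2" using Suc pr_Par.prems by simp
    ultimately show ?thesis by (blast intro: tau_Par1 dc_Par)
  qed
next
  case (pr_Res r s t k)
  then show ?case by (blast intro: tau_Res prel.pr_Res dc_Res)
qed simp

text \<open>Delay can only hide success: a pending continuation is guarded in the target but already
  released in the source. The converse is proved for encodings, by \<open>denc_tops\<close>.\<close>

lemma prel_tops: "prel L r s t k \<Longrightarrow> tops t \<Longrightarrow> tops s"
proof (induction rule: prel.induct)
  case (pr_enc r s)
  then show ?case
    by (induction s arbitrary: r) (auto simp: handshake_def await_def dout_def split: synchronism.splits if_splits)
qed (auto simp: handshake_def await_def dout_def split: synchronism.splits)

lemma denc_tops: "tops s \<Longrightarrow> tops (denc L r s)"
  by (induction s arbitrary: r) auto

text \<open>The output sends from below its restriction, so the match is weakened first and the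
  receiver's continuation is renamed by a lifted \<open>Suc\<close>.\<close>

lemma denc_comm:
  assumes "out_thread p ch ts p'" "dmatches ts ps = Some vs"
  shows "\<exists>t v. tau (DPar (denc L r p) (denc L r (DIn ch ps q))) t \<and> dscong t v \<and>
    prel L r (DPar p' (ds (inst vs) q)) v 1"
proof -
  let ?f = "\<lambda>i. Nm (Suc i)" let ?d = "data_tm r ch ts" let ?q = "denc L r (ds (inst vs) q)"
  have "dmatches (rents Suc ts) (map (dps ?f) ps) = Some (rents Suc vs)"
    using assms(2) by (simp add: dmatches_ren)
  from inp_denc[OF this, of L "Suc r" "rento Suc ch" "ren (upf (nbs ps) Suc) q" "Nm 0"]
  have "inp (ren Suc (denc L r (DIn ch ps q))) (tchan L (Suc r)) [Cmp (Nm 0) (rent Suc ?d)]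
      (DPar (dout L (Suc r) (Nm 0)) (ren Suc ?q))"
    using dmatches_length[OF assms(2)]
    unfolding denc_ren by (simp add: up_ren ren_inst data_tm_subst[of ?f r "Suc r"] del: denc.simps)
  then have "send (handshake L r (Cmp (Nm 0) (rent Suc ?d)) (denc L r p')) (denc L r (DIn ch ps q))
      (DRes (DPar (DPar DNull (DPar (dout L (Suc r) (Nm 0)) (ren Suc ?q))) (await L r (denc L r p'))))"
    unfolding handshake_def by (intro send_Res send_Par1 dout_send)
  moreover have "denc L r p = handshake L r (Cmp (Nm 0) (rent Suc ?d)) (denc L r p')"
    using assms(1) by (cases p) auto
  moreover have "dscong (DRes (DPar (DPar DNull (DPar (dout L (Suc r) (Nm 0)) (ren Suc ?q))) (await L r (denc L r p'))))
      (DPar (pending L r (denc L r p')) ?q)"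
    by (rule handshake_scong[OF dc_refl])
  moreover have "prel L r (DPar p' (ds (inst vs) q)) (DPar (pending L r (denc L r p')) ?q) (1 + 0)"
    by (intro pr_Par pr_pending pr_enc)
  ultimately show ?thesis using tau_comm1 by (metis add_0_right)
qed

text \<open>The encoding is homomorphic on every operator that occurs in a structural law, and for
  the laws of restriction it commutes with \<open>swap01\<close> and weakening.\<close>

lemma denc_scong: "dscong p q \<Longrightarrow> dscong (denc L r p) (denc L r q)"
proof (induction arbitrary: r rule: dscong.induct)
  case (dc_res_comm p)
  have "denc L (Suc (Suc r)) (ren swap01 p) = ren swap01 (denc L (Suc (Suc r)) p)"
    by (simp add: denc_ren)
  then show ?case using dscong.dc_res_comm by simp
next
  case (dc_scope p q)
  have "denc L (Suc r) (ren Suc p) = ren Suc (denc L r p)" by (simp add: denc_ren)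
  then show ?case using dscong.dc_scope by simp
next
  case (dc_unfold p q)
  then show ?case by (auto intro!: dscong.dc_unfold elim!: unfold.cases)
next
  case (dc_trans p q u)
  then show ?case by (blast intro: dscong.dc_trans)
qed (auto intro: dscong.intros)

section \<open>The encoding\<close>

abbreviation shift_tm :: "tm \<Rightarrow> tm" where
  "shift_tm \<equiv> subst_tm (\<lambda>a. Nm (a + 2))"

abbreviation shift_pat :: "pat \<Rightarrow> pat" where
  "shift_pat \<equiv> subst_pat (\<lambda>a. a + 2) (\<lambda>a. Nm (a + 2))"

definition out_proc :: "lang \<Rightarrow> tm \<Rightarrow> proc" where
  "out_proc L t =
     (case synchronism L of
        Asynchronous \<Rightarrow> Out (tchan L 0) [t]
      | Synchronous \<Rightarrow> OutC (tchan L 0) [t] Null)"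

primrec list_pat :: "pat list \<Rightarrow> pat" where
  "list_pat [] = Match 0"
| "list_pat (p # ps) = PCmp p (list_pat ps)"

definition data_pat :: "tm option \<Rightarrow> pat list \<Rightarrow> pat" where
  "data_pat ch ps = PCmp (match_tm (chan_tm 0 ch)) (list_pat ps)"

definition out_then :: "lang \<Rightarrow> tm option \<Rightarrow> tm list \<Rightarrow> proc \<Rightarrow> proc" where
  "out_then L ch ts P =
     Res 1 (Par (out_proc L (Cmp (Nm 1) (data_tm 0 (map_option shift_tm ch) (map shift_tm ts))))
       (In (tchan L 0) [Match 1] P))"

text \<open>
  The name \<open>0\<close> is reserved as the channel of all communications and as the tag inside data; the
  name \<open>1\<close>, always bound, carries the acknowledgement.
\<close>

primrec enc :: "lang \<Rightarrow> proc \<Rightarrow> proc" where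
  "enc L Null = Null"
| "enc L (Out ch ts) = out_then L ch ts Null"
| "enc L (OutC ch ts P) = out_then L ch ts (enc L P)"
| "enc L (In ch ps P) =
     In (tchan L 0) [PCmp (Bind 1) (data_pat (map_option shift_tm ch) (map shift_pat ps))]
       (Par (out_proc L (Nm 1)) (enc L P))"
| "enc L (Res n P) = Res (n + 2) (enc L P)"
| "enc L (Par P Q) = Par (enc L P) (enc L Q)"
| "enc L (Cond s t P Q) = Cond (shift_tm s) (shift_tm t) (enc L P) (enc L Q)"
| "enc L (Rep P) = Rep (enc L P)"
| "enc L Succ = Succ"

lemma interp_out_proc: "\<rho> 0 = Nm r \<Longrightarrow> interp \<rho> (out_proc L t) = dout L r (subst_tm \<rho> t)"
  by (simp add: out_proc_def dout_def tchan_subst split: synchronism.splits)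

lemma dp_list_pat: "\<rho> 0 = Nm r \<Longrightarrow> dp \<rho> (list_pat ps) = list_dpat r (map (dp \<rho>) ps)"
  by (induction ps) auto

lemma dp_data_pat:
  "\<rho> 0 = Nm r \<Longrightarrow> dp \<rho> (data_pat ch ps) = data_dpat r (map_option (subst_tm \<rho>) ch) (map (dp \<rho>) ps)"
  by (simp add: data_pat_def data_dpat_def chan_tm_subst dp_list_pat)

lemma binders_list_pat [simp]: "binders_pat (list_pat ps) = binders ps"
  by (induction ps) auto

lemma binders_data_pat [simp]: "binders_pat (data_pat ch ps) = binders ps"
  by (simp add: data_pat_def)

lemma ext_Nil [simp]: "ext [] \<rho> = \<rho>"
  by (auto simp: ext_def)

text \<open>The second hypothesis expresses that the continuation does not use name 1. Encodings
  satisfy it, because source names are shifted by 2.\<close>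

lemma interp_out_then:
  assumes "\<rho> 0 = Nm r" and "interp (ext [1] \<rho>) P = ren Suc p"
  shows "interp \<rho> (out_then L ch ts P) = handshake L r
    (Cmp (Nm 0) (rent Suc (data_tm r (map_option (subst_tm (\<lambda>a. \<rho> (a + 2))) ch) (map (subst_tm (\<lambda>a. \<rho> (a + 2))) ts)))) p"
proof -
  have e: "ext [1] \<rho> 0 = Nm (Suc r)" "ext [1] \<rho> 1 = Nm 0" "\<And>a. ext [1] \<rho> (a + 2) = rent Suc (\<rho> (a + 2))"
    using assms(1) by (auto simp: ext_def sh_def)
  have "subst_tm (ext [1] \<rho>) (shift_tm t) = rent Suc (subst_tm (\<lambda>a. \<rho> (a + 2)) t)" for t
    by (simp only: subst_tm_comp subst_tm.simps e(3))
  then have "map_option (subst_tm (ext [1] \<rho>)) (map_option shift_tm ch) =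
      rento Suc (map_option (subst_tm (\<lambda>a. \<rho> (a + 2))) ch)"
    "map (subst_tm (ext [1] \<rho>)) (map shift_tm ts) = rents Suc (map (subst_tm (\<lambda>a. \<rho> (a + 2))) ts)"
    by (simp_all only: option.map_comp list.map_comp o_def)
  moreover have "subst_tm (ext [1] \<rho>) (data_tm 0 (map_option shift_tm ch) (map shift_tm ts)) =
      data_tm (Suc r) (map_option (subst_tm (ext [1] \<rho>)) (map_option shift_tm ch))
        (map (subst_tm (ext [1] \<rho>)) (map shift_tm ts))"
    by (rule data_tm_subst) (rule e(1))
  moreover have "rent Suc (data_tm r c us) = data_tm (Suc r) (rento Suc c) (rents Suc us)" for c us
    by (rule data_tm_subst) simp
  ultimately have "subst_tm (ext [1] \<rho>) (data_tm 0 (map_option shift_tm ch) (map shift_tm ts)) =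
      rent Suc (data_tm r (map_option (subst_tm (\<lambda>a. \<rho> (a + 2))) ch) (map (subst_tm (\<lambda>a. \<rho> (a + 2))) ts))"
    by metis
  then show ?thesis
    using assms(2) e by (simp add: out_then_def handshake_def await_def interp_out_proc tchan_subst)
qed

text \<open>Reduces statements on \<open>enc\<close> to \<open>denc\<close>: source names are looked
  up through the shift, and the index of the reserved name is the value of the environment at
  0.\<close>

lemma interp_enc: "\<rho> 0 = Nm r \<Longrightarrow> interp \<rho> (enc L P) = denc L r (interp (\<lambda>a. \<rho> (a + 2)) P)"
proof (induction P arbitrary: \<rho> r)
  case (Out ch ts)
  show ?case using interp_out_then[of \<rho> r Null DNull L ch ts] Out by simp
next
  case (OutC ch ts P)
  have "ext [1] \<rho> 0 = Nm (Suc r)" using OutC.prems by (simp add: ext_def)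
  from OutC.IH[of "ext [1] \<rho>", OF this]
  have "interp (ext [1] \<rho>) (enc L P) = denc L (Suc r) (interp (\<lambda>a. ext [1] \<rho> (a + 2)) P)" .
  also have "(\<lambda>a. ext [1] \<rho> (a + 2)) = (\<lambda>a. rent Suc (\<rho> (a + 2)))" by (auto simp: ext_def sh_def)
  also have "denc L (Suc r) (interp \<dots> P) = ren Suc (denc L r (interp (\<lambda>a. \<rho> (a + 2)) P))"
    by (simp add: denc_ren ds_interp)
  finally show ?case using interp_out_then[of \<rho>, OF OutC.prems] by simp
next
  case (In ch ps P)
  let ?k = "length (binders ps)" let ?xs = "1 # map (\<lambda>a. a + 2) (binders ps)"
  have e: "ext ?xs \<rho> 0 = Nm (Suc (r + ?k))" "ext ?xs \<rho> 1 = Nm 0"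
    using In.prems by (auto simp: ext_def)
  have "ext ?xs \<rho> (a + 2) = rent Suc (ext (binders ps) (\<lambda>a. \<rho> (a + 2)) a)" for a
    using pos_map[of "\<lambda>a. a + 2" "binders ps" a]
    by (auto simp: ext_def sh_def subst_tm_comp image_iff inj_on_def)
  then have "interp (ext ?xs \<rho>) (enc L P) =
      ren Suc (denc L (r + ?k) (interp (ext (binders ps) (\<lambda>a. \<rho> (a + 2))) P))"
    by (simp only: In.IH[of "ext ?xs \<rho>", OF e(1)] denc_ren ds_interp)
  then show ?case
    using In.prems e
    by (simp add: tchan_subst dp_data_pat interp_out_proc option.map_comp o_def subst_tm_comp dp_subst_pat)
next
  case (Res n P)
  have "ext [n + 2] \<rho> 0 = Nm (Suc r)" using Res.prems by (simp add: ext_def)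
  moreover have "(\<lambda>a. ext [n + 2] \<rho> (a + 2)) = ext [n] (\<lambda>a. \<rho> (a + 2))" by (auto simp: ext_def)
  ultimately show ?case using Res.IH by simp
qed (auto simp: subst_tm_comp)

text \<open>The shift leaves index 0 to the reserved name, so encodings can be interpreted in the
  environment \<open>Nm\<close>.\<close>

abbreviation src :: "proc \<Rightarrow> dproc" where
  "src S \<equiv> ren (\<lambda>a. a + 2) (interp Nm S)"

lemma src_eq: "src S = nint (\<lambda>a. a + 2) S"
  by (simp add: ds_interp)

lemma interp_Nm_enc: "interp Nm (enc L S) = denc L 0 (src S)"
  by (simp add: interp_enc ds_interp)

text \<open>Each message is one packed term and each pattern is single, which suits every arity;
  \<open>dout\<close> and \<open>tchan\<close> adapt to synchronism and medium. Only compounds need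
  the intensional target.\<close>

lemma din_denc: "matching L = Intensional \<Longrightarrow> din L (denc L r d)"
proof (induction d arbitrary: r)
  have "ok_channel L (tchan L r)" for r
    by (auto simp: ok_channel_def tchan_def ok_tm_def split: medium.splits)
  moreover assume "matching L = Intensional"
  ultimately have 1: "din L (dout L r t)" and 2: "din L p \<Longrightarrow> din L (handshake L r t p)"
    and 3: "ok_channel L (tchan L r)" for r t p
    by (auto simp: dout_def handshake_def await_def ok_out_def ok_arity_def ok_tm_def dok_pat_def
        split: synchronism.splits)
  { case (DOut ch ts) then show ?case using 2 by simp }
  { case (DOutC ch ts d) then show ?case using 2 by simp }
  { case (DIn ch ps d) then show ?case using 1 3 by (simp add: ok_arity_def dok_pat_def) }
qed auto

lemma pwf_enc: "pwf P \<Longrightarrow> pwf (enc L P)"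
  by (induction P)
     (auto simp: out_then_def out_proc_def distinct_map inj_on_def split: synchronism.splits)

section \<open>Compositionality contexts\<close>

definition out_ctx :: "lang \<Rightarrow> tm \<Rightarrow> ctx" where
  "out_ctx L t =
     (case synchronism L of
        Asynchronous \<Rightarrow> COut (tchan L 0) [t]
      | Synchronous \<Rightarrow> COutC (tchan L 0) [t] CNull)"

lemma out_ctx [simp]: "fill (out_ctx L t) F = out_proc L t" "holes (out_ctx L t) = []"
  by (auto simp: out_ctx_def out_proc_def split: synchronism.splits)

definition out_then_ctx :: "lang \<Rightarrow> tm option \<Rightarrow> tm list \<Rightarrow> ctx \<Rightarrow> ctx" where
  "out_then_ctx L ch ts C =
     CRes 1 (CPar (out_ctx L (Cmp (Nm 1) (data_tm 0 (map_option shift_tm ch) (map shift_tm ts))))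
       (CIn (tchan L 0) [Match 1] C))"

primrec enc_ctx :: "lang \<Rightarrow> ctx \<Rightarrow> ctx" where
  "enc_ctx L (Hole i) = Hole i"
| "enc_ctx L CNull = CNull"
| "enc_ctx L (COut ch ts) = out_then_ctx L ch ts CNull"
| "enc_ctx L (COutC ch ts C) = out_then_ctx L ch ts (enc_ctx L C)"
| "enc_ctx L (CIn ch ps C) =
     CIn (tchan L 0) [PCmp (Bind 1) (data_pat (map_option shift_tm ch) (map shift_pat ps))]
       (CPar (out_ctx L (Nm 1)) (enc_ctx L C))"
| "enc_ctx L (CRes n C) = CRes (n + 2) (enc_ctx L C)"
| "enc_ctx L (CPar C D) = CPar (enc_ctx L C) (enc_ctx L D)"
| "enc_ctx L (CCond s t C D) = CCond (shift_tm s) (shift_tm t) (enc_ctx L C) (enc_ctx L D)"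
| "enc_ctx L (CRep C) = CRep (enc_ctx L C)"
| "enc_ctx L CSucc = CSucc"

text \<open>Each operator is translated into fixed surroundings of its translated arguments, so
  translating the context once works for all fillings.\<close>

lemma enc_fill: "enc L (fill C F) = fill (enc_ctx L C) (\<lambda>i. enc L (F i))"
  by (induction C) (auto simp: out_then_def out_then_ctx_def)

lemma holes_enc_ctx: "holes (enc_ctx L C) = holes C"
  by (induction C) (auto simp: out_then_ctx_def)

lemma rename_procs: "P \<in> procs L \<Longrightarrow> rename f P \<in> procs L"
  using procs_iff[of P L f] procs_iff[of "rename f P" L "\<lambda>a. a"]
  by (simp add: interp_rename) (simp add: rename_def)

lemma procs_alpha: "P \<in> procs L \<Longrightarrow> Q \<in> procs L \<Longrightarrow> interp Nm P = interp Nm Q \<Longrightarrow> P =\<^sub>\<alpha> Q"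
  using procs_iff[of P L "\<lambda>a. a"] procs_iff[of Q L "\<lambda>a. a"] alpha_complete[of "\<lambda>a. a" P _ Q]
  by (simp add: inj_def)

lemma scong_refl: "P \<in> procs L \<Longrightarrow> scong L P P"
  by (rule sc_alpha) (auto intro: alpha_refl)

section \<open>Simulation in both directions and the criteria for validity\<close>

lemma denc_match:
  assumes "matches ts ps = Some \<sigma>" "In ch ps Q \<in> procs L" "inj f" "out_thread p (rento f ch) (rents f ts) p'"
  shows "\<exists>t v. tau (DPar (denc L2 r p) (denc L2 r (nint f (In ch ps Q)))) t \<and> dscong t v \<and>
    prel L2 r (DPar p' (nint f (map_subst \<sigma> Q))) v 1"
proof -
  have "distinct (binders ps)" using assms(2) by (simp add: procs_def ok_in_def)
  from matches_sound[OF assms(1) this assms(3), of Q] obtain vs where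
    vs: "dmatches (rents f ts) (map (rdp f) ps) = Some vs"
    "nint f (map_subst \<sigma> Q) = ds (inst vs) (nint (enf (binders ps) f) Q)" .
  from denc_comm[OF assms(4) vs(1), of L2 r "nint (enf (binders ps) f) Q"] show ?thesis
    unfolding vs(2) by (simp add: ext_Nm)
qed

text \<open>Induction on \<open>red\<close> itself: the congruences of \<open>red_scong\<close> are
  absorbed by \<open>denc_scong\<close> and \<open>tau_scong\<close> before the step and by the
  intermediate \<open>s\<close> after it. \<open>s\<close> also hides the \<open>DNull\<close> left
  by an asynchronous output.\<close>

lemma red_denc:
  "red L P P' \<Longrightarrow> inj f \<Longrightarrow>
    \<exists>t v s. tau (denc L2 r (nint f P)) t \<and> dscong t v \<and> prel L2 r s v 1 \<and> dscong s (nint f P')"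
proof (induction arbitrary: f r rule: red.induct)
  case (red_async ch ts ps Q \<sigma>)
  have "In ch ps Q \<in> procs L" using red_async(1) by (simp add: procs_simps)
  from denc_match[OF red_async(2) this red_async.prems, of "nint f (Out ch ts)" DNull L2 r] show ?case
    using dc_nil2 unfolding interp.simps(6) denc.simps(6) by fastforce
next
  case (red_sync ch ts P ps Q \<sigma>)
  have "In ch ps Q \<in> procs L" using red_sync(1) by (simp add: procs_simps)
  from denc_match[OF red_sync(2) this red_sync.prems, of "nint f (OutC ch ts P)" "nint f P" L2 r] show ?case
    using dc_refl unfolding interp.simps(6) denc.simps(6) by fastforce
next
  case (red_Par P P' Q)
  then obtain t v s where *: "tau (denc L2 r (nint f P)) t" "dscong t v" "prel L2 r s v 1" "dscong s (nint f P')"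
    by blast
  have "prel L2 r (DPar s (nint f Q)) (DPar v (denc L2 r (nint f Q))) (1 + 0)"
    using *(3) by (intro pr_Par pr_enc)
  then show ?case using * by (auto intro: tau_Par1 dc_Par)
next
  case (red_Res P P' n)
  then obtain t v s where *: "tau (denc L2 (Suc r) (nint (enf [n] f) P)) t" "dscong t v"
    "prel L2 (Suc r) s v 1" "dscong s (nint (enf [n] f) P')"
    using inj_enf by blast
  then show ?case unfolding nint_Res denc.simps by (blast intro: tau_Res dc_Res pr_Res)
next
  case (red_scong P Q Q' P')
  then obtain t v s where *: "tau (denc L2 r (nint f Q)) t" "dscong t v" "prel L2 r s v 1" "dscong s (nint f Q')"
    by blast
  obtain t' where "tau (denc L2 r (nint f P)) t'" "dscong t t'"
    using tau_scong[OF dc_sym[OF denc_scong[OF scong_sound[OF red_scong(1) red_scong.prems]]] *(1)] by blast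
  moreover from this have "dscong t' v" using *(2) dc_trans dc_sym by blast
  moreover have "dscong s (nint f P')"
    using dc_trans[OF *(4) scong_sound[OF red_scong(3) red_scong.prems]] .
  ultimately show ?case using *(3) by blast
qed

lemma tops_src: "tops (src S) \<longleftrightarrow> tops (interp Nm S)"
  by (rule tops_ren) (simp add: inj_def)

context
  fixes L1 L2 :: lang
  assumes int: "matching L2 = Intensional"
begin

lemma enc_procs:
  assumes "P \<in> procs L1"
  shows "enc L2 P \<in> procs L2"
  using int assms procs_iff[of P L1 "\<lambda>a. a"] procs_iff[of "enc L2 P" L2 "\<lambda>a. a"]
  by (simp add: interp_Nm_enc din_denc pwf_enc)

lemma encoding_enc: "encoding L1 L2 (enc L2) (\<lambda>a. [a + 2])"
  unfolding encoding_def
proof (intro conjI ballI impI allI)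
  fix P Q assume "P \<in> procs L1" "Q \<in> procs L1" "P =\<^sub>\<alpha> Q"
  then show "enc L2 P =\<^sub>\<alpha> enc L2 Q"
    by (intro procs_alpha[of _ L2]) (auto simp: enc_procs interp_Nm_enc alpha_sound)
qed (auto simp: enc_procs)

lemma compositional_enc: "compositional L1 L2 (enc L2)"
  unfolding compositional_def
proof (intro allI impI)
  fix k Op N assume Op: "operator k Op \<and> context_of L1 k Op"
  have "fill (enc_ctx L2 Op) (\<lambda>_. Null) = enc L2 (fill Op (\<lambda>_. Null))" by (simp add: enc_fill)
  then have "context_of L2 k (enc_ctx L2 Op)"
    using Op enc_procs by (auto simp: context_of_def holes_enc_ctx)
  then show "\<exists>C. context_of L2 k C \<and>
      (\<forall>S. (\<forall>i<k. S i \<in> procs L1) \<and> (\<Union>i<k. fn (S i)) = N \<longrightarrow>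
         enc L2 (fill Op S) =\<^sub>\<alpha> fill C (\<lambda>i. enc L2 (S i)))"
    by (auto simp: enc_fill intro!: exI[of _ "enc_ctx L2 Op"] alpha_refl)
qed

lemma name_invariant_enc:
  assumes E: "\<And>P Q. scong L2 P Q \<Longrightarrow> (P, Q) \<in> E"
  shows "name_invariant L1 E (enc L2) (\<lambda>a. [a + 2])"
  unfolding name_invariant_def
proof (intro ballI allI impI)
  fix S \<sigma> assume S: "S \<in> procs L1" and \<sigma>: "name_subst \<sigma>"
  define \<sigma>' where "\<sigma>' b = (if b < 2 then b else \<sigma> (b - 2) + 2)" for b :: name
  have "{b. \<sigma>' b \<noteq> b} \<subseteq> (\<lambda>a. a + 2) ` {a. \<sigma> a \<noteq> a}"
  proof
    fix b assume "b \<in> {b. \<sigma>' b \<noteq> b}"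
    then have "b = (b - 2) + 2" "\<sigma> (b - 2) \<noteq> b - 2" by (auto simp: \<sigma>'_def split: if_splits)
    then show "b \<in> (\<lambda>a. a + 2) ` {a. \<sigma> a \<noteq> a}" by blast
  qed
  then have fin: "name_subst \<sigma>'"
    using \<sigma> finite_subset unfolding name_subst_def by blast
  have P: "enc L2 (rename \<sigma> S) \<in> procs L2" "rename \<sigma>' (enc L2 S) \<in> procs L2"
    using S enc_procs rename_procs by blast+
  have "interp Nm (enc L2 (rename \<sigma> S)) = denc L2 0 (interp (\<lambda>a. Nm (\<sigma> a + 2)) S)"
    by (simp add: interp_Nm_enc ds_interp interp_rename)
  moreover have "interp Nm (rename \<sigma>' (enc L2 S)) = denc L2 0 (interp (\<lambda>a. Nm (\<sigma> a + 2)) S)"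
    by (simp add: interp_rename interp_enc \<sigma>'_def)
  \<comment> \<open>The interpretations agree for every \<open>\<sigma>\<close>, injective or not,
    so alpha-equivalence covers both branches of the goal.\<close>
  ultimately have eq: "enc L2 (rename \<sigma> S) =\<^sub>\<alpha> rename \<sigma>' (enc L2 S)"
    using P by (intro procs_alpha[of _ L2]) auto
  then have "(enc L2 (rename \<sigma> S), rename \<sigma>' (enc L2 S)) \<in> E"
    using P by (intro E sc_alpha)
  moreover have "\<sigma>' b = b" if "b \<notin> (\<Union>a. set [a + 2])" for b
  proof -
    have "b < 2"
    proof (rule ccontr)
      assume "\<not> b < 2"
      then have "b = (b - 2) + 2" by simp
      then show False using that by auto
    qed
    then show ?thesis by (simp add: \<sigma>'_def)
  qed
  ultimately show "\<exists>\<sigma>'. name_subst \<sigma>' \<and> (\<forall>a. [\<sigma> a + 2] = map \<sigma>' [a + 2]) \<and>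
      (\<forall>b. b \<notin> (\<Union>a. set [a + 2]) \<longrightarrow> \<sigma>' b = b) \<and>
      (if inj \<sigma> then enc L2 (rename \<sigma> S) =\<^sub>\<alpha> rename \<sigma>' (enc L2 S)
       else (enc L2 (rename \<sigma> S), rename \<sigma>' (enc L2 S)) \<in> E)"
    using fin eq by (intro exI[of _ \<sigma>']) (auto simp: \<sigma>'_def)
qed

text \<open>One source step costs two target steps: the data exchange, then the acknowledgement
  delivered by \<open>prel_drain\<close>.\<close>

lemma enc_red:
  assumes red: "red L1 S S'"
  shows "\<exists>T1 T2. red L2 (enc L2 S) T1 \<and> red L2 T1 T2 \<and> scong L2 T2 (enc L2 S')"
proof -
  have S: "S \<in> procs L1" "S' \<in> procs L1" using red_procs[OF red] by auto
  have "inj (\<lambda>a::nat. a + 2)" by (simp add: inj_def)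
  from red_denc[OF red this, of L2 0] obtain t v s where
    t: "tau (interp Nm (enc L2 S)) t" "dscong t v" "prel L2 0 s v 1" "dscong s (src S')"
    unfolding interp_Nm_enc src_eq by blast
  obtain t1 v1 where t1: "tau v t1" "dscong t1 v1" "prel L2 0 s v1 0"
    using prel_drain[OF t(3), of 0] by auto
  obtain t2 where t2: "tau t t2" "dscong t1 t2" using tau_scong[OF dc_sym[OF t(2)] t1(1)] by blast
  have "v1 = denc L2 0 s" using t1(3) by (rule prel_0)
  then have "dscong v1 (interp Nm (enc L2 S'))" using denc_scong[OF t(4)] by (simp only: interp_Nm_enc)
  then have sc: "dscong t2 (interp Nm (enc L2 S'))"
    using dc_trans[OF dc_sym[OF t2(2)] dc_trans[OF t1(2)]] by blast
  obtain T1 where T1: "red L2 (enc L2 S) T1" "interp Nm T1 = t"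
    using red_complete[OF t(1) enc_procs[OF S(1)]] by blast
  have "T1 \<in> procs L2" using red_procs[OF T1(1)] by blast
  then obtain T2 where T2: "red L2 T1 T2" "interp Nm T2 = t2"
    using red_complete[of T1 t2 L2] t2(1) T1(2) by blast
  have "T2 \<in> procs L2" using red_procs[OF T2(1)] by blast
  then have "scong L2 T2 (enc L2 S')"
    using sc T2(2) enc_procs[OF S(2)] by (simp add: scong_iff)
  then show ?thesis using T1 T2 by blast
qed

lemma enc_reds: "reds L1 S S' \<Longrightarrow> S \<in> procs L1 \<Longrightarrow> \<exists>T. reds L2 (enc L2 S) T \<and> scong L2 T (enc L2 S')"
proof (induction rule: rtranclp_induct)
  case base
  then show ?case using scong_refl[OF enc_procs] by blast
next
  case (step S1 S2)
  then obtain T where T: "reds L2 (enc L2 S) T" "scong L2 T (enc L2 S1)" by blast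
  obtain T1 T2 where *: "red L2 (enc L2 S1) T1" "red L2 T1 T2" "scong L2 T2 (enc L2 S2)"
    using enc_red[OF step.hyps(2)] by blast
  have "T1 \<in> procs L2" using red_procs[OF *(1)] by blast
  then have "red L2 T T1" using red_scong[OF T(2) *(1)] scong_refl by blast
  then show ?case using T(1) *(2,3) by (meson rtranclp.rtrancl_into_rtrancl)
qed

text \<open>\<open>prel\<close> up to structural equivalence, on named processes. The parameter
  \<open>k\<close> counts the acknowledgements still due.\<close>

definition simul :: "nat \<Rightarrow> proc \<Rightarrow> proc \<Rightarrow> bool" where
  "simul k T S \<longleftrightarrow>
     S \<in> procs L1 \<and> T \<in> procs L2 \<and> (\<exists>v. prel L2 0 (src S) v k \<and> dscong v (interp Nm T))"

lemma simul_enc: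
  "S \<in> procs L1 \<Longrightarrow> simul 0 (enc L2 S) S"
  using pr_enc[of L2 0 "src S"] enc_procs by (fastforce simp: simul_def interp_Nm_enc)

lemma simul_red:
  assumes "simul k T S" "red L2 T T'"
  shows "(\<exists>S' k'. red L1 S S' \<and> simul k' T' S') \<or> (\<exists>k'<k. simul k' T' S)"
proof -
  obtain v where v: "prel L2 0 (src S) v k" "dscong v (interp Nm T)" and S: "S \<in> procs L1"
    using assms(1) by (auto simp: simul_def)
  have T': "T' \<in> procs L2" using red_procs[OF assms(2)] by blast
  have "\<exists>U. tau (interp Nm T) U \<and> dscong U (interp Nm T')"
    using red_sound[OF assms(2), of "\<lambda>a. a"] by (simp add: inj_def)
  then obtain U where U: "tau (interp Nm T) U" "dscong U (interp Nm T')" by blast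
  obtain w where w: "tau v w" "dscong U w" using tau_scong[OF dc_sym[OF v(2)] U(1)] by blast
  have wT: "dscong w (interp Nm T')" using dc_trans[OF dc_sym[OF w(2)] U(2)] .
  from prel_tau[OF w(1) v(1)] show ?thesis
  proof (elim disjE exE conjE)
    fix s' v' k' assume *: "tau (src S) s'" "prel L2 0 s' v' k'" "dscong w v'"
    have "inj (\<lambda>a::nat. a + 2)" by (simp add: inj_def)
    then obtain s1 where s1: "s' = ren (\<lambda>a. a + 2) s1" "tau (interp Nm S) s1"
      using tau_ren_inv[OF *(1) refl] by blast
    obtain S' where S': "red L1 S S'" "interp Nm S' = s1" using red_complete[OF s1(2) S] by blast
    have "dscong v' (interp Nm T')" using dc_trans[OF dc_sym[OF *(3)] wT] .
    then have "simul k' T' S'"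
      using T' red_procs[OF S'(1)] *(2) s1(1) S'(2) by (auto simp: simul_def)
    then show ?thesis using S'(1) by blast
  next
    fix v' k' assume *: "k' < k" "prel L2 0 (src S) v' k'" "dscong w v'"
    have "dscong v' (interp Nm T')" using dc_trans[OF dc_sym[OF *(3)] wT] .
    then show ?thesis using T' S * by (auto simp: simul_def)
  qed
qed

lemma simul_reds:
  "reds L2 T T' \<Longrightarrow> simul k T S \<Longrightarrow> \<exists>S' k'. reds L1 S S' \<and> simul k' T' S'"
proof (induction rule: rtranclp_induct)
  case (step T1 T2)
  then obtain S1 k1 where *: "reds L1 S S1" "simul k1 T1 S1" by blast
  from simul_red[OF *(2) step.hyps(2)] show ?case
    using *(1) by (meson rtranclp.rtrancl_into_rtrancl)
qed blast

text \<open>Delivering the acknowledgements one at a time ends in an encoding proper, by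
  \<open>prel_0\<close>.\<close>

lemma simul_drain: "simul k T S \<Longrightarrow> \<exists>T'. reds L2 T T' \<and> scong L2 T' (enc L2 S)"
proof (induction k arbitrary: T)
  case 0
  then obtain v where v: "prel L2 0 (src S) v 0" "dscong v (interp Nm T)" "S \<in> procs L1" "T \<in> procs L2"
    by (auto simp: simul_def)
  have "dscong (interp Nm T) (interp Nm (enc L2 S))"
    using prel_0[OF v(1)] dc_sym[OF v(2)] by (simp only: interp_Nm_enc)
  then have "scong L2 T (enc L2 S)"
    using v(3,4) enc_procs by (simp add: scong_iff)
  then show ?case by blast
next
  case (Suc k)
  then obtain v where v: "prel L2 0 (src S) v (Suc k)" "dscong v (interp Nm T)" "S \<in> procs L1" "T \<in> procs L2"
    by (auto simp: simul_def)
  obtain w w' where w: "tau v w" "dscong w w'" "prel L2 0 (src S) w' k"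
    using prel_drain[OF v(1) refl] by blast
  obtain U where U: "tau (interp Nm T) U" "dscong w U" using tau_scong[OF v(2) w(1)] by blast
  obtain T1 where T1: "red L2 T T1" "interp Nm T1 = U" using red_complete[OF U(1) v(4)] by blast
  have "dscong w' (interp Nm T1)" unfolding T1(2) using dc_trans[OF dc_sym[OF w(2)] U(2)] .
  then have "simul k T1 S" using w(3) v(3) red_procs[OF T1(1)] by (auto simp: simul_def)
  then show ?case using Suc.IH T1(1) by (meson converse_rtranclp_into_rtranclp)
qed

lemma operational_correspondence_enc:
  assumes E: "\<And>P Q. scong L2 P Q \<Longrightarrow> (P, Q) \<in> E"
  shows "operational_correspondence L1 L2 E (enc L2)"
  unfolding operational_correspondence_def
proof (intro conjI ballI allI impI)
  fix S S' assume "S \<in> procs L1" "reds L1 S S'"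
  then show "\<exists>T. reds L2 (enc L2 S) T \<and> (T, enc L2 S') \<in> E"
    using enc_reds E by blast
next
  fix S T assume "S \<in> procs L1" "reds L2 (enc L2 S) T"
  then obtain S' k where "reds L1 S S'" "simul k T S'"
    using simul_reds simul_enc by blast
  then show "\<exists>S' T'. reds L1 S S' \<and> reds L2 T T' \<and> (T', enc L2 S') \<in> E"
    using simul_drain E by blast
qed

text \<open>Steps that do not advance the source lower \<open>k\<close>, so only finitely many of
  them precede the next source step.\<close>

lemma simul_diverges_step:
  assumes "\<And>i. red L2 (f i) (f (Suc i))"
  shows "simul k (f i) S \<Longrightarrow> \<exists>j k' S'. red L1 S S' \<and> simul k' (f j) S'"
proof (induction k arbitrary: i rule: less_induct)
  case (less k)
  from simul_red[OF less.prems assms] show ?case using less.IH by blast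
qed

lemma divergence_reflecting_enc: "divergence_reflecting L1 L2 (enc L2)"
  unfolding divergence_reflecting_def
proof (intro ballI impI)
  fix S assume S: "S \<in> procs L1" and "diverges L2 (enc L2 S)"
  then obtain f where f: "f 0 = enc L2 S" "\<And>i. red L2 (f i) (f (Suc i))" by (auto simp: diverges_def)
  \<comment> \<open>Source processes related to some point of the infinite target run. Each has a
    reduct of the same kind, and dependent choice strings these into an infinite source run.\<close>
  define Q where "Q X = (\<exists>i k. simul k (f i) X)" for X
  have "Q S" unfolding Q_def using simul_enc[OF S] f(1) by metis
  moreover have "\<exists>Y. Q Y \<and> red L1 X Y" if "Q X" for X
    using that simul_diverges_step[of f, OF f(2)] unfolding Q_def by meson
  ultimately have "\<exists>g. \<forall>n. (Q (g n) \<and> (n = 0 \<longrightarrow> g n = S)) \<and> red L1 (g n) (g (Suc n))"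
    by (intro dependent_nat_choice) auto
  then show "diverges L1 S" unfolding diverges_def by blast
qed

lemma success_sensitive_enc: "success_sensitive L1 L2 (enc L2)"
  unfolding success_sensitive_def
proof (intro ballI iffI)
  fix S assume S: "S \<in> procs L1"
  then have encS: "enc L2 S \<in> procs L2" using enc_procs by blast
  show "succeeds L2 (enc L2 S)" if "succeeds L1 S"
  proof -
    obtain S' where S': "reds L1 S S'" "tops (interp Nm S')" using \<open>succeeds L1 S\<close> succeeds_iff[OF S] by blast
    obtain T where T: "reds L2 (enc L2 S) T" "scong L2 T (enc L2 S')" using enc_reds[OF S'(1) S] by blast
    have "tops (interp Nm (enc L2 S'))"
      unfolding interp_Nm_enc using S'(2) by (intro denc_tops) (simp only: tops_src)
    moreover have "dscong (interp Nm T) (interp Nm (enc L2 S'))"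
      using T(2) scong_procs[OF T(2)] scong_iff by blast
    ultimately show ?thesis using T(1) succeeds_iff[OF encS] tops_scong by blast
  qed
  show "succeeds L1 S" if "succeeds L2 (enc L2 S)"
  proof -
    obtain T where T: "reds L2 (enc L2 S) T" "tops (interp Nm T)"
      using \<open>succeeds L2 (enc L2 S)\<close> succeeds_iff[OF encS] by blast
    obtain S' k where S': "reds L1 S S'" "simul k T S'"
      using simul_reds[OF T(1) simul_enc[OF S]] by blast
    then obtain v where "prel L2 0 (src S') v k" "dscong v (interp Nm T)" by (auto simp: simul_def)
    \<comment> \<open>Acknowledgements may still be pending in \<open>T\<close>, but success seen
      despite them is already present in \<open>S'\<close>.\<close>
    then have "tops (interp Nm S')" using T(2) tops_scong prel_tops tops_src by blast
    then show ?thesis using S'(1) succeeds_iff[OF S] by blast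
  qed
qed

end

theorem theorem16:
  fixes \<alpha>1 \<alpha>2 :: synchronism and \<beta>1 \<beta>2 :: arity and \<gamma>1 \<gamma>2 :: medium and \<delta>1 :: matching
    and E :: "proc rel"
  assumes "reference_equivalence (Lang \<alpha>2 \<beta>2 \<gamma>2 Intensional) E"
  shows "\<exists>enc \<phi>. valid_encoding (Lang \<alpha>1 \<beta>1 \<gamma>1 \<delta>1) (Lang \<alpha>2 \<beta>2 \<gamma>2 Intensional) E enc \<phi>"
proof -
  let ?L1 = "Lang \<alpha>1 \<beta>1 \<gamma>1 \<delta>1" and ?L2 = "Lang \<alpha>2 \<beta>2 \<gamma>2 Intensional"
  have int: "matching ?L2 = Intensional" by simp
  have E: "(P, Q) \<in> E" if "scong ?L2 P Q" for P Q
    using assms that by (simp add: reference_equivalence_def)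
  have "valid_encoding ?L1 ?L2 E (enc ?L2) (\<lambda>a. [a + 2])"
    unfolding valid_encoding_def
    using encoding_enc[OF int] compositional_enc[OF int] name_invariant_enc[OF int E]
      operational_correspondence_enc[OF int E] divergence_reflecting_enc[OF int] success_sensitive_enc[OF int]
    by blast
  then show ?thesis by blast
qed

end
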